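(* Let $\lambda>-1$. The predual of $A^1_\lambda(\mathcal{U})$ is isomorphic to $\widetilde{\mathcal{B}}_0$, with equivalent norms, under the pairing $$\langle f,g\rangle_\lambda=\int_{\mathcal{U}}\boldsymbol{\rho}(z)\,\mathcal{L}_nf(z)\,\overline{g(z)}\,dV_\lambda(z),\qquad f\in\widetilde{\mathcal{B}}_0,\ g\in A^1_\lambda(\mathcal{U}).$$ That is, the map $g\mapsto\langle\cdot,g\rangle_\lambda$ is a conjugate-linear bijection of $A^1_\lambda(\mathcal{U})$ onto the space of bounded linear functionals on $(\widetilde{\mathcal{B}}_0,\|\cdot\|_{\mathcal{B}})$, and there are constants $0<c\le C<\infty$ such that $c\|g\|_{1,\lambda}\le\|\langle\cdot,g\rangle_\lambda\|\le C\|g\|_{1,\lambda}$ for all $g\in A^1_\lambda(\mathcal{U})$, where $\|\langle\cdot,g\rangle_\lambda\|$ is the dual norm.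
   Context: Let $n$ be a positive integer; write $z=(z',z_n)\in\mathbb{C}^n$ with $z'=(z_1,\dots,z_{n-1})$. Put $\boldsymbol{\rho}(z)=\operatorname{Im}z_n-|z'|^2$, $\mathcal{U}=\{z\in\mathbb{C}^n:\boldsymbol{\rho}(z)>0\}$, $b\mathcal{U}=\{z\in\mathbb{C}^n:\boldsymbol{\rho}(z)=0\}$, $\mathbf{i}=(0',i)$. For $\lambda>-1$: $dV_\lambda=c_\lambda\boldsymbol{\rho}^\lambda dV$, with $dV$ Lebesgue measure on $\mathbb{C}^n$ and $c_\lambda=\frac{\Gamma(n+1+\lambda)}{4\pi^n\Gamma(1+\lambda)}$. $A^1_\lambda(\mathcal{U})$ is the space of holomorphic $f$ on $\mathcal{U}$ with $\|f\|_{1,\lambda}=\int_{\mathcal{U}}|f|\,dV_\lambda<\infty$. Let $\mathcal{L}_j=\partial_j+2i\overline{z}_j\partial_n$ for $1\le j\le n-1$ and $\mathcal{L}_n=\partial_n$, where $\partial_j=\partial/\partial z_j$. For $f$ holomorphic on $\mathcal{U}$ let $|\widetilde{\nabla}f|=\big(2\boldsymbol{\rho}\sum_{j=1}^{n-1}|\mathcal{L}_jf|^2+8\boldsymbol{\rho}^2|\mathcal{L}_nf|^2\big)^{1/2}$ and $\|f\|_{\mathcal{B}}=\sup_{\mathcal{U}}|\widetilde{\nabla}f|$. $\widetilde{\mathcal{B}}$ is the space of holomorphic $f$ on $\mathcal{U}$ with $\|f\|_{\mathcal{B}}<\infty$ and $f(\mathbf{i})=0$, normed by $\|\cdot\|_{\mathcal{B}}$.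 $C_0(\mathcal{U})$ is the space of complex-valued continuous functions $f$ on $\mathcal{U}$ with $f(z)\to0$ as $z\to b\mathcal{U}\cup\{\infty\}$. $\widetilde{\mathcal{B}}_0$ is the subspace of those $f\in\widetilde{\mathcal{B}}$ with $|\widetilde{\nabla}f|\in C_0(\mathcal{U})$. *)

theory Defs
  imports "HOL-Analysis.Analysis"
begin

text \<open>
  The space of \<open>n\<close> complex variables is \<open>complex ^ 'n\<close>, where \<open>'n\<close> is an arbitrary finite linearly
  ordered index type; \<open>n = CARD('n)\<close> and the coordinate \<open>z\<^sub>n\<close> is the one with the greatest index.
  The case \<open>n = 1\<close> is included, the block \<open>z'\<close> then being empty.

  Functions on the Siegel domain are represented by total functions that vanish outside of it,
  and functionals on a function space by total functions that vanish outside that space.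
  Thus equality of representatives is equality as functions on the domain, and pointwise
  sums and multiples of representatives are again representatives.
\<close>

type_synonym 'n cspace = "complex ^ 'n"

definition last_ix :: "'n::{finite,linorder}" where
  "last_ix = Max UNIV"

definition rho :: "'n::{finite,linorder} cspace \<Rightarrow> real" where
  "rho z = Im (z $ last_ix) - (\<Sum>j\<in>UNIV - {last_ix}. (cmod (z $ j))\<^sup>2)"

definition siegel :: "('n::{finite,linorder} cspace) set" where
  "siegel = {z. rho z > 0}"

definition siegel_bd :: "('n::{finite,linorder} cspace) set" where
  "siegel_bd = {z. rho z = 0}"

definition base_pt :: "'n::{finite,linorder} cspace" where
  "base_pt = axis last_ix \<i>"

definition c_lam :: "'n::{finite,linorder} itself \<Rightarrow> real \<Rightarrow> real" where
  "c_lam _ lam = Gamma (real CARD('n) + 1 + lam) / (4 * pi ^ CARD('n) * Gamma (1 + lam))"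

text \<open>The weighted measure, as a measure whose underlying space is the Siegel domain.\<close>

definition dV :: "real \<Rightarrow> ('n::{finite,linorder} cspace) measure" where
  "dV lam = density (restrict_space lborel siegel)
     (\<lambda>z. ennreal (c_lam TYPE('n) lam * rho z powr lam))"

text \<open>Holomorphy in several variables on an open set: complex differentiability, i.e.\ the real
  Frechet derivative exists and is complex linear (\<open>*s\<close> is complex scalar multiplication).\<close>

definition holomorphic_Cn_on :: "('n::finite cspace \<Rightarrow> complex) \<Rightarrow> ('n cspace) set \<Rightarrow> bool" where
  "holomorphic_Cn_on f S \<longleftrightarrow>
     (\<forall>z\<in>S. \<exists>D. (f has_derivative D) (at z) \<and> (\<forall>c h. D (c *s h) = c * D h))"

definition holo_siegel :: "('n::{finite,linorder} cspace \<Rightarrow> complex) set" where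
  "holo_siegel = {f. holomorphic_Cn_on f siegel \<and> (\<forall>z. z \<notin> siegel \<longrightarrow> f z = 0)}"

text \<open>On holomorphic functions \<open>\<partial>/\<partial>z\<^sub>j\<close> is the complex derivative in the \<open>j\<close>-th variable.\<close>

definition cpartial :: "'n::finite \<Rightarrow> ('n cspace \<Rightarrow> complex) \<Rightarrow> 'n cspace \<Rightarrow> complex" where
  "cpartial j f z = deriv (\<lambda>w. f (\<chi> i. if i = j then w else z $ i)) (z $ j)"

definition Lop :: "'n::{finite,linorder} \<Rightarrow> ('n cspace \<Rightarrow> complex) \<Rightarrow> 'n cspace \<Rightarrow> complex" where
  "Lop j f z = (if j = last_ix then cpartial last_ix f z
                else cpartial j f z + 2 * \<i> * cnj (z $ j) * cpartial last_ix f z)"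

definition inv_grad :: "('n::{finite,linorder} cspace \<Rightarrow> complex) \<Rightarrow> 'n cspace \<Rightarrow> real" where
  "inv_grad f z = sqrt (2 * rho z * (\<Sum>j\<in>UNIV - {last_ix}. (cmod (Lop j f z))\<^sup>2)
                        + 8 * (rho z)\<^sup>2 * (cmod (Lop last_ix f z))\<^sup>2)"

text \<open>The norm is meaningful only where the supremum is finite, which \<open>bloch\<close> demands.\<close>

definition bloch_norm :: "('n::{finite,linorder} cspace \<Rightarrow> complex) \<Rightarrow> real" where
  "bloch_norm f = (SUP z\<in>siegel. inv_grad f z)"

definition bloch :: "('n::{finite,linorder} cspace \<Rightarrow> complex) set" where
  "bloch = {f \<in> holo_siegel. bdd_above (inv_grad f ` siegel) \<and> f base_pt = 0}"

text \<open>The limit at infinity is taken within the Siegel domain.\<close>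

definition C0_siegel :: "('n::{finite,linorder} cspace \<Rightarrow> complex) \<Rightarrow> bool" where
  "C0_siegel f \<longleftrightarrow> continuous_on siegel f
     \<and> (\<forall>w\<in>siegel_bd. (f \<longlongrightarrow> 0) (at w within siegel))
     \<and> (f \<longlongrightarrow> 0) (inf at_infinity (principal siegel))"

definition bloch0 :: "('n::{finite,linorder} cspace \<Rightarrow> complex) set" where
  "bloch0 = {f \<in> bloch. C0_siegel (\<lambda>z. complex_of_real (inv_grad f z))}"

definition A1 :: "real \<Rightarrow> ('n::{finite,linorder} cspace \<Rightarrow> complex) set" where
  "A1 lam = {f \<in> holo_siegel. integrable (dV lam) f}"

definition A1_norm :: "real \<Rightarrow> ('n::{finite,linorder} cspace \<Rightarrow> complex) \<Rightarrow> real" where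
  "A1_norm lam f = (\<integral>z. cmod (f z) \<partial>(dV lam))"

definition bloch0_dual :: "(('n::{finite,linorder} cspace \<Rightarrow> complex) \<Rightarrow> complex) set" where
  "bloch0_dual = {\<Phi>.
     (\<forall>f\<in>bloch0. \<forall>g\<in>bloch0. \<forall>a b. \<Phi> (\<lambda>z. a * f z + b * g z) = a * \<Phi> f + b * \<Phi> g)
     \<and> (\<exists>K. \<forall>f\<in>bloch0. cmod (\<Phi> f) \<le> K * bloch_norm f)
     \<and> (\<forall>f. f \<notin> bloch0 \<longrightarrow> \<Phi> f = 0)}"

definition dual_norm :: "(('n::{finite,linorder} cspace \<Rightarrow> complex) \<Rightarrow> complex) \<Rightarrow> real" where
  "dual_norm \<Phi> = (SUP f\<in>{f \<in> bloch0. bloch_norm f \<le> 1}. cmod (\<Phi> f))"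

definition pair_integrand ::
  "('n::{finite,linorder} cspace \<Rightarrow> complex) \<Rightarrow> ('n cspace \<Rightarrow> complex) \<Rightarrow> 'n cspace \<Rightarrow> complex" where
  "pair_integrand f g z = complex_of_real (rho z) * Lop last_ix f z * cnj (g z)"

definition pairing ::
  "real \<Rightarrow> ('n::{finite,linorder} cspace \<Rightarrow> complex) \<Rightarrow> ('n cspace \<Rightarrow> complex) \<Rightarrow> complex" where
  "pairing lam f g = (\<integral>z. pair_integrand f g z \<partial>(dV lam))"

definition pair_functional ::
  "real \<Rightarrow> ('n::{finite,linorder} cspace \<Rightarrow> complex) \<Rightarrow> ('n cspace \<Rightarrow> complex) \<Rightarrow> complex" where
  "pair_functional lam g = (\<lambda>f. if f \<in> bloch0 then pairing lam f g else 0)"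

end

theory Submission
  imports Defs "HOL-Complex_Analysis.Complex_Analysis"
begin

text \<open>
  Write \<open>rr z w = (\<i>/2) (cnj w\<^sub>n - z\<^sub>n) - \<Sum> z\<^sub>j cnj w\<^sub>j\<close> for the polarisation of \<open>rho\<close>,
  \<open>s = n + 1 + lam\<close>, and let \<open>k\<^sub>w\<close> be the function in the little Bloch space whose derivative in
  \<open>z\<^sub>n\<close> is the Bergman kernel \<open>K(z, w) = rr z w powr - (s + 1)\<close> of weight \<open>lam + 1\<close>.
  By the reproducing formula, \<open>k\<^sub>w\<close> pairs with \<open>g\<close> to a constant times \<open>cnj (g w)\<close>.

  Given a bounded functional \<open>\<Phi>\<close>, put \<open>\<gamma> w = \<Phi> k\<^sub>w\<close>. Riemann sums of kernels are finite combinations of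
  the \<open>k\<^sub>w\<close>, so no vector-valued integration is needed: combinations with unimodular coefficients
  \<open>cnj (sgn (\<gamma> w))\<close> have bounded Bloch norm by the Forelli--Rudin estimate
  \<open>\<integral> |K(z, w)| dV\<^sub>lam(w) = C / rho z\<close>, whence \<open>\<integral> |\<gamma>| dV\<^sub>lam \<le> C \<parallel>\<Phi>\<parallel>\<close>; and Riemann sums of
  \<open>\<partial>\<^sub>n f = c \<integral> K(\<cdot>, w) rho(w) \<partial>\<^sub>n f(w) dV\<^sub>lam(w)\<close> converge to \<open>f\<close> in Bloch norm because
  \<open>rho \<partial>\<^sub>n f\<close> vanishes at the boundary and at infinity. The second fact represents \<open>\<Phi>\<close> as the pairing
  with a multiple of \<open>cnj \<gamma>\<close>, which then reproduces itself and is therefore holomorphic. The first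
  fact, applied to a pairing, gives the lower norm bound.

  Two reductions keep the analysis elementary. The Bloch norm is controlled by \<open>rho |\<partial>\<^sub>n f|\<close> alone.
  The reproducing formula is the mean value property of holomorphic functions on the unit ball,
  transported by a Cayley transform and an affine automorphism.
\<close>

text \<open>The domain is unbounded, so Riemann sums of \<open>ker p z w\<close> in \<open>w\<close>
  must converge uniformly over all \<open>z\<close>. This is possible because the error is relative:
  a small move of \<open>w\<close> within a compact set changes \<open>ker p z w\<close> by at most
  a small multiple of its own modulus, the same multiple for every \<open>z\<close>
  (\<open>ker_close\<close>). Integrating the modulus against \<open>dV lam\<close> turns such an
  error into a small multiple of \<open>1 / rho z\<close>, which is exactly what a supremum of
  \<open>rho\<close> times the last derivative tolerates. The weight \<open>lam + 1\<close> stems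
  from the factor \<open>rho\<close> in the pairing: together with the density of
  \<open>dV lam\<close> it is a multiple of \<open>rho powr (lam + 1)\<close>. The resulting
  exponent \<open>s + 1\<close>, that is \<open>n + 2 + lam\<close>, is also the one for which the
  Forelli-Rudin integral against \<open>dV lam\<close> scales like \<open>1 / rho z\<close>. A
  functional can only be evaluated at finite combinations of the \<open>kfun s w\<close>, so its
  integral bound is first proved on compact sets, with a constant independent of the set, and then
  extended by monotone convergence. The constants \<open>repc\<close> and \<open>FRv\<close> are
  never computed; positivity of the first and finiteness of the second suffice.\<close>

no_notation fps_nth (infixl \<open>$\<close> 75)

section \<open>Planar change of variables under injective holomorphic maps\<close>

definition real2_of_complex :: "complex \<Rightarrow> real ^ 2" where
  "real2_of_complex z = vector [Re z, Im z]"

definition complex_of_real2 :: "real ^ 2 \<Rightarrow> complex" where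
  "complex_of_real2 v = Complex (v $ 1) (v $ 2)"

lemma complex_of_real2_inverse [simp]:
  "complex_of_real2 (real2_of_complex z) = z" "real2_of_complex (complex_of_real2 v) = v"
  by (auto simp: complex_of_real2_def real2_of_complex_def vec_eq_iff forall_2)

lemma linear_complex_of_real2: "linear complex_of_real2"
  by (auto simp: linear_iff complex_of_real2_def complex_eq_iff)

lemma linear_real2_of_complex: "linear real2_of_complex"
  by (auto simp: linear_iff real2_of_complex_def vec_eq_iff forall_2)

lemma measurable_complex_of_real2 [measurable]: "complex_of_real2 \<in> borel_measurable borel"
  using linear_complex_of_real2
  by (intro borel_measurable_continuous_onI linear_continuous_on) (simp add: linear_conv_bounded_linear)

lemma prod_Basis_real2: "(\<Prod>b\<in>(Basis :: (real ^ 2) set). f b) = f (axis 1 1) * f (axis 2 1)"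
proof -
  have *: "(Basis :: (real ^ 2) set) = {axis 1 1, axis 2 1}"
    by (auto simp: Basis_vec_def UNIV_2)
  show ?thesis
    unfolding * by (subst prod.insert) (auto simp: axis_eq_axis)
qed

text \<open>The change of variables theorem applied below lives on \<open>real ^ 'n\<close>; this
  identification of planar Lebesgue measure carries it to \<open>complex\<close>.\<close>

lemma lborel_complex_real2: "lborel = distr lborel borel complex_of_real2"
proof (rule lborel_eqI)
  fix l u :: complex assume le: "\<And>b. b \<in> Basis \<Longrightarrow> l \<bullet> b \<le> u \<bullet> b"
  then have le': "Re l \<le> Re u" "Im l \<le> Im u"
    using le[of 1] le[of \<i>] by (auto simp: Basis_complex_def)
  have eq: "complex_of_real2 -` box l u = box (real2_of_complex l) (real2_of_complex u)"
    by (auto simp: box_def Basis_complex_def Basis_vec_def UNIV_2 inner_axis complex_of_real2_def real2_of_complex_def)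
  have "emeasure lborel (box (real2_of_complex l) (real2_of_complex u))
    = (\<Prod>b\<in>Basis. (real2_of_complex u - real2_of_complex l) \<bullet> b)"
    using le' by (intro emeasure_lborel_box)
      (auto simp: Basis_vec_def UNIV_2 inner_axis real2_of_complex_def)
  also have "\<dots> = (\<Prod>b\<in>Basis. (u - l) \<bullet> b)"
    unfolding prod_Basis_real2 by (auto simp: Basis_complex_def inner_axis real2_of_complex_def algebra_simps)
  finally show "emeasure (distr lborel borel complex_of_real2) (box l u) = (\<Prod>b\<in>Basis. (u - l) \<bullet> b)"
    by (simp add: emeasure_distr eq)
qed simp

text \<open>Multiplication by \<open>a\<close> has the real matrix with rows
  \<open>Re a, - Im a\<close> and \<open>Im a, Re a\<close>: the Cauchy-Riemann equations in the
  form needed for the Jacobian.\<close>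

lemma abs_det_matrix_mult_complex:
  "\<bar>det (matrix (\<lambda>x. real2_of_complex (a * complex_of_real2 x)))\<bar> = (cmod a)\<^sup>2"
  unfolding cmod_power2
  by (simp add: det_2 matrix_def real2_of_complex_def complex_of_real2_def axis_def power2_eq_square)

text \<open>The real Jacobian of a holomorphic map is the squared modulus of its derivative. The set
  is given on the image side so that measurability is transported by preimages under
  \<open>g\<close>.\<close>

lemma emeasure_holomorphic_image:
  assumes S: "open S" and der: "\<And>x. x \<in> S \<Longrightarrow> (g has_field_derivative g' x) (at x)"
    and inj: "inj_on g S" and A [measurable]: "A \<in> sets borel" "A \<subseteq> g ` S"
    and g [measurable]: "g \<in> borel_measurable borel" and g' [measurable]: "g' \<in> borel_measurable borel"
  shows "emeasure lborel A = (\<integral>\<^sup>+x. ennreal ((cmod (g' x))\<^sup>2) * indicator (S \<inter> g -` A) x \<partial>lborel)"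
proof -
  let ?r = real2_of_complex and ?c = complex_of_real2
  define T where "T = ?c -` (S \<inter> g -` A)"
  define G where "G = ?r \<circ> g \<circ> ?c"
  define G' where "G' = (\<lambda>x. (\<lambda>y. ?r (g' (?c x) * ?c y)))"
  have S' [measurable]: "S \<in> sets borel" using S by simp
  have T [measurable]: "T \<in> sets borel"
  proof -
    have "S \<inter> g -` A \<in> sets borel"
      using measurable_sets[OF g A(1)] S' by auto
    then show ?thesis unfolding T_def
      using measurable_sets[OF measurable_complex_of_real2] by auto
  qed
  have rl: "(?r has_derivative ?r) F" for F
    by (intro bounded_linear_imp_has_derivative) (simp add: linear_real2_of_complex flip: linear_conv_bounded_linear)
  have cl: "(?c has_derivative ?c) F" for F
    by (intro bounded_linear_imp_has_derivative) (simp add: linear_complex_of_real2 flip: linear_conv_bounded_linear)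
  have derG: "(G has_derivative G' x) (at x within T)" if "x \<in> T" for x
  proof -
    have "(g has_derivative (*) (g' (?c x))) (at (?c x))"
      using der[of "?c x"] that by (simp add: T_def has_field_derivative_def)
    then have "(G has_derivative (?r \<circ> (*) (g' (?c x)) \<circ> ?c)) (at x)"
      unfolding G_def by (auto intro!: diff_chain_at cl rl simp: comp_assoc)
    then show ?thesis
      by (auto simp: G'_def o_def intro: has_derivative_at_withinI)
  qed
  have injG: "inj_on G T"
  proof (rule inj_onI)
    fix x y assume "x \<in> T" "y \<in> T" "G x = G y"
    then have "g (?c x) = g (?c y)" by (metis G_def comp_def complex_of_real2_inverse(1))
    then have "?c x = ?c y" using inj \<open>x \<in> T\<close> \<open>y \<in> T\<close> by (auto simp: T_def inj_on_def)
    then show "x = y" by (metis complex_of_real2_inverse(2))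
  qed
  have GT: "G ` T = ?c -` A"
  proof (intro subset_antisym subsetI)
    fix x assume "x \<in> G ` T" then show "x \<in> ?c -` A" by (auto simp: T_def G_def)
  next
    fix x assume "x \<in> ?c -` A"
    then have "?c x \<in> A" by simp
    then obtain y where y: "y \<in> S" "?c x = g y" using A by auto
    then have "x = G (?r y)" by (simp add: G_def flip: y(2))
    moreover have "?r y \<in> T" using y \<open>?c x \<in> A\<close> by (simp add: T_def)
    ultimately show "x \<in> G ` T" by blast
  qed
  have cA [measurable]: "?c -` A \<in> sets borel"
    using measurable_sets[OF measurable_complex_of_real2 A(1)] by simp
  \<comment> \<open>Measure and integral determine each other here, which settles both cases below:
    a set of finite measure has this integral, and a finite integral would force finite
    measure.\<close>
  have key: "(?c -` A \<in> lmeasurable \<and> measure lebesgue (?c -` A) = m)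
    \<longleftrightarrow> ((\<lambda>x. (cmod (g' (?c x)))\<^sup>2) has_integral m) T" for m
    using has_measure_differentiable_image[of T G G' m] T derG injG
    by (simp add: GT G'_def abs_det_matrix_mult_complex sets_completionI_sets)
  have l: "emeasure lborel A = emeasure lebesgue (?c -` A)"
    by (subst lborel_complex_real2) (simp add: emeasure_distr)
  have r: "(\<integral>\<^sup>+x. ennreal ((cmod (g' x))\<^sup>2) * indicator (S \<inter> g -` A) x \<partial>lborel)
     = (\<integral>\<^sup>+x. ennreal ((cmod (g' (?c x)))\<^sup>2 * indicator T x) \<partial>lborel)"
    by (subst lborel_complex_real2, subst nn_integral_distr)
       (auto simp: T_def indicator_def intro!: nn_integral_cong)
  have restr: "(\<lambda>x. (cmod (g' (?c x)))\<^sup>2 * indicator T x) = (\<lambda>x. if x \<in> T then (cmod (g' (?c x)))\<^sup>2 else 0)"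
    by auto
  show ?thesis
  proof (cases "?c -` A \<in> lmeasurable")
    case True
    then have hi: "((\<lambda>x. (cmod (g' (?c x)))\<^sup>2) has_integral measure lebesgue (?c -` A)) T"
      using key by blast
    have "(\<integral>\<^sup>+x. ennreal ((cmod (g' (?c x)))\<^sup>2 * indicator T x) \<partial>lborel) = ennreal (measure lebesgue (?c -` A))"
      by (rule nn_integral_has_integral_lborel) (use hi restr has_integral_restrict_UNIV in auto)
    moreover have "emeasure lebesgue (?c -` A) = ennreal (measure lebesgue (?c -` A))"
      using True by (rule emeasure_eq_measure2)
    ultimately show ?thesis unfolding l r by simp
  next
    case False
    then have inf: "emeasure lebesgue (?c -` A) = \<infinity>"
      by (auto simp: fmeasurable_def less_top[symmetric])
    have "(\<integral>\<^sup>+x. ennreal ((cmod (g' (?c x)))\<^sup>2 * indicator T x) \<partial>lborel) = \<infinity>"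
    proof (rule ccontr)
      assume "\<not> ?thesis"
      then have fin: "(\<integral>\<^sup>+x. ennreal ((cmod (g' (?c x)))\<^sup>2 * indicator T x) \<partial>lborel) < \<infinity>"
        by (simp add: less_top)
      then obtain m where m: "0 \<le> m" "(\<integral>\<^sup>+x. ennreal ((cmod (g' (?c x)))\<^sup>2 * indicator T x) \<partial>lborel) = ennreal m"
        by (cases "\<integral>\<^sup>+x. ennreal ((cmod (g' (?c x)))\<^sup>2 * indicator T x) \<partial>lborel") auto
      have "((\<lambda>x. (cmod (g' (?c x)))\<^sup>2 * indicator T x) has_integral m) UNIV"
        by (rule nn_integral_has_integral) (use m in auto)
      then have "((\<lambda>x. (cmod (g' (?c x)))\<^sup>2) has_integral m) T"
        using restr has_integral_restrict_UNIV by simp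
      then show False using key False by blast
    qed
    then show ?thesis unfolding l r inf by simp
  qed
qed

section \<open>Lebesgue measure on complex coordinate space\<close>

text \<open>Equality of the two measures on all Borel sets gives the formula for every nonnegative
  measurable \<open>F\<close> at once.\<close>

lemma nn_integral_holomorphic_image:
  assumes S: "open S" "g ` S \<in> sets borel" and der: "\<And>x. x \<in> S \<Longrightarrow> (g has_field_derivative g' x) (at x)"
    and inj: "inj_on g S"
    and g [measurable]: "g \<in> borel_measurable borel" and g' [measurable]: "g' \<in> borel_measurable borel"
    and F [measurable]: "F \<in> borel_measurable borel"
  shows "(\<integral>\<^sup>+x. F x * indicator (g ` S) x \<partial>lborel)
    = (\<integral>\<^sup>+x. F (g x) * ennreal ((cmod (g' x))\<^sup>2) * indicator S x \<partial>lborel)"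
proof -
  have [measurable]: "S \<in> sets borel" using S by simp
  note S(2)[measurable]
  have "density lborel (indicator (g ` S))
    = distr (density lborel (\<lambda>x. ennreal ((cmod (g' x))\<^sup>2) * indicator S x)) borel g"
  proof (rule measure_eqI)
    fix A assume "A \<in> sets (density lborel (indicator (g ` S) :: complex \<Rightarrow> ennreal))"
    then have A [measurable]: "A \<in> sets borel" by simp
    have "emeasure (density lborel (indicator (g ` S))) A = emeasure lborel (A \<inter> g ` S)"
      by (simp add: emeasure_density flip: indicator_inter_arith)
        (simp add: Int_commute)
    also have "\<dots> = (\<integral>\<^sup>+x. ennreal ((cmod (g' x))\<^sup>2) * indicator (S \<inter> g -` (A \<inter> g ` S)) x \<partial>lborel)"
      by (rule emeasure_holomorphic_image[OF S(1) der inj]) auto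
    also have "\<dots> = (\<integral>\<^sup>+x. ennreal ((cmod (g' x))\<^sup>2) * indicator S x * indicator (g -` A) x \<partial>lborel)"
      by (intro nn_integral_cong) (auto simp: indicator_def)
    also have "\<dots> = emeasure (distr (density lborel (\<lambda>x. ennreal ((cmod (g' x))\<^sup>2) * indicator S x)) borel g) A"
      using measurable_sets[OF g A] by (simp add: emeasure_distr emeasure_density)
    finally show "emeasure (density lborel (indicator (g ` S))) A =
      emeasure (distr (density lborel (\<lambda>x. ennreal ((cmod (g' x))\<^sup>2) * indicator S x)) borel g) A" .
  qed simp
  then have "integral\<^sup>N (density lborel (indicator (g ` S))) F
    = integral\<^sup>N (distr (density lborel (\<lambda>x. ennreal ((cmod (g' x))\<^sup>2) * indicator S x)) borel g) F"
    by simp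
  then show ?thesis
    by (simp add: nn_integral_density nn_integral_distr ac_simps)
qed

lemma emeasure_lborel_scale_complex:
  assumes a: "a \<noteq> (0::complex)" and A: "A \<in> sets borel"
  shows "emeasure lborel A = ennreal ((cmod a)\<^sup>2) * emeasure lborel ((*) a -` A)"
proof -
  have sur: "range ((*) a) = UNIV"
    using a by (metis surj_def nonzero_mult_div_cancel_left times_divide_eq_right)
  have m: "(*) a -` A \<in> sets borel"
    using measurable_sets[of "(*) a" borel borel A] A by simp
  have "emeasure lborel A = (\<integral>\<^sup>+x. ennreal ((cmod a)\<^sup>2) * indicator (UNIV \<inter> (*) a -` A) x \<partial>lborel)"
    by (rule emeasure_holomorphic_image) (use a A sur in \<open>auto intro!: derivative_eq_intros inj_onI\<close>)
  then show ?thesis using m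
    by (simp add: nn_integral_cmult)
qed

lemma product_sigma_finite_lborel: "product_sigma_finite (\<lambda>_. lborel :: 'a::euclidean_space measure)"
  by unfold_locales

lemma nn_integral_PiM_scale:
  fixes a :: "'i \<Rightarrow> complex"
  assumes I: "finite I" and a: "\<And>i. i \<in> I \<Longrightarrow> a i \<noteq> 0"
    and F: "F \<in> borel_measurable (PiM I (\<lambda>_. lborel))"
  shows "(\<integral>\<^sup>+x. F x \<partial>PiM I (\<lambda>_. lborel))
    = ennreal (\<Prod>i\<in>I. (cmod (a i))\<^sup>2) * (\<integral>\<^sup>+x. F (\<lambda>i\<in>I. a i * x i) \<partial>PiM I (\<lambda>_. lborel))"
proof -
  interpret product_sigma_finite "\<lambda>_::'i. lborel :: complex measure"
    by (rule product_sigma_finite_lborel)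
  let ?M = "PiM I (\<lambda>_. lborel :: complex measure)"
  define T where "T = (\<lambda>x. \<lambda>i\<in>I. a i * x i)"
  have T [measurable]: "T \<in> measurable ?M ?M" unfolding T_def by measurable
  define P where "P = density (distr ?M ?M T) (\<lambda>_. ennreal (\<Prod>i\<in>I. (cmod (a i))\<^sup>2))"
  have "P = ?M"
  proof (rule PiM_eqI[OF I])
    fix A assume A: "\<And>i. i \<in> I \<Longrightarrow> A i \<in> sets (lborel :: complex measure)"
    have A': "(*) (a i) -` A i \<in> sets borel" if "i \<in> I" for i
      using measurable_sets[of "(*) (a i)" borel borel "A i"] A[OF that] by simp
    have [measurable]: "Pi\<^sub>E I A \<in> sets ?M" using A I by (intro sets_PiM_I_finite) auto
    have "T -` Pi\<^sub>E I A \<inter> space ?M = Pi\<^sub>E I (\<lambda>i. (*) (a i) -` A i)"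
      by (auto simp: T_def space_PiM PiE_iff)
    then have "emeasure P (Pi\<^sub>E I A) = ennreal (\<Prod>i\<in>I. (cmod (a i))\<^sup>2) * (\<Prod>i\<in>I. emeasure lborel ((*) (a i) -` A i))"
      unfolding P_def using A' I
      by (simp add: emeasure_density nn_integral_cmult emeasure_distr emeasure_PiM)
    also have "\<dots> = (\<Prod>i\<in>I. emeasure lborel (A i))"
      using A a
      by (subst prod_ennreal[symmetric])
        (auto simp: prod.distrib[symmetric] intro!: prod.cong emeasure_lborel_scale_complex[symmetric])
    finally show "emeasure P (Pi\<^sub>E I A) = (\<Prod>i\<in>I. emeasure lborel (A i))" .
  qed (simp add: P_def)
  then have "(\<integral>\<^sup>+x. F x \<partial>?M) = integral\<^sup>N P F" by simp
  also have "\<dots> = ennreal (\<Prod>i\<in>I. (cmod (a i))\<^sup>2) * (\<integral>\<^sup>+x. F (T x) \<partial>?M)"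
    unfolding P_def using F by (simp add: nn_integral_density nn_integral_cmult nn_integral_distr)
  finally show ?thesis by (simp add: T_def)
qed

lemma measurable_vec_lambda_PiM [measurable]:
  "(\<lambda>x. \<chi> i. x i) \<in> PiM UNIV (\<lambda>_. lborel :: complex measure) \<rightarrow>\<^sub>M (borel :: (complex ^ 'n) measure)"
proof (rule borel_measurable_euclidean_space[THEN iffD2], rule ballI)
  fix b :: "complex ^ 'n" assume "b \<in> Basis"
  then obtain i u where b: "b = axis i u" by (auto simp: Basis_vec_def)
  show "(\<lambda>x. (\<chi> i. x i) \<bullet> b) \<in> borel_measurable (PiM UNIV (\<lambda>_. lborel :: complex measure))"
    unfolding b inner_axis by simp
qed

lemma Basis_vec_image: "(Basis :: ('a::euclidean_space ^ 'n) set) = (\<lambda>(i, u). axis i u) ` (UNIV \<times> Basis)"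
  by (auto simp: Basis_vec_def)

lemma inj_on_axis_Basis: "inj_on (\<lambda>(i, u). axis i u :: 'a::euclidean_space ^ 'n) (UNIV \<times> Basis)"
  by (auto simp: inj_on_def axis_eq_axis)

text \<open>Makes Fubini available one complex coordinate at a time.\<close>

lemma lborel_vec_PiM:
  "(lborel :: (complex ^ 'n) measure) = distr (PiM UNIV (\<lambda>_. lborel)) borel (\<lambda>x. \<chi> i. x i)"
proof (rule lborel_eqI)
  interpret product_sigma_finite "\<lambda>_::'n. lborel :: complex measure"
    by (rule product_sigma_finite_lborel)
  fix l u :: "complex ^ 'n" assume le: "\<And>b. b \<in> Basis \<Longrightarrow> l \<bullet> b \<le> u \<bullet> b"
  have le': "l $ i \<bullet> b \<le> u $ i \<bullet> b" if "b \<in> Basis" for i b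
    using le[of "axis i b"] that by (simp add: axis_in_Basis_iff inner_axis)
  have "(\<lambda>x. \<chi> i. x i) -` box l u \<inter> space (PiM UNIV (\<lambda>_. lborel :: complex measure))
     = Pi\<^sub>E UNIV (\<lambda>i. box (l $ i) (u $ i))"
    by (auto simp: box_def Basis_vec_def inner_axis space_PiM)
  then have "emeasure (distr (PiM UNIV (\<lambda>_. lborel)) borel (\<lambda>x. \<chi> i. x i)) (box l u)
     = (\<Prod>i\<in>UNIV. emeasure lborel (box (l $ i) (u $ i)))"
    by (simp add: emeasure_distr emeasure_PiM)
  also have "\<dots> = (\<Prod>i\<in>UNIV. ennreal (\<Prod>b\<in>Basis. (u $ i - l $ i) \<bullet> b))"
    using le' by (intro prod.cong emeasure_lborel_box) auto
  also have "\<dots> = ennreal (\<Prod>i\<in>UNIV. \<Prod>b\<in>Basis. (u $ i - l $ i) \<bullet> b)"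
    using le' by (intro prod_ennreal prod_nonneg) (auto simp: inner_diff_left)
  also have "(\<Prod>i\<in>UNIV. \<Prod>b\<in>Basis. (u $ i - l $ i) \<bullet> b) = (\<Prod>b\<in>Basis. (u - l) \<bullet> b)"
    unfolding Basis_vec_image prod.reindex[OF inj_on_axis_Basis]
    by (simp add: prod.cartesian_product split_beta inner_axis)
  finally show "emeasure (distr (PiM UNIV (\<lambda>_. lborel)) borel (\<lambda>x. \<chi> i. x i)) (box l u)
     = ennreal (\<Prod>b\<in>Basis. (u - l) \<bullet> b)" .
qed simp

lemma nn_integral_vec_scale:
  fixes a :: "'n::finite \<Rightarrow> complex" and F :: "complex ^ 'n \<Rightarrow> ennreal"
  assumes a: "\<And>i. a i \<noteq> 0" and F [measurable]: "F \<in> borel_measurable borel"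
  shows "(\<integral>\<^sup>+w. F w \<partial>lborel) = ennreal (\<Prod>i\<in>UNIV. (cmod (a i))\<^sup>2) * (\<integral>\<^sup>+w. F (\<chi> i. a i * w $ i) \<partial>lborel)"
proof -
  have [measurable]: "(\<lambda>w. \<chi> i. a i * w $ i) \<in> borel_measurable (borel :: (complex ^ 'n) measure)"
    by (intro borel_measurable_continuous_onI continuous_intros)
  have *: "(\<integral>\<^sup>+w. G w \<partial>lborel) = (\<integral>\<^sup>+x. G (\<chi> i. x i) \<partial>PiM UNIV (\<lambda>_. lborel))"
    if "G \<in> borel_measurable borel" for G :: "complex ^ 'n \<Rightarrow> ennreal"
    by (subst lborel_vec_PiM) (use that in \<open>simp add: nn_integral_distr\<close>)
  show ?thesis
    unfolding *[OF F] by (subst nn_integral_PiM_scale[where a = a, OF finite a]) (simp_all add: * restrict_def)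
qed

text \<open>The first order of integration serves shears, where the inner variable is translated.
  The second serves the Cayley transform, where the other coordinates are rescaled by a factor
  depending on the outer one.\<close>

lemma nn_integral_vec_split:
  fixes F :: "complex ^ 'n \<Rightarrow> ennreal"
  assumes F [measurable]: "F \<in> borel_measurable borel"
  shows "(\<integral>\<^sup>+w. F w \<partial>lborel)
      = (\<integral>\<^sup>+x. \<integral>\<^sup>+y. F (\<chi> i. if i = l then y else x i) \<partial>lborel \<partial>PiM (UNIV - {l}) (\<lambda>_. lborel))"
    and "(\<integral>\<^sup>+w. F w \<partial>lborel)
      = (\<integral>\<^sup>+y. \<integral>\<^sup>+x. F (\<chi> i. if i = l then y else x i) \<partial>PiM (UNIV - {l}) (\<lambda>_. lborel) \<partial>lborel)"
proof -
  interpret product_sigma_finite "\<lambda>_::'n. lborel :: complex measure"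
    by (rule product_sigma_finite_lborel)
  have ins: "(UNIV :: 'n set) = insert l (UNIV - {l})" by auto
  have meas: "(\<lambda>x. F (\<chi> i. x i)) \<in> borel_measurable (PiM (insert l (UNIV - {l})) (\<lambda>_. lborel))"
    unfolding ins[symmetric] by measurable
  have 1: "(\<integral>\<^sup>+w. F w \<partial>lborel) = (\<integral>\<^sup>+x. F (\<chi> i. x i) \<partial>PiM (insert l (UNIV - {l})) (\<lambda>_. lborel))"
    by (subst lborel_vec_PiM) (simp add: nn_integral_distr flip: ins)
  show "(\<integral>\<^sup>+w. F w \<partial>lborel)
      = (\<integral>\<^sup>+x. \<integral>\<^sup>+y. F (\<chi> i. if i = l then y else x i) \<partial>lborel \<partial>PiM (UNIV - {l}) (\<lambda>_. lborel))"
    unfolding 1 using product_nn_integral_insert[OF _ _ meas] by (simp add: fun_upd_def)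
  show "(\<integral>\<^sup>+w. F w \<partial>lborel)
      = (\<integral>\<^sup>+y. \<integral>\<^sup>+x. F (\<chi> i. if i = l then y else x i) \<partial>PiM (UNIV - {l}) (\<lambda>_. lborel) \<partial>lborel)"
    unfolding 1 using product_nn_integral_insert_rev[OF _ _ meas] by (simp add: fun_upd_def)
qed

lemma nn_integral_lborel_translate:
  fixes F :: "'a::euclidean_space \<Rightarrow> ennreal"
  assumes "F \<in> borel_measurable borel"
  shows "(\<integral>\<^sup>+w. F w \<partial>lborel) = (\<integral>\<^sup>+w. F (c + w) \<partial>lborel)"
  by (subst lborel_distr_plus[of c, symmetric]) (use assms in \<open>simp add: nn_integral_distr\<close>)

lemma continuous_on_vec_update:
  "continuous_on S (\<lambda>y :: 'a::topological_space. \<chi> i. if i = l then y else x i)"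
proof (intro continuous_on_vec_lambda)
  show "continuous_on S (\<lambda>y. if i = l then y else x i)" for i
    by (cases "i = l") auto
qed

text \<open>On each line in direction \<open>l\<close> the map is a translation, because
  \<open>dep\<close> makes \<open>b\<close> constant along the line; translations preserve the inner
  integral.\<close>

lemma nn_integral_vec_shear:
  fixes F :: "complex ^ 'n \<Rightarrow> ennreal"
  assumes F [measurable]: "F \<in> borel_measurable borel"
    and b [measurable]: "b \<in> borel_measurable borel"
    and dep: "\<And>w y. b (\<chi> i. if i = l then y else w $ i) = b w"
  shows "(\<integral>\<^sup>+w. F w \<partial>lborel) = (\<integral>\<^sup>+w. F (w + axis l (b w)) \<partial>lborel)"
proof -
  let ?v = "\<lambda>x y. (\<chi> i. if i = l then y else x i) :: complex ^ 'n"
  have "(\<lambda>y. axis l y) \<in> borel_measurable (borel :: complex measure)"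
    unfolding axis_def by (intro borel_measurable_continuous_onI continuous_on_vec_update)
  then have ax: "(\<lambda>w::complex ^ 'n. w + axis l (b w)) \<in> borel_measurable borel"
    using measurable_compose[OF b] by (intro borel_measurable_add) auto
  have mF [measurable]: "(\<lambda>w. F (w + axis l (b w))) \<in> borel_measurable borel"
    using measurable_compose[OF ax F] by simp
  have "(\<integral>\<^sup>+y. F (?v x y) \<partial>lborel) = (\<integral>\<^sup>+y. F (?v x y + axis l (b (?v x y))) \<partial>lborel)" for x
  proof -
    have mv: "(\<lambda>y. F (?v x y)) \<in> borel_measurable borel"
    proof -
      have "(\<lambda>y. ?v x y) \<in> borel_measurable borel"
        by (intro borel_measurable_continuous_onI continuous_on_vec_update)
      from measurable_compose[OF this F] show ?thesis by simp
    qed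
    have "?v x y + axis l (b (?v x y)) = ?v x (b (?v x 0) + y)" for y
    proof -
      have "b (?v x y) = b (?v x 0)"
        using dep[of y "?v x 0"] by (simp cong: if_cong)
      then show ?thesis by (auto simp: vec_eq_iff axis_def)
    qed
    then show ?thesis
      by (simp add: nn_integral_lborel_translate[OF mv, of "b (?v x 0)"])
  qed
  then show ?thesis
    by (subst (1 2) nn_integral_vec_split(1)[where l = l]) auto
qed

section \<open>Geometry of the Siegel domain\<close>

definition rr :: "'n::{finite,linorder} cspace \<Rightarrow> 'n cspace \<Rightarrow> complex" where
  "rr z w = \<i> / 2 * (cnj (w $ last_ix) - z $ last_ix) - (\<Sum>j\<in>UNIV - {last_ix}. z $ j * cnj (w $ j))"

lemma rr_cnj: "rr w z = cnj (rr z w)"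
  by (simp add: rr_def field_simps)

text \<open>Polarisation of the squared moduli. On the domain all summands are nonnegative, so up to
  a factor 2 the modulus of \<open>rr\<close> dominates each of \<open>rho z\<close>,
  \<open>rho w\<close> and the squared distance of the first coordinates. The kernel estimates rest
  on this.\<close>

lemma Re_rr:
  "Re (rr z w) = (rho z + rho w + (\<Sum>j\<in>UNIV - {last_ix}. (cmod (z $ j - w $ j))\<^sup>2)) / 2"
proof -
  have "(\<Sum>j\<in>UNIV - {last_ix}. (cmod (z $ j - w $ j))\<^sup>2)
    = (\<Sum>j\<in>UNIV - {last_ix}. (cmod (z $ j))\<^sup>2 + (cmod (w $ j))\<^sup>2 - 2 * Re (z $ j * cnj (w $ j)))"
    unfolding cmod_power2 by (rule sum.cong) (auto simp: power2_eq_square algebra_simps)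
  then show ?thesis
    by (simp add: rr_def rho_def sum.distrib sum_subtractf sum_distrib_left[symmetric] field_simps)
qed

lemma rr_same: "rr z z = of_real (rho z)"
proof (rule complex_eqI)
  show "Im (rr z z) = Im (of_real (rho z))"
    using arg_cong[OF rr_cnj[of z z], of Im] by simp
qed (simp add: Re_rr)

lemma continuous_on_rho [continuous_intros]: "continuous_on S rho"
  unfolding rho_def[abs_def] by (intro continuous_intros)

lemma measurable_rho [measurable]: "rho \<in> borel_measurable borel"
  by (intro borel_measurable_continuous_onI continuous_intros)

lemma open_siegel: "open siegel"
  unfolding siegel_def by (intro open_Collect_less continuous_intros)

lemma sets_siegel [measurable]: "siegel \<in> sets borel"
  by (intro borel_open open_siegel)

lemma Re_rr_pos:
  assumes "z \<in> siegel" "w \<in> siegel"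
  shows "0 < Re (rr z w)" "rho z \<le> 2 * cmod (rr z w)" "rho w \<le> 2 * cmod (rr z w)"
    "(\<Sum>j\<in>UNIV - {last_ix}. (cmod (z $ j - w $ j))\<^sup>2) \<le> 2 * cmod (rr z w)"
proof -
  have s: "0 \<le> (\<Sum>j\<in>UNIV - {last_ix}. (cmod (z $ j - w $ j))\<^sup>2)"
    by (intro sum_nonneg) auto
  have r: "0 < rho z" "0 < rho w" using assms by (auto simp: siegel_def)
  show "0 < Re (rr z w)" unfolding Re_rr using r s by (intro divide_pos_pos add_pos_nonneg) auto
  show "rho z \<le> 2 * cmod (rr z w)" "rho w \<le> 2 * cmod (rr z w)"
    "(\<Sum>j\<in>UNIV - {last_ix}. (cmod (z $ j - w $ j))\<^sup>2) \<le> 2 * cmod (rr z w)"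
    using complex_Re_le_cmod[of "rr z w"] r s unfolding Re_rr by simp_all
qed

text \<open>The automorphism carrying \<open>base_pt\<close> to \<open>z\<close>: the anisotropic
  dilation with factor \<open>rho z\<close> on the last coordinate and its square root on the
  others, followed by the Heisenberg translation that belongs to the boundary point below
  \<open>z\<close>.\<close>

definition siegel_map :: "'n::{finite,linorder} cspace \<Rightarrow> 'n cspace \<Rightarrow> 'n cspace" where
  "siegel_map z w = (\<chi> j. if j = last_ix
     then of_real (rho z) * w $ last_ix
       + 2 * \<i> * of_real (sqrt (rho z)) * (\<Sum>j\<in>UNIV - {last_ix}. w $ j * cnj (z $ j))
       + of_real (Re (z $ last_ix)) + \<i> * (\<Sum>j\<in>UNIV - {last_ix}. (cmod (z $ j))\<^sup>2)
     else of_real (sqrt (rho z)) * w $ j + z $ j)"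

lemma siegel_map_base: "z \<in> siegel \<Longrightarrow> siegel_map z base_pt = z"
proof -
  assume "z \<in> siegel"
  have "complex_of_real (rho z) * \<i> + of_real (Re (z $ last_ix))
      + \<i> * (\<Sum>j\<in>UNIV - {last_ix}. (cmod (z $ j))\<^sup>2) = z $ last_ix"
    by (rule complex_eqI) (simp_all add: rho_def)
  then show ?thesis
    by (simp add: siegel_map_def base_pt_def vec_eq_iff axis_def)
qed

text \<open>The Heisenberg translation preserves \<open>rr\<close> and the dilation scales it. This
  homogeneity reduces kernel integrals at \<open>z\<close> to those at
  \<open>base_pt\<close>.\<close>

lemma rr_siegel_map:
  assumes z: "z \<in> siegel"
  shows "rr (siegel_map z w) (siegel_map z v) = of_real (rho z) * rr w v"
proof -
  define d where "d = complex_of_real (sqrt (rho z))"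
  have d2: "complex_of_real (rho z) = d * d" and dc: "cnj d = d"
    using z by (auto simp: d_def siegel_def simp flip: of_real_mult)
  let ?S = "\<lambda>f. (\<Sum>j\<in>UNIV - {last_ix}. f j) :: complex"
  have zz: "complex_of_real (\<Sum>j\<in>UNIV - {last_ix}. (cmod (z $ j))\<^sup>2) = ?S (\<lambda>j. z $ j * cnj (z $ j))"
    unfolding of_real_sum complex_norm_square ..
  have "?S (\<lambda>j. siegel_map z w $ j * cnj (siegel_map z v $ j))
      = ?S (\<lambda>j. (d * w $ j + z $ j) * (d * cnj (v $ j) + cnj (z $ j)))"
    by (rule sum.cong) (auto simp: siegel_map_def dc simp flip: d_def)
  also have "\<dots> = d * d * ?S (\<lambda>j. w $ j * cnj (v $ j)) + d * ?S (\<lambda>j. w $ j * cnj (z $ j))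
      + d * ?S (\<lambda>j. z $ j * cnj (v $ j)) + ?S (\<lambda>j. z $ j * cnj (z $ j))"
    by (simp add: algebra_simps sum.distrib sum_distrib_left)
  finally have 1: "?S (\<lambda>j. siegel_map z w $ j * cnj (siegel_map z v $ j)) = \<dots>" .
  have 2: "siegel_map z u $ last_ix = d * d * u $ last_ix + 2 * \<i> * d * ?S (\<lambda>j. u $ j * cnj (z $ j))
      + of_real (Re (z $ last_ix)) + \<i> * ?S (\<lambda>j. z $ j * cnj (z $ j))" for u
    by (simp add: siegel_map_def d2 flip: d_def zz)
  have 3: "cnj (siegel_map z v $ last_ix) = d * d * cnj (v $ last_ix) - 2 * \<i> * d * ?S (\<lambda>j. z $ j * cnj (v $ j))
      + of_real (Re (z $ last_ix)) - \<i> * ?S (\<lambda>j. z $ j * cnj (z $ j))"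
    unfolding 2 by (simp add: dc mult.commute)
  show ?thesis
    unfolding rr_def[of "siegel_map z w"] 1 2[of w] 3 d2 by (simp add: rr_def field_simps)
qed

lemma rho_siegel_map:
  assumes "z \<in> siegel"
  shows "rho (siegel_map z w) = rho z * rho w"
  using rr_siegel_map[OF assms, of w w] unfolding rr_same by (simp flip: of_real_mult)

lemma siegel_map_in_siegel: "z \<in> siegel \<Longrightarrow> siegel_map z w \<in> siegel \<longleftrightarrow> w \<in> siegel"
  by (auto simp: siegel_def rho_siegel_map zero_less_mult_iff)

lemma continuous_on_siegel_map: "continuous_on S (siegel_map z)"
  unfolding siegel_map_def[abs_def]
proof (intro continuous_on_vec_lambda)
  fix i
  show "continuous_on S (\<lambda>w. if i = last_ix
     then of_real (rho z) * w $ last_ix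
       + 2 * \<i> * of_real (sqrt (rho z)) * (\<Sum>j\<in>UNIV - {last_ix}. w $ j * cnj (z $ j))
       + of_real (Re (z $ last_ix)) + \<i> * (\<Sum>j\<in>UNIV - {last_ix}. (cmod (z $ j))\<^sup>2)
     else of_real (sqrt (rho z)) * w $ i + z $ i)"
    by (cases "i = last_ix") (auto intro!: continuous_intros)
qed

lemma measurable_siegel_map [measurable]: "siegel_map z \<in> borel_measurable borel"
  by (intro borel_measurable_continuous_onI continuous_on_siegel_map)

text \<open>Translation and shear preserve the measure. The dilation multiplies the last coordinate
  by \<open>rho z\<close> and the n - 1 others by its square root; squaring the moduli gives the
  exponent \<open>2 + (n - 1)\<close>.\<close>

lemma nn_integral_siegel_map:
  fixes F :: "'n::{finite,linorder} cspace \<Rightarrow> ennreal"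
  assumes z: "z \<in> siegel" and F [measurable]: "F \<in> borel_measurable borel"
  shows "(\<integral>\<^sup>+w. F w \<partial>lborel) = ennreal (rho z ^ (CARD('n) + 1)) * (\<integral>\<^sup>+w. F (siegel_map z w) \<partial>lborel)"
proof -
  define r where "r = rho z"
  have r: "r > 0" using z by (simp add: r_def siegel_def)
  define c :: "'n cspace" where "c = (\<chi> j. if j = last_ix then of_real (Re (z $ last_ix))
      + \<i> * (\<Sum>j\<in>UNIV - {last_ix}. (cmod (z $ j))\<^sup>2) else z $ j)"
  define b where "b = (\<lambda>w :: 'n cspace. 2 * \<i> * (\<Sum>j\<in>UNIV - {last_ix}. w $ j * cnj (z $ j)))"
  define a where "a = (\<lambda>j::'n. if j = last_ix then complex_of_real r else of_real (sqrt r))"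
  have b [measurable]: "b \<in> borel_measurable borel"
    unfolding b_def by (intro borel_measurable_continuous_onI continuous_intros)
  have [measurable]: "(\<lambda>y. axis last_ix y :: 'n cspace) \<in> borel_measurable (borel :: complex measure)"
    unfolding axis_def by (intro borel_measurable_continuous_onI continuous_on_vec_update)
  have p: "(\<Prod>j\<in>UNIV. (cmod (a j))\<^sup>2) = r ^ (CARD('n) + 1)"
  proof -
    have "(\<Prod>j\<in>UNIV. (cmod (a j))\<^sup>2) = (cmod (a last_ix))\<^sup>2 * (\<Prod>j\<in>UNIV - {last_ix}. (cmod (a j))\<^sup>2)"
      by (rule prod.remove) auto
    also have "(\<Prod>j\<in>UNIV - {last_ix}. (cmod (a j))\<^sup>2) = (\<Prod>j\<in>UNIV - {last_ix :: 'n}. r)"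
      using r by (intro prod.cong) (auto simp: a_def norm_of_real)
    also have "\<dots> = r ^ (CARD('n) - 1)"
      by (simp add: card_Diff_singleton)
    also have "(cmod (a last_ix))\<^sup>2 * r ^ (CARD('n) - 1) = r ^ (2 + (CARD('n) - 1))"
      unfolding power_add by (simp add: a_def)
    also have "2 + (CARD('n) - 1) = CARD('n) + 1"
      using zero_less_card_finite[where 'a='n] by linarith
    finally show ?thesis .
  qed
  have "(\<integral>\<^sup>+w. F w \<partial>lborel) = (\<integral>\<^sup>+w. F (c + w) \<partial>lborel)"
    by (rule nn_integral_lborel_translate) simp
  also have "\<dots> = (\<integral>\<^sup>+w. F (c + (w + axis last_ix (b w))) \<partial>lborel)"
    by (rule nn_integral_vec_shear[OF _ b]) (auto simp: b_def intro!: sum.cong)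
  also have "\<dots> = ennreal (\<Prod>j\<in>UNIV. (cmod (a j))\<^sup>2) * (\<integral>\<^sup>+w. F (c + ((\<chi> j. a j * w $ j)
     + axis last_ix (b (\<chi> j. a j * w $ j)))) \<partial>lborel)"
    by (rule nn_integral_vec_scale) (use r in \<open>auto simp: a_def\<close>)
  also have "(\<lambda>w. c + ((\<chi> j. a j * w $ j) + axis last_ix (b (\<chi> j. a j * w $ j)))) = siegel_map z"
    by (rule ext) (auto simp: siegel_map_def vec_eq_iff c_def a_def b_def axis_def r_def sum_distrib_left
        algebra_simps intro!: sum.cong)
  then have "(\<integral>\<^sup>+w. F (c + ((\<chi> j. a j * w $ j) + axis last_ix (b (\<chi> j. a j * w $ j)))) \<partial>lborel)
    = (\<integral>\<^sup>+w. F (siegel_map z w) \<partial>lborel)" by metis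
  finally show ?thesis unfolding p r_def .
qed

section \<open>The Cayley transform of the ball onto the Siegel domain\<close>

definition cayley1 :: "complex \<Rightarrow> complex" where
  "cayley1 x = \<i> * (1 + x) / (1 - x)"

lemma Im_cayley1: "Im (cayley1 x) = (1 - (cmod x)\<^sup>2) / (cmod (1 - x))\<^sup>2"
  unfolding cayley1_def Im_divide cmod_power2
  by (simp add: power2_eq_square algebra_simps)

lemma cayley1_image: "cayley1 ` ball 0 1 = {y. 0 < Im y}"
proof (intro subset_antisym subsetI)
  fix y assume "y \<in> cayley1 ` ball 0 1"
  then obtain x where x: "cmod x < 1" "y = cayley1 x" by auto
  then have "0 < 1 - (cmod x)\<^sup>2" "0 < (cmod (1 - x))\<^sup>2"
    by (auto simp: power_less_one_iff abs_square_less_1)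
  then show "y \<in> {y. 0 < Im y}" by (simp add: x Im_cayley1)
next
  fix y assume "y \<in> {y. 0 < Im y}"
  then have y: "0 < Im y" by simp
  define x where "x = (y - \<i>) / (y + \<i>)"
  have ne: "y + \<i> \<noteq> 0" using y by (auto simp: complex_eq_iff)
  have "cmod (y - \<i>) < cmod (y + \<i>)"
    unfolding cmod_def using y by (auto simp: power2_eq_square algebra_simps)
  then have "cmod x < 1" using ne by (simp add: x_def norm_divide)
  moreover have "cayley1 x = y"
  proof -
    have "1 + x = 2 * y / (y + \<i>)" "1 - x = 2 * \<i> / (y + \<i>)"
      using ne by (auto simp: x_def field_simps)
    then show ?thesis using ne by (simp add: cayley1_def)
  qed
  ultimately show "y \<in> cayley1 ` ball 0 1" by force
qed

lemma cayley1_deriv: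
  "x \<noteq> 1 \<Longrightarrow> (cayley1 has_field_derivative 2 * \<i> / (1 - x)\<^sup>2) (at x)"
  unfolding cayley1_def[abs_def]
  by (auto intro!: derivative_eq_intros simp: field_simps power2_eq_square)

lemma inj_on_cayley1: "inj_on cayley1 (ball 0 1)"
proof (rule inj_onI)
  fix x y assume "x \<in> ball 0 1" "y \<in> ball 0 1" and eq: "cayley1 x = cayley1 y"
  then have "1 - x \<noteq> 0" "1 - y \<noteq> 0" by auto
  with eq have "(1 + x) * (1 - y) = (1 + y) * (1 - x)"
    by (simp add: cayley1_def field_simps)
  then show "x = y" by (simp add: algebra_simps)
qed

text \<open>Sends \<open>0\<close> to \<open>base_pt\<close> and the boundary point with last
  coordinate 1 to infinity. For a fixed last coordinate it is a scaling of the others, which is how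
  its Jacobian is found.\<close>

definition cayley :: "'n::{finite,linorder} cspace \<Rightarrow> 'n cspace" where
  "cayley x = (\<chi> j. if j = last_ix then cayley1 (x $ last_ix) else x $ j / (1 - x $ last_ix))"

lemma norm_vec_power2: "(norm x)\<^sup>2 = (\<Sum>j\<in>UNIV. (norm (x $ j))\<^sup>2)" for x :: "'a::real_normed_vector ^ 'n"
  by (simp add: norm_vec_def L2_set_def sum_nonneg)

lemma rho_cayley: "rho (cayley x) = (1 - (norm x)\<^sup>2) / (cmod (1 - x $ last_ix))\<^sup>2"
proof -
  have "(norm x)\<^sup>2 = (cmod (x $ last_ix))\<^sup>2 + (\<Sum>j\<in>UNIV - {last_ix}. (cmod (x $ j))\<^sup>2)"
    unfolding norm_vec_power2 by (rule sum.remove) auto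
  moreover have "(\<Sum>j\<in>UNIV - {last_ix}. (cmod (cayley x $ j))\<^sup>2)
     = (\<Sum>j\<in>UNIV - {last_ix}. (cmod (x $ j))\<^sup>2 / (cmod (1 - x $ last_ix))\<^sup>2)"
    by (rule sum.cong) (auto simp: cayley_def norm_divide power_divide)
  ultimately show ?thesis
    by (simp add: rho_def cayley_def Im_cayley1 sum_divide_distrib[symmetric] diff_divide_distrib add_divide_distrib)
qed

lemma last_coord_ne_1: "norm x < 1 \<Longrightarrow> cmod (x $ last_ix) < 1" "norm x < 1 \<Longrightarrow> x $ last_ix \<noteq> 1"
  using Finite_Cartesian_Product.norm_nth_le[of x last_ix] by auto

lemma cayley_in_siegel: 
  assumes "x $ last_ix \<noteq> 1"
  shows "cayley x \<in> siegel \<longleftrightarrow> norm x < 1"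
proof -
  have "0 < (cmod (1 - x $ last_ix))\<^sup>2" using assms by simp
  then show ?thesis
    by (simp add: siegel_def rho_cayley zero_less_divide_iff abs_square_less_1)
qed

lemma rr_base_cayley: 
  assumes "norm x < 1"
  shows "rr base_pt (cayley x) = 1 / cnj (1 - x $ last_ix)"
proof -
  have ne: "cnj (1 - x $ last_ix) \<noteq> 0" using last_coord_ne_1[OF assms] by simp
  have "(\<Sum>j\<in>UNIV - {last_ix}. base_pt $ j * cnj (cayley x $ j)) = 0"
    by (rule sum.neutral) (auto simp: base_pt_def axis_def)
  then have "rr base_pt (cayley x) = \<i> / 2 * (cnj (cayley1 (x $ last_ix)) - \<i>)"
    by (simp add: rr_def cayley_def base_pt_def)
  also have "\<dots> = 1 / cnj (1 - x $ last_ix)"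
    using ne by (simp add: cayley1_def field_simps)
  finally show ?thesis .
qed

lemma measurable_cayley1 [measurable]: "cayley1 \<in> borel_measurable borel"
  unfolding cayley1_def[abs_def] by measurable

lemma measurable_nth_cspace [measurable]: "(\<lambda>x :: complex ^ 'n. x $ j) \<in> borel_measurable borel"
  by (intro borel_measurable_continuous_onI continuous_intros)

lemma measurable_cayley [measurable]: "cayley \<in> borel_measurable borel"
proof (rule borel_measurable_euclidean_space[THEN iffD2], rule ballI)
  fix b :: "'a cspace" assume "b \<in> Basis"
  then obtain i u where b: "b = axis i u" by (auto simp: Basis_vec_def)
  show "(\<lambda>x. cayley x \<bullet> b) \<in> borel_measurable borel"
    unfolding b inner_axis by (cases "i = last_ix") (simp_all add: cayley_def)
qed

text \<open>The last coordinate \<open>y\<close> is the outer variable. It moves by the planar map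
  \<open>cayley1\<close> and contributes \<open>4 / cmod (1 - y) ^ 4\<close>; for fixed
  \<open>y\<close> the other n - 1 coordinates are multiplied by \<open>1 / (1 - y)\<close> and
  contribute \<open>1 / cmod (1 - y) ^ (2 * (n - 1))\<close>.\<close>

lemma nn_integral_cayley:
  fixes F :: "'n::{finite,linorder} cspace \<Rightarrow> ennreal"
  assumes F [measurable]: "F \<in> borel_measurable borel"
  shows "(\<integral>\<^sup>+w. F w * indicator siegel w \<partial>lborel)
    = (\<integral>\<^sup>+x. F (cayley x) * ennreal (4 / cmod (1 - x $ last_ix) ^ (2 * (CARD('n) + 1))) * indicator (ball 0 1) x \<partial>lborel)"
proof -
  interpret P: product_sigma_finite "\<lambda>_::'n. lborel :: complex measure"
    by (rule product_sigma_finite_lborel)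
  let ?I = "UNIV - {last_ix :: 'n}"
  let ?P = "PiM ?I (\<lambda>_. lborel :: complex measure)"
  let ?v = "\<lambda>x y. (\<chi> i. if i = last_ix then y else x i) :: 'n cspace"
  have [measurable]: "ball (0 :: 'n cspace) 1 \<in> sets borel" by simp
  interpret Q: sigma_finite_measure ?P by (rule P.sigma_finite) simp
  have v [measurable]: "(\<lambda>p. ?v (snd p) (fst p)) \<in> borel_measurable (borel \<Otimes>\<^sub>M ?P)"
  proof (rule borel_measurable_euclidean_space[THEN iffD2], rule ballI)
    fix b :: "'n cspace" assume "b \<in> Basis"
    then obtain i u where b: "b = axis i u" by (auto simp: Basis_vec_def)
    show "(\<lambda>p. ?v (snd p) (fst p) \<bullet> b) \<in> borel_measurable (borel \<Otimes>\<^sub>M ?P)"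
      unfolding b inner_axis by (cases "i = last_ix") simp_all
  qed
  have vy [measurable]: "?v x \<in> borel_measurable borel" for x
    by (intro borel_measurable_continuous_onI continuous_on_vec_update)
  have vx [measurable]: "(\<lambda>x. ?v x y) \<in> borel_measurable ?P" for y
  proof -
    have "(\<lambda>x. (\<lambda>p. ?v (snd p) (fst p)) (y, x)) \<in> borel_measurable ?P"
      by (rule measurable_compose[OF _ v]) simp
    then show ?thesis by (simp only: fst_conv snd_conv)
  qed
  let ?G = "\<lambda>w. F w * indicator siegel w"
  define H where "H y = (\<integral>\<^sup>+x. ?G (?v x y) \<partial>?P)" for y
  have H [measurable]: "H \<in> borel_measurable borel"
  proof -
    have "(\<lambda>p. ?G (?v (snd p) (fst p))) \<in> borel_measurable (borel \<Otimes>\<^sub>M ?P)"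
      using measurable_compose[OF v, of ?G borel] by simp
    then show ?thesis unfolding H_def
      by (intro Q.borel_measurable_nn_integral) (simp add: split_beta')
  qed
  \<comment> \<open>A point with positive \<open>rho\<close> has its last coordinate in the upper
    half-plane, so restricting the outer integral to the image of \<open>cayley1\<close> loses
    nothing.\<close>
  have H0: "H y = H y * indicator (cayley1 ` ball 0 1) y" for y
  proof (cases "0 < Im y")
    case False
    have "?v x y \<notin> siegel" for x
    proof -
      have "0 \<le> (\<Sum>j\<in>?I. (cmod (?v x y $ j))\<^sup>2)" by (intro sum_nonneg) auto
      then show ?thesis using False by (simp add: siegel_def rho_def not_less)
    qed
    then have "H y = 0" by (simp add: H_def)
    then show ?thesis by simp
  qed (simp add: cayley1_image)
  have opens: "open {y. 0 < Im y}"
    by (intro open_Collect_less continuous_intros)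
  have HC: "H (cayley1 y) * ennreal ((cmod (2 * \<i> / (1 - y)\<^sup>2))\<^sup>2)
     = (\<integral>\<^sup>+x. F (cayley (?v x y)) * ennreal (4 / cmod (1 - y) ^ (2 * (CARD('n) + 1))) * indicator (ball 0 1) (?v x y) \<partial>?P)"
    if y: "cmod y < 1" for y
  proof -
    have y1: "y \<noteq> 1" using y by auto
    define a where "a = inverse (1 - y)"
    have a0: "a \<noteq> 0" using y1 by (simp add: a_def)
    have m: "(\<lambda>x. ?G (?v x (cayley1 y))) \<in> borel_measurable ?P"
      by (rule measurable_compose[OF vx, of ?G borel]) measurable
    have m2: "(\<lambda>x. F (cayley (?v x y)) * indicator (ball 0 1) (?v x y)) \<in> borel_measurable ?P"
      by (rule measurable_compose[OF vx, of "\<lambda>w. F (cayley w) * indicator (ball 0 1) w" borel]) measurable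
    have "H (cayley1 y) = ennreal (\<Prod>i\<in>?I. (cmod a)\<^sup>2) * (\<integral>\<^sup>+x. ?G (?v (\<lambda>i\<in>?I. a * x i) (cayley1 y)) \<partial>?P)"
      unfolding H_def by (rule nn_integral_PiM_scale[where a = "\<lambda>_. a", OF _ _ m]) (simp_all add: a0)
    also have "(\<lambda>x. ?G (?v (\<lambda>i\<in>?I. a * x i) (cayley1 y))) = (\<lambda>x. F (cayley (?v x y)) * indicator (ball 0 1) (?v x y))"
    proof
      fix x
      have eq: "?v (\<lambda>i\<in>?I. a * x i) (cayley1 y) = cayley (?v x y)"
        by (simp add: cayley_def vec_eq_iff a_def field_simps)
      show "?G (?v (\<lambda>i\<in>?I. a * x i) (cayley1 y)) = F (cayley (?v x y)) * indicator (ball 0 1) (?v x y)"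
        unfolding eq using cayley_in_siegel[of "?v x y"] y1 by (simp add: indicator_def)
    qed
    finally have h: "H (cayley1 y) = ennreal (\<Prod>i\<in>?I. (cmod a)\<^sup>2) * (\<integral>\<^sup>+x. F (cayley (?v x y)) * indicator (ball 0 1) (?v x y) \<partial>?P)" .
    have card: "Suc (card ?I) = CARD('n)"
      using card_Suc_Diff1[of UNIV "last_ix :: 'n"] by simp
    have "(\<Prod>i\<in>?I. (cmod a)\<^sup>2) * (cmod (2 * \<i> / (1 - y)\<^sup>2))\<^sup>2 = ((cmod a)\<^sup>2) ^ card ?I * (4 * ((cmod a)\<^sup>2)\<^sup>2)"
      by (simp add: a_def norm_divide norm_mult norm_power norm_inverse power_divide divide_inverse power_mult_distrib power_inverse)
    also have "\<dots> = 4 * ((cmod a)\<^sup>2) ^ (Suc (card ?I) + 1)"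
    proof -
      have "X ^ k * (4 * X\<^sup>2) = 4 * X ^ (Suc k + 1)" for X :: real and k
        by (simp add: power2_eq_square)
      then show ?thesis .
    qed
    also have "\<dots> = 4 / cmod (1 - y) ^ (2 * (CARD('n) + 1))"
      unfolding card power_mult[symmetric] by (simp add: a_def norm_inverse divide_inverse power_inverse)
    finally have const: "(\<Prod>i\<in>?I. (cmod a)\<^sup>2) * (cmod (2 * \<i> / (1 - y)\<^sup>2))\<^sup>2 = 4 / cmod (1 - y) ^ (2 * (CARD('n) + 1))" .
    have "H (cayley1 y) * ennreal ((cmod (2 * \<i> / (1 - y)\<^sup>2))\<^sup>2)
      = ennreal ((\<Prod>i\<in>?I. (cmod a)\<^sup>2) * (cmod (2 * \<i> / (1 - y)\<^sup>2))\<^sup>2) * (\<integral>\<^sup>+x. F (cayley (?v x y)) * indicator (ball 0 1) (?v x y) \<partial>?P)"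
      unfolding h by (subst ennreal_mult) (auto simp: ac_simps intro!: prod_nonneg)
    also have "\<dots> = (\<integral>\<^sup>+x. F (cayley (?v x y)) * ennreal (4 / cmod (1 - y) ^ (2 * (CARD('n) + 1))) * indicator (ball 0 1) (?v x y) \<partial>?P)"
      unfolding const by (subst nn_integral_cmult[symmetric, OF m2]) (simp add: ac_simps)
    finally show ?thesis .
  qed
  have "(\<integral>\<^sup>+w. ?G w \<partial>lborel) = (\<integral>\<^sup>+y. H y \<partial>lborel)"
    unfolding H_def by (rule nn_integral_vec_split(2)) measurable
  also have "\<dots> = (\<integral>\<^sup>+y. H y * indicator (cayley1 ` ball 0 1) y \<partial>lborel)"
    using H0 by (intro nn_integral_cong) auto
  also have "\<dots> = (\<integral>\<^sup>+y. H (cayley1 y) * ennreal ((cmod (2 * \<i> / (1 - y)\<^sup>2))\<^sup>2) * indicator (ball 0 1) y \<partial>lborel)"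
    by (rule nn_integral_holomorphic_image[OF _ _ cayley1_deriv inj_on_cayley1])
       (use opens in \<open>auto simp: cayley1_image\<close>)
  also have "\<dots> = (\<integral>\<^sup>+y. \<integral>\<^sup>+x. F (cayley (?v x y)) * ennreal (4 / cmod (1 - y) ^ (2 * (CARD('n) + 1))) * indicator (ball 0 1) (?v x y) \<partial>?P \<partial>lborel)"
  proof (intro nn_integral_cong)
    fix y
    show "H (cayley1 y) * ennreal ((cmod (2 * \<i> / (1 - y)\<^sup>2))\<^sup>2) * indicator (ball 0 1) y
      = (\<integral>\<^sup>+x. F (cayley (?v x y)) * ennreal (4 / cmod (1 - y) ^ (2 * (CARD('n) + 1))) * indicator (ball 0 1) (?v x y) \<partial>?P)"
    proof (cases "cmod y < 1")
      case True then show ?thesis using HC[OF True] by simp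
    next
      case False
      then have "\<not> norm (?v x y) < 1" for x
        using last_coord_ne_1(1)[of "?v x y"] by auto
      then show ?thesis using False by simp
    qed
  qed
  also have "\<dots> = (\<integral>\<^sup>+x. F (cayley x) * ennreal (4 / cmod (1 - x $ last_ix) ^ (2 * (CARD('n) + 1))) * indicator (ball 0 1) x \<partial>lborel)"
    by (subst nn_integral_vec_split(2)[where l = last_ix]) simp_all
  finally show ?thesis .
qed

section \<open>Forelli--Rudin estimate\<close>

lemma nn_integral_one_plus_abs_powr_finite:
  assumes "a > (1::real)"
  shows "(\<integral>\<^sup>+t. ennreal ((1 + \<bar>t\<bar>) powr (- a)) \<partial>lborel) < \<infinity>"
proof -
  define g where "g t = ennreal (if 0 \<le> t then (1 + t) powr (- a) else 0)" for t :: real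
  have [measurable]: "g \<in> borel_measurable borel" unfolding g_def[abs_def] by measurable
  have "((\<lambda>x. x powr (- a)) has_integral - (1 powr (- a + 1)) / (- a + 1)) {1..}"
    by (rule has_integral_powr_to_inf) (use assms in auto)
  then have "((\<lambda>x. if x \<in> {1..} then x powr (- a) else 0) has_integral - (1 powr (- a + 1)) / (- a + 1)) UNIV"
    by (simp only: has_integral_restrict_UNIV)
  then have "(\<integral>\<^sup>+t. ennreal (if t \<in> {1..} then t powr (- a) else 0) \<partial>lborel) = ennreal (- (1 powr (- a + 1)) / (- a + 1))"
    by (intro nn_integral_has_integral_lborel) auto
  then have 1: "(\<integral>\<^sup>+t. ennreal (if t \<in> {1..} then t powr (- a) else 0) \<partial>lborel) < \<infinity>"
    by simp
  have "(\<integral>\<^sup>+t. g t \<partial>lborel) = (\<integral>\<^sup>+t. g (- 1 + t) \<partial>lborel)"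
    by (rule nn_integral_lborel_translate) simp
  also have "\<dots> = (\<integral>\<^sup>+t. ennreal (if t \<in> {1..} then t powr (- a) else 0) \<partial>lborel)"
    by (intro nn_integral_cong) (auto simp: g_def)
  finally have g: "(\<integral>\<^sup>+t. g t \<partial>lborel) < \<infinity>" using 1 by simp
  have g': "(\<integral>\<^sup>+t. g (- t) \<partial>lborel) = (\<integral>\<^sup>+t. g t \<partial>lborel)"
    using nn_integral_real_affine[of g "-1" 0] by simp
  have "(\<integral>\<^sup>+t. ennreal ((1 + \<bar>t\<bar>) powr (- a)) \<partial>lborel) \<le> (\<integral>\<^sup>+t. g t + g (- t) \<partial>lborel)"
    by (intro nn_integral_mono) (auto simp: g_def abs_if)
  also have "\<dots> = (\<integral>\<^sup>+t. g t \<partial>lborel) + (\<integral>\<^sup>+t. g t \<partial>lborel)"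
    by (subst nn_integral_add) (auto simp: g')
  finally show ?thesis using g by (auto simp: le_less_trans)
qed

text \<open>The integrand behaves like \<open>t powr l\<close> at 0, integrable because
  \<open>l > - 1\<close>, and like \<open>t powr (- 3 / 2)\<close> at infinity.\<close>

lemma nn_integral_powr_over_one_plus_finite:
  assumes "l > (- 1::real)"
  shows "(\<integral>\<^sup>+t. ennreal (if 0 < t then t powr l * (1 + t) powr (- (l + 3 / 2)) else 0) \<partial>lborel) < \<infinity>"
proof -
  \<comment> \<open>For \<open>t\<close> at least 1 the quotient \<open>t / (1 + t)\<close> lies
    between 1/2 and 1, so its power \<open>l\<close> is at most 1 or \<open>2 powr (- l)\<close>,
    according to the sign of \<open>l\<close>.\<close>
  define C where "C = max 1 (2 powr (- l))"
  have "((\<lambda>x. x powr l) has_integral (1 powr (l + 1) / (l + 1))) {0..1}"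
    by (rule has_integral_powr_from_0) (use assms in auto)
  then have "((\<lambda>x. if x \<in> {0..1} then x powr l else 0) has_integral (1 powr (l + 1) / (l + 1))) UNIV"
    by (simp only: has_integral_restrict_UNIV)
  then have "(\<integral>\<^sup>+t. ennreal (if t \<in> {0..1} then t powr l else 0) \<partial>lborel) = ennreal (1 powr (l + 1) / (l + 1))"
    by (intro nn_integral_has_integral_lborel) auto
  then have 1: "(\<integral>\<^sup>+t. ennreal (if t \<in> {0..1} then t powr l else 0) \<partial>lborel) < \<infinity>" by simp
  have "((\<lambda>x. x powr (- 3 / 2)) has_integral - (1 powr (- 3 / 2 + 1)) / (- 3 / 2 + 1)) {1::real..}"
    by (rule has_integral_powr_to_inf) auto
  then have "((\<lambda>x. if x \<in> {1..} then x powr (- 3 / 2) else 0) has_integral - (1 powr (- 3 / 2 + 1)) / (- 3 / 2 + 1)) (UNIV::real set)"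
    by (simp only: has_integral_restrict_UNIV)
  then have "(\<integral>\<^sup>+t. ennreal (if t \<in> {1..} then t powr (- 3 / 2) else 0) \<partial>lborel) = ennreal (- (1 powr (- 3 / 2 + 1)) / (- 3 / 2 + 1))"
    by (intro nn_integral_has_integral_lborel) auto
  then have 2: "(\<integral>\<^sup>+t. ennreal (if t \<in> {1..} then t powr (- 3 / 2) else 0) \<partial>lborel) < \<infinity>" by simp
  have bound: "t powr l * (1 + t) powr (- (l + 3 / 2)) \<le> C * t powr (- 3 / 2)" if "t \<ge> 1" for t
  proof -
    have q: "(t / (1 + t)) powr l \<le> C"
    proof (cases "l \<ge> 0")
      case True
      then have "(t / (1 + t)) powr l \<le> 1" using that by (intro powr_le1) auto
      then show ?thesis by (simp add: C_def)
    next
      case False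
      have "(t / (1 + t)) powr l \<le> (1 / 2) powr l"
        using that False by (intro powr_mono2') (auto simp: field_simps)
      also have "\<dots> = 2 powr (- l)" by (simp add: powr_minus powr_divide inverse_eq_divide)
      finally show ?thesis by (simp add: C_def)
    qed
    have "t powr l * (1 + t) powr (- (l + 3 / 2)) = (t / (1 + t)) powr l * (1 + t) powr (- 3 / 2)"
    proof -
      have "(1 + t) powr (- (l + 3 / 2)) = (1 + t) powr (- l) * (1 + t) powr (- 3 / 2)"
        by (simp flip: powr_add)
      then show ?thesis using that by (simp add: powr_divide powr_minus[of _ l] field_simps)
    qed
    also have "\<dots> \<le> C * t powr (- 3 / 2)"
      using that q by (intro mult_mono powr_mono2') (auto simp: C_def)
    finally show ?thesis .
  qed
  have "(\<integral>\<^sup>+t. ennreal (if 0 < t then t powr l * (1 + t) powr (- (l + 3 / 2)) else 0) \<partial>lborel)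
    \<le> (\<integral>\<^sup>+t. ennreal (if t \<in> {0..1} then t powr l else 0) + ennreal C * ennreal (if t \<in> {1..} then t powr (- 3 / 2) else 0) \<partial>lborel)"
  proof (intro nn_integral_mono)
    fix t :: real
    have C: "0 \<le> C" by (simp add: C_def)
    show "ennreal (if 0 < t then t powr l * (1 + t) powr (- (l + 3 / 2)) else 0)
      \<le> ennreal (if t \<in> {0..1} then t powr l else 0) + ennreal C * ennreal (if t \<in> {1..} then t powr (- 3 / 2) else 0)"
    proof (cases "0 < t \<and> t \<le> 1")
      case True
      have "(1 + t) powr (- (l + 3 / 2)) \<le> 1"
        using True assms powr_mono[of "- (l + 3 / 2)" 0 "1 + t"] by simp
      then have "t powr l * (1 + t) powr (- (l + 3 / 2)) \<le> t powr l"
        by (simp add: mult_left_le)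
      then have "ennreal (t powr l * (1 + t) powr (- (l + 3 / 2))) \<le> ennreal (t powr l)"
        by (rule ennreal_leI)
      then show ?thesis using True by (auto intro: add_increasing2)
    next
      case False
      then show ?thesis using bound[of t] C by (auto simp: ennreal_mult[symmetric] intro!: ennreal_leI)
    qed
  qed
  also have "\<dots> = (\<integral>\<^sup>+t. ennreal (if t \<in> {0..1} then t powr l else 0) \<partial>lborel)
      + ennreal C * (\<integral>\<^sup>+t. ennreal (if t \<in> {1..} then t powr (- 3 / 2) else 0) \<partial>lborel)"
    by (subst nn_integral_add) (auto simp: nn_integral_cmult)
  also have "\<dots> < \<infinity>" using 1 2 by (auto simp: ennreal_mult_less_top)
  finally show ?thesis .
qed

lemma norm_rr_base: "cmod (rr base_pt w) = cmod (w $ last_ix + \<i>) / 2"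
proof -
  have "(\<Sum>j\<in>UNIV - {last_ix}. base_pt $ j * cnj (w $ j)) = 0"
    by (rule sum.neutral) (auto simp: base_pt_def axis_def)
  then have "rr base_pt w = \<i> / 2 * cnj (w $ last_ix + \<i>)"
    by (simp add: rr_def base_pt_def)
  then show ?thesis by (simp only: norm_mult norm_divide complex_mod_cnj) simp
qed

text \<open>
  A shear turns \<open>siegel\<close> into \<open>Im z\<^sub>n > 0\<close>; the integrand is then dominated by a product of functions of
  the real coordinates. The exponents \<open>a\<close> and \<open>l + 3/2\<close> make each factor integrable and
  satisfy \<open>n a + (l + 3/2) = n + 2 + l\<close>.
\<close>

lemma forelli_rudin_base:
  assumes l: "l > - 1"
  shows "(\<integral>\<^sup>+w. ennreal (rho w powr l * cmod (rr base_pt w) powr (- (real CARD('n) + 2 + l))) * indicator siegel (w :: 'n::{finite,linorder} cspace) \<partial>lborel) < \<infinity>"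
proof -
  define n where "n = real CARD('n)"
  have n: "n \<ge> 1" using zero_less_card_finite[where 'a='n] unfolding n_def by linarith
  define a where "a = 1 + 1 / (2 * n)"
  define p where "p = n + 2 + l"
  have a: "a > 1" using n by (simp add: a_def)
  have p: "n * a + (l + 3 / 2) = p" using n by (simp add: a_def p_def field_simps)
  let ?I = "UNIV - {last_ix :: 'n}"
  let ?S = "\<lambda>w :: 'n cspace. \<Sum>j\<in>?I. (cmod (w $ j))\<^sup>2"
  let ?F = "\<lambda>w :: 'n cspace. ennreal (rho w powr l * cmod (rr base_pt w) powr (- p)) * indicator siegel w"
  \<comment> \<open>One factor for each of the 2n real coordinates. After the shear the imaginary
    part of the last coordinate is the height \<open>rho\<close>, so only that factor carries the
    weight \<open>t powr l\<close>.\<close>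
  define f where "f b t = (if b = axis last_ix \<i> then (if 0 < t then t powr l * (1 + t) powr (- (l + 3 / 2)) else 0)
      else (1 + \<bar>t\<bar>) powr (- a))" for b :: "'n cspace" and t :: real
  have f0: "0 \<le> f b t" for b t by (simp add: f_def)
  have [measurable]: "(\<lambda>t. f b t) \<in> borel_measurable borel" for b unfolding f_def by measurable
  have [measurable]: "?S \<in> borel_measurable borel"
    by (intro borel_measurable_continuous_onI continuous_intros)
  have [measurable]: "(\<lambda>w :: 'n cspace. rr base_pt w) \<in> borel_measurable borel"
    unfolding rr_def by (intro borel_measurable_continuous_onI continuous_intros)
  have "(\<integral>\<^sup>+w. ?F w \<partial>lborel) = (\<integral>\<^sup>+w. ?F (w + axis last_ix (\<i> * ?S w)) \<partial>lborel)"
    by (rule nn_integral_vec_shear) (auto intro!: sum.cong)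
  also have "\<dots> \<le> (\<integral>\<^sup>+w. ennreal (4 powr p) * ennreal (\<Prod>b\<in>Basis. f b (w \<bullet> b)) \<partial>lborel)"
  proof (intro nn_integral_mono)
    fix w :: "'n cspace"
    let ?w = "w + axis last_ix (\<i> * ?S w)"
    let ?h = "Im (w $ last_ix)" and ?x = "Re (w $ last_ix)"
    have S: "?S ?w = ?S w" by (rule sum.cong) (auto simp: axis_def)
    have rho: "rho ?w = ?h" unfolding rho_def S by (simp add: axis_def)
    show "?F ?w \<le> ennreal (4 powr p) * ennreal (\<Prod>b\<in>Basis. f b (w \<bullet> b))"
    proof (cases "0 < ?h")
      case False
      then have "?w \<notin> siegel" unfolding siegel_def mem_Collect_eq rho .
      moreover have "?F x \<le> y" if "x \<notin> siegel" for x y using that by simp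
      ultimately show ?thesis by blast
    next
      case h: True
      define A where "A = cmod (?w $ last_ix + \<i>)"
      have S0: "0 \<le> ?S w" by (intro sum_nonneg) auto
      have A1: "?h + ?S w + 1 \<le> A"
        using abs_Im_le_cmod[of "?w $ last_ix + \<i>"] h S0 by (simp add: A_def axis_def)
      have Ax: "\<bar>?x\<bar> \<le> A"
        using abs_Re_le_cmod[of "?w $ last_ix + \<i>"] by (simp add: A_def axis_def)
      \<comment> \<open>\<open>A\<close> is twice the modulus of \<open>rr base_pt ?w\<close> and at
        least 1 plus the height; doubling it also covers 1 plus the modulus of \<open>?x\<close>.
        The constant \<open>4 powr p\<close> comes from the kernel modulus being
        \<open>B / 4\<close>.\<close>
      define B where "B = 2 * A"
      have B: "1 + ?h \<le> B" "1 + \<bar>?x\<bar> \<le> B" "B > 0" using A1 Ax h S0 by (auto simp: B_def)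
      \<comment> \<open>The coordinates of the block z' are controlled by \<open>B\<close> only
        through their squares, so each yields half the exponent; the real and imaginary parts at one
        index together yield \<open>B powr (- a)\<close>.\<close>
      have t: "(1 + \<bar>t\<bar>) powr (- a) \<ge> B powr (- a / 2)" if "t\<^sup>2 \<le> ?S w" for t :: real
      proof -
        have "(1 + \<bar>t\<bar>)\<^sup>2 \<le> 2 * (1 + t\<^sup>2)"
          using zero_le_power2[of "1 - \<bar>t\<bar>"] by (simp add: power2_eq_square algebra_simps abs_mult_self_eq)
        also have "\<dots> \<le> B" using that A1 h by (simp add: B_def)
        finally have "(1 + \<bar>t\<bar>) \<le> sqrt B" by (simp add: real_le_rsqrt)
        then have "(1 + \<bar>t\<bar>) powr (- a) \<ge> (sqrt B) powr (- a)"
          using a by (intro powr_mono2') auto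
        then show ?thesis using B by (simp add: powr_half_sqrt[symmetric] powr_powr)
      qed
      have bt: "(cmod (w $ i))\<^sup>2 \<le> ?S w" if "i \<noteq> last_ix" for i
        using that by (intro member_le_sum) auto
      have Bb: "(Basis :: complex set) = {1, \<i>}" by (simp add: Basis_complex_def)
      have "(\<Prod>b\<in>Basis. f b (w \<bullet> b)) = (\<Prod>i\<in>UNIV. \<Prod>u\<in>Basis. f (axis i u) (w $ i \<bullet> u))"
        unfolding Basis_vec_image prod.reindex[OF inj_on_axis_Basis]
        by (simp add: prod.cartesian_product split_beta inner_axis)
      also have "\<dots> = (\<Prod>i\<in>UNIV. f (axis i 1) (Re (w $ i)) * f (axis i \<i>) (Im (w $ i)))"
        by (simp add: Bb inner_complex_def)
      also have "\<dots> = f (axis last_ix 1) ?x * f (axis last_ix \<i>) ?h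
         * (\<Prod>i\<in>?I. f (axis i 1) (Re (w $ i)) * f (axis i \<i>) (Im (w $ i)))"
        by (rule prod.remove) auto
      also have "\<dots> \<ge> (B powr (- a) * (?h powr l * B powr (- (l + 3 / 2)))) * (\<Prod>i\<in>?I. B powr (- a / 2) * B powr (- a / 2))"
      proof (intro mult_mono prod_mono conjI)
        show "B powr (- a) \<le> f (axis last_ix 1) ?x"
          using a B by (auto simp: f_def axis_eq_axis complex_eq_iff intro!: powr_mono2')
        show "?h powr l * B powr (- (l + 3 / 2)) \<le> f (axis last_ix \<i>) ?h"
          using h B l by (auto simp: f_def intro!: mult_left_mono powr_mono2')
        fix i assume i: "i \<in> ?I"
        have r: "(Re (w $ i))\<^sup>2 \<le> ?S w" "(Im (w $ i))\<^sup>2 \<le> ?S w"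
          using bt[of i] i unfolding cmod_power2
          by (smt (verit, best) DiffD2 insertI1 zero_le_power2)+
        show "B powr (- a / 2) \<le> f (axis i 1) (Re (w $ i))" "B powr (- a / 2) \<le> f (axis i \<i>) (Im (w $ i))"
          using i t[OF r(1)] t[OF r(2)] by (auto simp: f_def axis_eq_axis)
      qed (auto simp: f0 intro!: prod_nonneg)
      also have "(B powr (- a) * (?h powr l * B powr (- (l + 3 / 2)))) * (\<Prod>i\<in>?I. B powr (- a / 2) * B powr (- a / 2))
         = ?h powr l * B powr (- p)"
      proof -
        have "(\<Prod>i\<in>?I. B powr (- a / 2) * B powr (- a / 2)) = (B powr (- a)) ^ card ?I"
          by (simp flip: powr_add)
        also have "\<dots> = B powr (- a * (n - 1))"
          using B n by (simp add: powr_realpow[symmetric] powr_powr card_Diff_singleton n_def of_nat_diff)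
        finally show ?thesis
          using p by (simp add: powr_add[symmetric] algebra_simps)
      qed
      finally have le: "?h powr l * B powr (- p) \<le> (\<Prod>b\<in>Basis. f b (w \<bullet> b))" .
      have "rho ?w powr l * cmod (rr base_pt ?w) powr (- p) = ?h powr l * (B / 4) powr (- p)"
        unfolding rho norm_rr_base A_def[symmetric] B_def by simp
      also have "(B / 4) powr (- p) = 4 powr p * B powr (- p)"
        using B by (simp add: powr_divide powr_minus field_simps)
      also have "?h powr l * (4 powr p * B powr (- p)) \<le> 4 powr p * (\<Prod>b\<in>Basis. f b (w \<bullet> b))"
        using mult_left_mono[OF le, of "4 powr p"] by (simp add: mult.left_commute)
      finally have "ennreal (rho ?w powr l * cmod (rr base_pt ?w) powr (- p)) \<le> ennreal (4 powr p * (\<Prod>b\<in>Basis. f b (w \<bullet> b)))"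
        by (rule ennreal_leI)
      also have "\<dots> = ennreal (4 powr p) * ennreal (\<Prod>b\<in>Basis. f b (w \<bullet> b))"
        by (simp add: ennreal_mult f0 prod_nonneg)
      finally show ?thesis by (auto simp: indicator_def)
    qed
  qed
  also have "\<dots> = ennreal (4 powr p) * (\<integral>\<^sup>+w. ennreal (\<Prod>b\<in>Basis. f b (w \<bullet> b)) \<partial>(lborel :: 'n cspace measure))"
    by (rule nn_integral_cmult) measurable
  also have "(\<integral>\<^sup>+w. ennreal (\<Prod>b\<in>Basis. f b (w \<bullet> b)) \<partial>(lborel :: 'n cspace measure)) = (\<Prod>b\<in>(Basis :: 'n cspace set). (\<integral>\<^sup>+t. ennreal (f b t) \<partial>lborel))"
    using nn_integral_lborel_prod[where f = "\<lambda>b t. ennreal (f b t)" and 'a = "'n cspace"]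
    by (simp add: prod_ennreal f0)
  also have "ennreal (4 powr p) * \<dots> < \<infinity>"
  proof -
    have "(\<integral>\<^sup>+t. ennreal (f b t) \<partial>lborel) < \<infinity>" for b
      using nn_integral_one_plus_abs_powr_finite[OF a] nn_integral_powr_over_one_plus_finite[OF l]
      by (cases "b = axis last_ix \<i>") (simp_all add: f_def)
    then have "(\<Prod>b\<in>(Basis :: 'n cspace set). (\<integral>\<^sup>+t. ennreal (f b t) \<partial>lborel)) \<noteq> \<infinity>"
      by (auto simp: ennreal_prod_eq_top less_top)
    then show ?thesis by (simp add: ennreal_mult_less_top less_top)
  qed
  finally show ?thesis unfolding p_def n_def .
qed

section \<open>Integration in ball coordinates centred at a point\<close>

definition jac :: "'n::{finite,linorder} cspace \<Rightarrow> 'n cspace \<Rightarrow> real" where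
  "jac z x = rho z ^ (CARD('n) + 1) * (4 / cmod (1 - x $ last_ix) ^ (2 * (CARD('n) + 1)))"

text \<open>Coordinates from the unit ball in which the prescribed point \<open>z\<close> sits at
  the centre; \<open>jac\<close> is the real Jacobian of this map.\<close>

definition siegel_param :: "'n::{finite,linorder} cspace \<Rightarrow> 'n cspace \<Rightarrow> 'n cspace" where
  "siegel_param z x = siegel_map z (cayley x)"

lemma measurable_siegel_param [measurable]: "siegel_param z \<in> borel_measurable borel"
  unfolding siegel_param_def[abs_def] by measurable

lemma measurable_jac [measurable]: "jac z \<in> borel_measurable borel"
  unfolding jac_def[abs_def] by measurable

lemma jac_nonneg: "z \<in> siegel \<Longrightarrow> 0 \<le> jac z x"
  by (simp add: jac_def siegel_def)

lemma nn_integral_siegel_param: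
  fixes F :: "'n::{finite,linorder} cspace \<Rightarrow> ennreal"
  assumes z: "z \<in> siegel" and F [measurable]: "F \<in> borel_measurable borel"
  shows "(\<integral>\<^sup>+w. F w * indicator siegel w \<partial>lborel)
    = (\<integral>\<^sup>+x. F (siegel_param z x) * ennreal (jac z x * indicator (ball 0 1) x) \<partial>lborel)"
proof -
  have [measurable]: "ball (0 :: 'n cspace) 1 \<in> sets borel" by simp
  have "(\<integral>\<^sup>+w. F w * indicator siegel w \<partial>lborel)
     = ennreal (rho z ^ (CARD('n) + 1)) * (\<integral>\<^sup>+w. F (siegel_map z w) * indicator siegel (siegel_map z w) \<partial>lborel)"
    by (rule nn_integral_siegel_map[OF z]) measurable
  also have "(\<integral>\<^sup>+w. F (siegel_map z w) * indicator siegel (siegel_map z w) \<partial>lborel)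
    = (\<integral>\<^sup>+w. F (siegel_map z w) * indicator siegel w \<partial>lborel)"
    using siegel_map_in_siegel[OF z] by (intro nn_integral_cong) (simp add: indicator_def)
  also have "\<dots> = (\<integral>\<^sup>+x. F (siegel_map z (cayley x)) * ennreal (4 / cmod (1 - x $ last_ix) ^ (2 * (CARD('n) + 1))) * indicator (ball 0 1) x \<partial>lborel)"
    by (rule nn_integral_cayley) measurable
  also have "ennreal (rho z ^ (CARD('n) + 1)) * \<dots> = (\<integral>\<^sup>+x. ennreal (rho z ^ (CARD('n) + 1)) * (F (siegel_map z (cayley x)) * ennreal (4 / cmod (1 - x $ last_ix) ^ (2 * (CARD('n) + 1))) * indicator (ball 0 1) x) \<partial>lborel)"
    by (rule nn_integral_cmult[symmetric]) measurable
  also have "\<dots> = (\<integral>\<^sup>+x. F (siegel_param z x) * ennreal (jac z x * indicator (ball 0 1) x) \<partial>lborel)"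
  proof (intro nn_integral_cong)
    fix x :: "'n cspace"
    have "ennreal (jac z x) = ennreal (rho z ^ (CARD('n) + 1)) * ennreal (4 / cmod (1 - x $ last_ix) ^ (2 * (CARD('n) + 1)))"
      unfolding jac_def using z by (intro ennreal_mult) (auto simp: siegel_def)
    then show "ennreal (rho z ^ (CARD('n) + 1)) * (F (siegel_map z (cayley x)) * ennreal (4 / cmod (1 - x $ last_ix) ^ (2 * (CARD('n) + 1))) * indicator (ball 0 1) x)
      = F (siegel_param z x) * ennreal (jac z x * indicator (ball 0 1) x)"
      by (auto simp: siegel_param_def indicator_def ac_simps)
  qed
  finally show ?thesis .
qed

text \<open>Recasting the formula for nonnegative functions as an equality of measures carries it
  over to Bochner integrals, integrability included.\<close>

lemma siegel_param_distr:
  assumes z: "z \<in> siegel"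
  shows "density lborel (\<lambda>w. ennreal (indicator siegel w))
    = distr (density lborel (\<lambda>x. ennreal (jac z x * indicator (ball 0 1) x))) borel (siegel_param z)"
    (is "?L = ?R")
proof (rule measure_eqI)
  fix A assume "A \<in> sets ?L"
  then have A [measurable]: "A \<in> sets borel" by simp
  have [measurable]: "ball (0 :: 'a cspace) 1 \<in> sets borel" by simp
  have m: "siegel_param z -` A \<in> sets borel"
    using measurable_sets[OF measurable_siegel_param A] by simp
  have "emeasure ?L A = (\<integral>\<^sup>+w. indicator A w * indicator siegel w \<partial>lborel)"
    by (simp add: emeasure_density ennreal_indicator mult.commute)
  also have "\<dots> = (\<integral>\<^sup>+x. indicator A (siegel_param z x) * ennreal (jac z x * indicator (ball 0 1) x) \<partial>lborel)"
    by (rule nn_integral_siegel_param[OF z]) measurable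
  also have "\<dots> = emeasure ?R A"
    using m by (simp add: emeasure_distr emeasure_density mult.commute indicator_vimage)
  finally show "emeasure ?L A = emeasure ?R A" .
qed simp

lemma integral_siegel_param:
  fixes G :: "'n::{finite,linorder} cspace \<Rightarrow> 'b::{banach,second_countable_topology}"
  assumes z: "z \<in> siegel" and G [measurable]: "G \<in> borel_measurable borel"
  shows "integrable lborel (\<lambda>w. indicator siegel w *\<^sub>R G w)
      \<longleftrightarrow> integrable lborel (\<lambda>x. (jac z x * indicator (ball 0 1) x) *\<^sub>R G (siegel_param z x))"
    and "(\<integral>w. indicator siegel w *\<^sub>R G w \<partial>lborel)
      = (\<integral>x. (jac z x * indicator (ball 0 1) x) *\<^sub>R G (siegel_param z x) \<partial>lborel)"
proof -
  have [measurable]: "ball (0 :: 'n cspace) 1 \<in> sets borel" by simp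
  have nn: "0 \<le> jac z x * indicator (ball 0 1) x" for x
    using jac_nonneg[OF z] by simp
  show "integrable lborel (\<lambda>w. indicator siegel w *\<^sub>R G w)
      \<longleftrightarrow> integrable lborel (\<lambda>x. (jac z x * indicator (ball 0 1) x) *\<^sub>R G (siegel_param z x))"
    using nn by (subst (1 2) integrable_density[symmetric])
      (auto simp: siegel_param_distr[OF z] integrable_distr_eq)
  show "(\<integral>w. indicator siegel w *\<^sub>R G w \<partial>lborel)
      = (\<integral>x. (jac z x * indicator (ball 0 1) x) *\<^sub>R G (siegel_param z x) \<partial>lborel)"
    using nn by (subst (1 2) integral_density[symmetric])
      (auto simp: siegel_param_distr[OF z] integral_distr)
qed

text \<open>The integral at \<open>base_pt\<close>. It is finite by
  \<open>forelli_rudin_base\<close>, so \<open>enn2real\<close> loses no information.\<close>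

definition FRc :: "'n::{finite,linorder} itself \<Rightarrow> real \<Rightarrow> real" where
  "FRc _ l = enn2real (\<integral>\<^sup>+w. ennreal (rho w powr l * cmod (rr base_pt w) powr (- (real CARD('n) + 2 + l)))
     * indicator siegel (w :: 'n cspace) \<partial>lborel)"

lemma measurable_rr [measurable]: "rr z \<in> borel_measurable borel"
  unfolding rr_def[abs_def] by (intro borel_measurable_continuous_onI continuous_intros)

text \<open>Transport by \<open>siegel_map z\<close>: Jacobian, weight and kernel contribute the
  powers \<open>n + 1\<close>, \<open>l\<close> and \<open>- (n + 2 + l)\<close> of
  \<open>rho z\<close>, whose sum is - 1.\<close>

lemma forelli_rudin:
  assumes l: "l > - 1" and z: "z \<in> siegel"
  shows "(\<integral>\<^sup>+w. ennreal (rho w powr l * cmod (rr z w) powr (- (real CARD('n) + 2 + l)))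
     * indicator siegel (w :: 'n::{finite,linorder} cspace) \<partial>lborel) = ennreal (FRc TYPE('n) l / rho z)"
proof -
  define p where "p = real CARD('n) + 2 + l"
  define r where "r = rho z"
  have r: "r > 0" using z by (simp add: r_def siegel_def)
  let ?F = "\<lambda>z w. ennreal (rho w powr l * cmod (rr z w) powr (- p)) * indicator siegel (w :: 'n cspace)"
  have pw: "r ^ (CARD('n) + 1) * (r powr l * r powr (- p)) = 1 / r"
  proof -
    have "r ^ (CARD('n) + 1) = r powr (real CARD('n) + 1)"
      using r powr_realpow[OF r, of "CARD('n) + 1"] by (simp only: of_nat_add of_nat_1)
    then show ?thesis
      using r by (simp add: powr_add[symmetric] p_def powr_minus_divide)
  qed
  have "(\<integral>\<^sup>+w. ?F z w \<partial>lborel) = ennreal (r ^ (CARD('n) + 1)) * (\<integral>\<^sup>+w. ?F z (siegel_map z w) \<partial>lborel)"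
    unfolding r_def by (rule nn_integral_siegel_map[OF z]) measurable
  also have "(\<integral>\<^sup>+w. ?F z (siegel_map z w) \<partial>lborel) = (\<integral>\<^sup>+w. ennreal (r powr l * r powr (- p)) * ?F base_pt w \<partial>lborel)"
  proof (intro nn_integral_cong)
    fix w :: "'n cspace"
    show "?F z (siegel_map z w) = ennreal (r powr l * r powr (- p)) * ?F base_pt w"
    proof (cases "w \<in> siegel")
      case True
      have "rr z (siegel_map z w) = of_real r * rr base_pt w"
        using rr_siegel_map[OF z, of base_pt w] siegel_map_base[OF z] by (simp add: r_def)
      then show ?thesis
        using True r by (simp add: siegel_map_in_siegel[OF z] rho_siegel_map[OF z] norm_mult powr_mult
            ennreal_mult[symmetric] ac_simps siegel_def flip: r_def)
    qed (simp add: siegel_map_in_siegel[OF z])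
  qed
  also have "\<dots> = ennreal (r powr l * r powr (- p)) * (\<integral>\<^sup>+w. ?F base_pt w \<partial>lborel)"
    by (rule nn_integral_cmult) measurable
  also have "(\<integral>\<^sup>+w. ?F base_pt w \<partial>lborel) = ennreal (FRc TYPE('n) l)"
    unfolding FRc_def p_def
    using forelli_rudin_base[OF l, where 'n = 'n] by (intro ennreal_enn2real[symmetric]) simp
  also have "ennreal (r ^ (CARD('n) + 1)) * (ennreal (r powr l * r powr (- p)) * ennreal (FRc TYPE('n) l))
     = ennreal (r ^ (CARD('n) + 1) * (r powr l * r powr (- p)) * FRc TYPE('n) l)"
    using r by (simp add: ennreal_mult[symmetric] FRc_def mult.assoc)
  finally show ?thesis unfolding pw by (simp add: p_def r_def)
qed

section \<open>Mean value property for radial weights on the unit ball\<close>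

lemma circle_mean_value:
  fixes h :: "complex \<Rightarrow> complex"
  assumes S: "open S" "cball 0 1 \<subseteq> S" and h: "h holomorphic_on S"
  shows "integrable (restrict_space lborel {0..2 * pi}) (\<lambda>t. h (cis t))"
    and "(\<integral>t. h (cis t) \<partial>restrict_space lborel {0..2 * pi}) = 2 * pi * h 0"
proof -
  have cont: "continuous_on {0..2 * pi} (\<lambda>t. h (cis t))"
    using continuous_on_compose2[OF holomorphic_on_imp_continuous_on[OF h], of "{0..2 * pi}" cis] S
      continuous_on_cis[OF continuous_on_id, of "{0..2 * pi}"]
    by (auto simp: subset_eq)
  then have si: "set_integrable lborel {0..2 * pi} (\<lambda>t. h (cis t))"
    unfolding set_integrable_def by (intro borel_integrable_compact) auto
  then show "integrable (restrict_space lborel {0..2 * pi}) (\<lambda>t. h (cis t))"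
    by (simp add: integrable_restrict_space set_integrable_def)
  have "((\<lambda>u. h u / (u - 0)) has_contour_integral (2 * of_real pi * \<i> * h 0)) (circlepath 0 1)"
    by (rule Cauchy_integral_circlepath_simple) (use S h holomorphic_on_subset in auto)
  then have "((\<lambda>t. h (0 + of_real 1 * cis t) / (0 + of_real 1 * cis t - 0) * of_real 1 * \<i> * cis t) has_integral (2 * of_real pi * \<i> * h 0)) {0..2 * pi}"
    unfolding circlepath_def by (subst (asm) has_contour_integral_part_circlepath_iff) auto
  then have "((\<lambda>t. h (cis t) * \<i>) has_integral (2 * of_real pi * \<i> * h 0)) {0..2 * pi}"
    by (simp add: cis_neq_zero)
  from has_integral_mult_left[OF this, of "- \<i>"]
  have "((\<lambda>t. (h (cis t) * \<i>) * (- \<i>)) has_integral ((2 * of_real pi * \<i> * h 0) * (- \<i>))) {0..2 * pi}" .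
  moreover have "(2 * of_real pi * \<i> * h 0) * (- \<i>) = - (\<i> * \<i>) * (2 * pi * h 0)"
    by (simp only: mult_minus_left mult_minus_right of_real_mult of_real_numeral ac_simps)
  moreover have "(h (cis t) * \<i>) * (- \<i>) = h (cis t)" for t
    by (simp add: mult.assoc)
  ultimately have "((\<lambda>t. h (cis t)) has_integral (2 * pi * h 0)) {0..2 * pi}"
    by (simp only:) simp
  then show "(\<integral>t. h (cis t) \<partial>restrict_space lborel {0..2 * pi}) = 2 * pi * h 0"
    using set_borel_integral_eq_integral(2)[OF si]
    by (simp add: integral_restrict_space set_lebesgue_integral_def has_integral_iff)
qed

lemma lborel_rotate: "(lborel :: (complex ^ 'n) measure) = distr lborel borel (\<lambda>x. cis t *s x)"
proof (rule measure_eqI)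
  have [measurable]: "(\<lambda>x. cis t *s x) \<in> borel_measurable (borel :: (complex ^ 'n) measure)"
    unfolding vector_scalar_mult_def by (intro borel_measurable_continuous_onI continuous_intros)
  fix A assume "A \<in> sets (lborel :: (complex ^ 'n) measure)"
  then have A [measurable]: "A \<in> sets borel" by simp
  have m: "(\<lambda>x. cis t *s x) -` A \<in> sets borel"
    using measurable_sets[of "(\<lambda>x. cis t *s x)" borel borel A] by simp
  have "emeasure lborel A = (\<integral>\<^sup>+x. indicator A x \<partial>lborel)" by simp
  also have "\<dots> = (\<integral>\<^sup>+x. indicator A (cis t *s x) \<partial>lborel)"
    by (subst nn_integral_vec_scale[where a = "\<lambda>_. cis t"]) (auto simp: vector_scalar_mult_def)
  also have "\<dots> = emeasure (distr lborel borel (\<lambda>x. cis t *s x)) A"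
    using m by (simp add: emeasure_distr flip: indicator_vimage)
  finally show "emeasure lborel A = emeasure (distr lborel borel (\<lambda>x. cis t *s x)) A" .
qed simp

lemma norm_cis_scale: "norm (cis t *s x) = norm x" for x :: "complex ^ 'n"
  by (simp add: norm_vec_def L2_set_def norm_mult)

text \<open>Averaging over the rotations \<open>cis t\<close> changes neither the measure nor the
  radial weight, and replaces \<open>V x\<close> by its mean over a circle in the complex line
  through \<open>x\<close>, which is \<open>V 0\<close>. Hence \<open>hol\<close> asks for
  holomorphy on lines through \<open>0\<close>.\<close>

lemma ball_mean_value:
  fixes V :: "complex ^ 'n \<Rightarrow> complex" and \<phi> :: "real \<Rightarrow> real"
  assumes V: "continuous_on (ball 0 1) V" and \<phi> [measurable]: "\<phi> \<in> borel_measurable borel"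
    and hol: "\<And>x. norm x < 1 \<Longrightarrow> (\<lambda>c. V (c *s x)) holomorphic_on {c. cmod c * norm x < 1}"
    and int: "integrable lborel (\<lambda>x. (indicator (ball 0 1) x * \<phi> (norm x)) *\<^sub>R V x)"
    and int': "integrable lborel (\<lambda>x :: complex ^ 'n. indicator (ball 0 1) x * \<phi> (norm x))"
  shows "(\<integral>x. (indicator (ball 0 1) x * \<phi> (norm x)) *\<^sub>R V x \<partial>lborel)
     = of_real (\<integral>x. indicator (ball 0 1) (x :: complex ^ 'n) * \<phi> (norm x) \<partial>lborel) * V 0"
proof -
  define W where "W x = (indicator (ball 0 1) x * \<phi> (norm x)) *\<^sub>R V x" for x :: "complex ^ 'n"
  let ?M = "restrict_space lborel {0..2 * pi} :: real measure"
  have [measurable]: "ball (0 :: complex ^ 'n) 1 \<in> sets borel" by simp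
  have iV [measurable]: "(\<lambda>x. indicator (ball 0 1) x *\<^sub>R V x) \<in> borel_measurable borel"
    by (rule borel_measurable_continuous_on_indicator) (use V in auto)
  have W_eq: "W = (\<lambda>x. \<phi> (norm x) *\<^sub>R (indicator (ball 0 1) x *\<^sub>R V x))"
    by (auto simp: W_def)
  have W [measurable]: "W \<in> borel_measurable borel"
    unfolding W_eq by measurable
  have intW: "integrable lborel W" using int by (simp add: W_def[abs_def])
  have rot [measurable]: "(\<lambda>p. cis (fst p) *s snd p) \<in> borel_measurable (borel \<Otimes>\<^sub>M (borel :: (complex ^ 'n) measure))"
    unfolding borel_prod vector_scalar_mult_def
    by (intro borel_measurable_continuous_onI continuous_intros)
  have rot1 [measurable]: "(\<lambda>x. cis t *s x) \<in> borel_measurable (borel :: (complex ^ 'n) measure)" for t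
    unfolding vector_scalar_mult_def by (intro borel_measurable_continuous_onI continuous_intros)
  have M: "finite_measure ?M"
    by (rule finite_measureI) (simp add: emeasure_restrict_space space_restrict_space)
  interpret M: finite_measure ?M by (rule M)
  interpret P: pair_sigma_finite lborel ?M by unfold_locales
  have Wrot [measurable]: "(\<lambda>p. W (cis (snd p) *s fst p)) \<in> borel_measurable (lborel \<Otimes>\<^sub>M ?M)"
  proof -
    have A: "(\<lambda>p. W (cis (fst p) *s snd p)) \<in> borel_measurable (borel \<Otimes>\<^sub>M (borel :: (complex ^ 'n) measure))"
      using measurable_compose[OF rot W] by simp
    have B: "(\<lambda>p. (snd p, fst p)) \<in> lborel \<Otimes>\<^sub>M ?M \<rightarrow>\<^sub>M borel \<Otimes>\<^sub>M (borel :: (complex ^ 'n) measure)"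
    proof (rule measurable_Pair)
      have "(\<lambda>x. x) \<in> ?M \<rightarrow>\<^sub>M borel" by (intro measurable_restrict_space1) simp
      then show "(\<lambda>p. snd p) \<in> lborel \<Otimes>\<^sub>M ?M \<rightarrow>\<^sub>M (borel :: real measure)"
        by (rule measurable_compose[OF measurable_snd])
    qed simp
    show ?thesis using measurable_compose[OF B A] by (simp only: fst_conv snd_conv)
  qed
  have rotint: "integral\<^sup>L lborel W = (\<integral>x. W (cis t *s x) \<partial>lborel)" for t
    by (subst lborel_rotate[of t]) (simp add: integral_distr)
  have rotnn: "(\<integral>\<^sup>+x. ennreal (norm (W x)) \<partial>lborel) = (\<integral>\<^sup>+x. ennreal (norm (W (cis t *s x))) \<partial>lborel)" for t
    by (subst lborel_rotate[of t]) (simp add: nn_integral_distr)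
  \<comment> \<open>By rotation invariance the inner integral of the modulus does not depend on
    \<open>t\<close>, so the double integral is a finite number times the length of the
    interval.\<close>
  have intp: "integrable (lborel \<Otimes>\<^sub>M ?M) (\<lambda>p. W (cis (snd p) *s fst p))"
  proof (rule integrableI_bounded)
    have "(\<integral>\<^sup>+p. ennreal (norm (W (cis (snd p) *s fst p))) \<partial>(lborel \<Otimes>\<^sub>M ?M))
      = (\<integral>\<^sup>+t. \<integral>\<^sup>+x. ennreal (norm (W (cis t *s x))) \<partial>lborel \<partial>?M)"
      by (subst P.nn_integral_snd[symmetric]) simp_all
    also have "\<dots> = (\<integral>\<^sup>+x. ennreal (norm (W x)) \<partial>lborel) * emeasure ?M (space ?M)"
      by (simp flip: rotnn)
    also have "\<dots> < \<infinity>"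
      using intW by (auto simp: integrable_iff_bounded ennreal_mult_less_top less_top[symmetric]
          ennreal_mult_eq_top_iff emeasure_restrict_space space_restrict_space)
    finally show "(\<integral>\<^sup>+p. ennreal (norm (W (cis (snd p) *s fst p))) \<partial>(lborel \<Otimes>\<^sub>M ?M)) < \<infinity>" .
  qed simp
  have inner: "(\<integral>t. W (cis t *s x) \<partial>?M) = (indicator (ball 0 1) x * \<phi> (norm x)) *\<^sub>R (2 * pi * V 0)" for x
  proof (cases "norm x < 1")
    case True
    have op: "open {c. cmod c * norm x < 1}"
      by (intro open_Collect_less continuous_intros)
    have sub: "cball 0 1 \<subseteq> {c. cmod c * norm x < 1}"
      using True mult_right_mono[of "cmod _" 1 "norm x"] by fastforce
    have "(\<integral>t. W (cis t *s x) \<partial>?M) = \<phi> (norm x) *\<^sub>R (\<integral>t. V (cis t *s x) \<partial>?M)"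
      using True by (simp add: W_def norm_cis_scale)
    also have "(\<integral>t. V (cis t *s x) \<partial>?M) = 2 * pi * V (0 *s x)"
      by (rule circle_mean_value(2)[OF op sub hol[OF True]])
    finally show ?thesis using True by simp
  qed (simp add: W_def norm_cis_scale)
  have "of_real (2 * pi) * integral\<^sup>L lborel W = (\<integral>t. (\<integral>x. W (cis t *s x) \<partial>lborel) \<partial>?M)"
    by (simp add: measure_restrict_space space_restrict_space scaleR_conv_of_real flip: rotint)
  also have "\<dots> = (\<integral>x. (\<integral>t. W (cis t *s x) \<partial>?M) \<partial>lborel)"
    by (rule P.Fubini_integral) (use intp in \<open>simp add: split_beta'\<close>)
  also have "\<dots> = (\<integral>x. (indicator (ball 0 1) (x :: complex ^ 'n) * \<phi> (norm x)) *\<^sub>R (2 * pi * V 0) \<partial>lborel)"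
    by (simp only: inner)
  also have "\<dots> = of_real (\<integral>x. indicator (ball 0 1) (x :: complex ^ 'n) * \<phi> (norm x) \<partial>lborel) * (2 * pi * V 0)"
    using int' by (subst integral_scaleR_left) (simp_all add: scaleR_conv_of_real)
  finally show ?thesis
    by (simp add: W_def[abs_def])
qed

section \<open>The reproducing formula\<close>

text \<open>Deliberately weaker than \<open>holomorphic_Cn_on\<close>. The mean value argument uses
  holomorphy only along curves, and this property passes to the last partial derivative by locally
  uniform limits in one variable, without a second Frechet derivative.\<close>

definition holo_along_curves :: "('n::{finite,linorder} cspace \<Rightarrow> complex) \<Rightarrow> bool" where
  "holo_along_curves u \<longleftrightarrow> (\<forall>\<gamma> S. open S \<longrightarrow> (\<forall>j. (\<lambda>c. \<gamma> c $ j) holomorphic_on S) \<longrightarrow>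
     \<gamma> ` S \<subseteq> siegel \<longrightarrow> (\<lambda>c. u (\<gamma> c)) holomorphic_on S)"

text \<open>The power of \<open>rr\<close> with exponent \<open>- p\<close>. The principal branch is
  harmless: \<open>rr\<close> has positive real part on the domain, where \<open>Ln\<close> is
  holomorphic and commutes with conjugation.\<close>

definition ker :: "real \<Rightarrow> 'n::{finite,linorder} cspace \<Rightarrow> 'n cspace \<Rightarrow> complex" where
  "ker p z w = exp (- of_real p * Ln (rr z w))"

lemma rr_nonzero: "z \<in> siegel \<Longrightarrow> w \<in> siegel \<Longrightarrow> rr z w \<noteq> 0"
  using Re_rr_pos(1) by fastforce

lemma norm_ker: "z \<in> siegel \<Longrightarrow> w \<in> siegel \<Longrightarrow> cmod (ker p z w) = cmod (rr z w) powr (- p)"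
  by (simp add: ker_def powr_def rr_nonzero)

lemma rr_not_nonpos: "z \<in> siegel \<Longrightarrow> w \<in> siegel \<Longrightarrow> rr z w \<notin> \<real>\<^sub>\<le>\<^sub>0"
  using Re_rr_pos(1) by (fastforce simp: complex_nonpos_Reals_iff)

lemma ker_cnj: "z \<in> siegel \<Longrightarrow> w \<in> siegel \<Longrightarrow> ker p w z = cnj (ker p z w)"
  unfolding ker_def rr_cnj[of w z] using rr_not_nonpos[of z w] cnj_Ln[of "rr z w"] by (simp add: exp_cnj)

lemma continuous_on_rr: "continuous_on S (rr z)" "continuous_on S (\<lambda>z. rr z w)"
  unfolding rr_def[abs_def] by (intro continuous_intros)+

lemma continuous_on_ker:
  assumes "z \<in> siegel"
  shows "continuous_on siegel (ker p z)" "continuous_on siegel (\<lambda>w. ker p w z)"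
  unfolding ker_def using assms rr_not_nonpos
  by (auto intro!: continuous_intros continuous_on_rr)

lemma cayley_zero: "cayley 0 = base_pt"
  by (auto simp: cayley_def cayley1_def base_pt_def vec_eq_iff axis_def)

lemma siegel_param_in_siegel:
  "z \<in> siegel \<Longrightarrow> norm x < 1 \<Longrightarrow> siegel_param z x \<in> siegel"
  by (simp add: siegel_param_def siegel_map_in_siegel cayley_in_siegel last_coord_ne_1)

lemma holomorphic_siegel_param:
  assumes "norm x < 1"
  shows "(\<lambda>c. siegel_param z (c *s x) $ j) holomorphic_on {c. cmod c * norm x < 1}"
proof -
  have ne: "c * x $ last_ix \<noteq> 1" if "cmod c * norm x < 1" for c
    using last_coord_ne_1(2)[of "c *s x"] that by (simp add: norm_vec_def L2_set_def norm_mult power_mult_distrib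
        sum_distrib_left[symmetric] real_sqrt_mult)
  have 1: "(\<lambda>c. cayley (c *s x) $ k) holomorphic_on {c. cmod c * norm x < 1}" for k
    using ne by (cases "k = last_ix") (auto simp: cayley_def cayley1_def intro!: holomorphic_intros)
  show ?thesis
    unfolding siegel_param_def siegel_map_def
    by (cases "j = last_ix") (auto intro!: holomorphic_intros 1)
qed

lemma norm_scale_vec: "norm (c *s x) = cmod c * norm x" for x :: "complex ^ 'n"
  by (simp add: norm_vec_def L2_set_def norm_mult power_mult_distrib
        sum_distrib_left[symmetric] real_sqrt_mult)

lemma continuous_on_siegel_param: "continuous_on (ball 0 1) (siegel_param z)"
proof -
  have "continuous_on (ball 0 1) (\<lambda>x :: 'a cspace. cayley x $ j)" for j
    by (cases "j = last_ix") (auto simp: cayley_def cayley1_def dest: last_coord_ne_1(2) intro!: continuous_intros)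
  then have "continuous_on (ball 0 1) (\<lambda>x :: 'a cspace. cayley x)"
    by (subst vec_lambda_eta[symmetric]) (intro continuous_on_vec_lambda)
  from continuous_on_compose2[OF continuous_on_siegel_map this, of UNIV]
  show ?thesis by (simp add: siegel_param_def[abs_def])
qed

text \<open>The reason for centring at \<open>z\<close>. With
  \<open>L = Ln (1 - x $ last_ix)\<close>, Jacobian and weight contribute
  \<open>exp (- 2 * p * Re L)\<close>, and the kernel, antiholomorphic in its second argument,
  contributes \<open>exp (p * cnj L)\<close>. All powers of \<open>rho z\<close> cancel, and besides
  the radial weight a function holomorphic in \<open>x\<close> remains.\<close>

lemma jac_ker_siegel_param:
  fixes x :: "'n::{finite,linorder} cspace" and \<alpha> :: real
  assumes z: "z \<in> siegel" and x: "norm x < 1"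
  defines "p \<equiv> real CARD('n) + 1 + \<alpha>"
  shows "of_real (jac z x * rho (siegel_param z x) powr \<alpha>) * ker p z (siegel_param z x)
    = of_real (4 * (1 - (norm x)\<^sup>2) powr \<alpha>) * exp (- of_real p * Ln (1 - x $ last_ix))"
proof -
  define r where "r = rho z"
  have r: "r > 0" using z by (simp add: r_def siegel_def)
  define c where "c = 1 - x $ last_ix"
  have Rec: "Re c > 0"
    using last_coord_ne_1(1)[OF x] complex_Re_le_cmod[of "x $ last_ix"] by (simp add: c_def)
  then have c0: "c \<noteq> 0" and cn: "c \<notin> \<real>\<^sub>\<le>\<^sub>0" by (auto simp: complex_nonpos_Reals_iff)
  have cn': "cnj c \<notin> \<real>\<^sub>\<le>\<^sub>0" using Rec by (auto simp: complex_nonpos_Reals_iff)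
  define L where "L = Ln c"
  have ac: "cmod c = exp (Re L)" using c0 by (simp add: L_def)
  have N: "0 < 1 - (norm x)\<^sup>2" using x by (simp add: abs_square_less_1)
  have rho: "rho (siegel_param z x) = r * (1 - (norm x)\<^sup>2) / (cmod c)\<^sup>2"
    by (simp add: siegel_param_def rho_siegel_map[OF z] rho_cayley r_def c_def)
  have "rr z (siegel_param z x) = of_real r * inverse (cnj c)"
    using rr_siegel_map[OF z, of base_pt "cayley x"] siegel_map_base[OF z] rr_base_cayley[OF x]
    by (simp add: siegel_param_def r_def c_def divide_inverse)
  then have "Ln (rr z (siegel_param z x)) = of_real (ln r) - cnj L"
    using r c0 cn cn' by (simp add: Ln_times_of_real Ln_of_real Ln_inverse L_def cnj_Ln)
  then have ker: "ker p z (siegel_param z x) = of_real (exp (- p * ln r)) * exp (of_real p * cnj L)"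
    unfolding ker_def by (simp only:) (simp add: exp_of_real[symmetric] exp_add[symmetric] algebra_simps)
  have "rho (siegel_param z x) powr \<alpha> = (1 - (norm x)\<^sup>2) powr \<alpha> * exp (\<alpha> * (ln r - 2 * Re L))"
  proof -
    have "(r * s / (exp t)\<^sup>2) powr \<alpha> = s powr \<alpha> * exp (\<alpha> * (ln r - 2 * t))" if "s > 0" for s t :: real
      using r that by (simp add: powr_def ln_mult ln_div ln_realpow exp_add[symmetric] algebra_simps)
    from this[OF N] show ?thesis unfolding rho ac .
  qed
  moreover have "jac z x = 4 * exp ((real CARD('n) + 1) * (ln r - 2 * Re L))"
  proof -
    have "r ^ (CARD('n) + 1) = exp ((real CARD('n) + 1) * ln r)"
      using exp_of_nat_mult[of "CARD('n) + 1" "ln r"] r by (simp add: algebra_simps)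
    moreover have "cmod c ^ (2 * (CARD('n) + 1)) = exp ((real CARD('n) + 1) * (2 * Re L))"
      unfolding ac exp_of_nat_mult[symmetric] by (simp add: algebra_simps)
    ultimately show ?thesis
      unfolding jac_def c_def[symmetric] r_def[symmetric]
      by (simp only: right_diff_distrib exp_diff) simp
  qed
  ultimately have "jac z x * rho (siegel_param z x) powr \<alpha>
     = 4 * (1 - (norm x)\<^sup>2) powr \<alpha> * exp (p * (ln r - 2 * Re L))"
    by (simp add: p_def exp_add[symmetric] algebra_simps)
  then have "of_real (jac z x * rho (siegel_param z x) powr \<alpha>) * ker p z (siegel_param z x)
    = of_real (4 * (1 - (norm x)\<^sup>2) powr \<alpha>) * (of_real (exp (p * (ln r - 2 * Re L)) * exp (- p * ln r)) * exp (of_real p * cnj L))"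
    unfolding ker by simp
  also have "exp (p * (ln r - 2 * Re L)) * exp (- p * ln r) = exp (- p * (2 * Re L))"
    by (simp add: exp_add[symmetric] algebra_simps)
  also have "of_real (exp (- p * (2 * Re L))) * exp (of_real p * cnj L) = exp (- of_real p * (of_real (2 * Re L) - cnj L))"
    by (simp add: exp_of_real[symmetric] exp_add[symmetric] algebra_simps)
  \<comment> \<open>Here the antiholomorphic factor disappears.\<close>
  also have "of_real (2 * Re L) - cnj L = L"
    by (simp add: complex_eq_iff)
  finally show ?thesis by (simp add: L_def c_def)
qed

definition ballc :: "'n::finite itself \<Rightarrow> real \<Rightarrow> real" where
  "ballc _ \<alpha> = (\<integral>x. indicator (ball 0 1) (x :: complex ^ 'n) * (4 * (1 - (norm x)\<^sup>2) powr \<alpha>) \<partial>lborel)"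

text \<open>For nonnegative \<alpha> the weight is bounded by 4. The case used is
  \<open>lam + 1\<close>, which is positive since \<open>lam > - 1\<close>.\<close>

lemma integrable_ball_weight:
  assumes "\<alpha> \<ge> 0"
  shows "integrable lborel (\<lambda>x. indicator (ball 0 1) (x :: complex ^ 'n) * (4 * (1 - (norm x)\<^sup>2) powr \<alpha>))"
proof (rule integrableI_bounded_set[where A = "ball 0 1" and B = 4])
  have [measurable]: "ball (0 :: complex ^ 'n) 1 \<in> sets borel" by simp
  show "(\<lambda>x. indicator (ball 0 1) (x :: complex ^ 'n) * (4 * (1 - (norm x)\<^sup>2) powr \<alpha>)) \<in> borel_measurable lborel"
    by measurable
  show "emeasure lborel (ball (0 :: complex ^ 'n) 1) < \<infinity>"
    by (rule emeasure_bounded_finite) simp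
  have "(1 - (norm x)\<^sup>2) powr \<alpha> \<le> 1" if "norm x < 1" for x :: "complex ^ 'n"
    using that assms by (intro powr_le1) (auto simp: abs_square_le_1)
  then show "AE x\<in>ball 0 1 in lborel. norm (indicator (ball 0 1) (x :: complex ^ 'n) * (4 * (1 - (norm x)\<^sup>2) powr \<alpha>)) \<le> 4"
    by (auto intro!: AE_I2)
qed auto

lemma ballc_pos:
  assumes "\<alpha> \<ge> 0"
  shows "ballc TYPE('n::finite) \<alpha> > 0"
proof -
  let ?f = "\<lambda>x :: complex ^ 'n. indicator (ball 0 1) x * (4 * (1 - (norm x)\<^sup>2) powr \<alpha>)"
  have nn: "0 \<le> ?f x" for x by simp
  have "ballc TYPE('n) \<alpha> \<noteq> 0"
  proof
    assume "ballc TYPE('n) \<alpha> = 0"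
    then have "AE x in lborel. ?f x = 0"
      unfolding ballc_def using integral_nonneg_eq_0_iff_AE[OF integrable_ball_weight[OF assms, where 'n = 'n]] nn by simp
    then have "AE x in lborel. x \<notin> ball (0 :: complex ^ 'n) 1"
    proof eventually_elim
      case (elim x)
      have "?f x \<noteq> 0" if "x \<in> ball 0 1"
        using that by (auto simp: abs_square_eq_1 power2_eq_1_iff)
      then show ?case using elim by blast
    qed
    then have "emeasure lborel (ball (0 :: complex ^ 'n) 1) = 0"
      by (subst (asm) AE_iff_measurable[of "ball 0 1"]) auto
    moreover have "ball (0 :: complex ^ 'n) 1 \<notin> null_sets lborel"
      using open_not_negligible[of "ball (0 :: complex ^ 'n) 1"] by (simp add: negligible_iff_null_sets null_sets_completion_iff)
    ultimately show False by (simp add: null_sets_def)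
  qed
  moreover have "ballc TYPE('n) \<alpha> \<ge> 0"
    unfolding ballc_def using nn by (intro integral_nonneg_AE) auto
  ultimately show ?thesis by simp
qed

text \<open>In ball coordinates centred at \<open>z\<close> the integrand is a radial weight times
  \<open>V\<close>, which is holomorphic on every complex line through \<open>0\<close> and takes
  the value \<open>u z\<close> there, as the logarithm of 1 vanishes. Integrability is a hypothesis
  because the growth of \<open>u\<close> is unrestricted.\<close>

lemma reproducing:
  fixes u :: "'n::{finite,linorder} cspace \<Rightarrow> complex" and \<alpha> :: real
  assumes \<alpha>: "\<alpha> \<ge> 0" and z: "z \<in> siegel"
    and u: "continuous_on siegel u" "holo_along_curves u"
  defines "p \<equiv> real CARD('n) + 1 + \<alpha>"
  assumes int: "integrable lborel (\<lambda>w. indicator siegel w *\<^sub>R (u w * of_real (rho w powr \<alpha>) * ker p z w))"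
  shows "(\<integral>w. indicator siegel w *\<^sub>R (u w * of_real (rho w powr \<alpha>) * ker p z w) \<partial>lborel)
    = of_real (ballc TYPE('n) \<alpha>) * u z"
proof -
  define G where "G w = indicator siegel w *\<^sub>R (u w * of_real (rho w powr \<alpha>) * ker p z w)" for w
  have G [measurable]: "G \<in> borel_measurable borel"
    unfolding G_def[abs_def]
  proof (rule borel_measurable_continuous_on_indicator)
    show "continuous_on siegel (\<lambda>w. u w * of_real (rho w powr \<alpha>) * ker p z w)"
      using continuous_on_ker(1)[OF z] u(1) by (intro continuous_intros) (auto simp: siegel_def)
  qed simp
  have iG: "indicator siegel w *\<^sub>R G w = G w" for w by (cases "w \<in> siegel") (auto simp: G_def)
  define V where "V x = u (siegel_param z x) * exp (- of_real p * Ln (1 - x $ last_ix))" for x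
  define \<phi> where "\<phi> t = 4 * (1 - t\<^sup>2) powr \<alpha>" for t :: real
  have Re: "0 < Re (1 - x $ last_ix)" if "norm x < 1" for x :: "'n cspace"
    using last_coord_ne_1(1)[OF that] complex_Re_le_cmod[of "x $ last_ix"] by simp
  have nonpos: "1 - x $ last_ix \<notin> \<real>\<^sub>\<le>\<^sub>0" if "norm x < 1" for x :: "'n cspace"
    using Re[OF that] by (auto simp: complex_nonpos_Reals_iff)
  have eq: "(jac z x * indicator (ball 0 1) x) *\<^sub>R G (siegel_param z x) = (indicator (ball 0 1) x * \<phi> (norm x)) *\<^sub>R V x" for x
  proof (cases "norm x < 1")
    case True
    have "jac z x *\<^sub>R G (siegel_param z x) = u (siegel_param z x) * (of_real (jac z x * rho (siegel_param z x) powr \<alpha>) * ker p z (siegel_param z x))"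
      using siegel_param_in_siegel[OF z True] by (simp add: G_def scaleR_conv_of_real)
    also have "\<dots> = \<phi> (norm x) *\<^sub>R V x"
      unfolding p_def jac_ker_siegel_param[OF z True] by (simp add: V_def \<phi>_def scaleR_conv_of_real p_def)
    finally show ?thesis using True by simp
  qed simp
  have "integrable lborel G" using int by (simp add: G_def[abs_def])
  then have intV: "integrable lborel (\<lambda>x. (indicator (ball 0 1) x * \<phi> (norm x)) *\<^sub>R V x)"
    using integral_siegel_param(1)[OF z G] by (simp add: iG eq)
  have cV: "continuous_on (ball 0 1) V"
    unfolding V_def using nonpos
    by (intro continuous_intros continuous_on_compose2[OF u(1) continuous_on_siegel_param])
       (auto simp: siegel_param_in_siegel[OF z])
  have hV: "(\<lambda>c. V (c *s x)) holomorphic_on {c. cmod c * norm x < 1}" if x: "norm x < 1" for x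
  proof -
    have op: "open {c. cmod c * norm x < 1}" by (intro open_Collect_less continuous_intros)
    have "(\<lambda>c. u (siegel_param z (c *s x))) holomorphic_on {c. cmod c * norm x < 1}"
      by (rule u(2)[unfolded holo_along_curves_def, rule_format, OF op])
        (use x in \<open>auto simp: siegel_param_in_siegel[OF z] norm_scale_vec intro: holomorphic_siegel_param\<close>)
    moreover have "(\<lambda>c. exp (- of_real p * Ln (1 - c * x $ last_ix))) holomorphic_on {c. cmod c * norm x < 1}"
      using nonpos[of "_ *s x"] by (intro holomorphic_intros) (auto simp: norm_scale_vec)
    ultimately show ?thesis unfolding V_def by (auto intro!: holomorphic_intros)
  qed
  have "(\<integral>w. G w \<partial>lborel) = (\<integral>x. (indicator (ball 0 1) x * \<phi> (norm x)) *\<^sub>R V x \<partial>lborel)"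
    using integral_siegel_param(2)[OF z G] by (simp add: iG eq)
  also have "\<dots> = of_real (\<integral>x. indicator (ball 0 1) (x :: 'n cspace) * \<phi> (norm x) \<partial>lborel) * V 0"
    by (rule ball_mean_value[OF cV _ hV intV])
       (use integrable_ball_weight[OF \<alpha>, where 'n = 'n] in \<open>auto simp: \<phi>_def[abs_def]\<close>)
  also have "V 0 = u z"
    by (simp add: V_def siegel_param_def cayley_zero siegel_map_base[OF z])
  finally show ?thesis by (simp add: G_def[abs_def] \<phi>_def ballc_def)
qed

section \<open>Holomorphic functions of several variables\<close>

lemma has_derivative_vec_lambda_euclidean:
  fixes f :: "'n::finite \<Rightarrow> 'a::real_normed_vector \<Rightarrow> 'b::euclidean_space"
  assumes "\<And>i. (f i has_derivative f' i) (at a within S)"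
  shows "((\<lambda>x. \<chi> i. f i x) has_derivative (\<lambda>h. \<chi> i. f' i h)) (at a within S)"
  unfolding has_derivative_componentwise_within[of "\<lambda>x. \<chi> i. f i x"]
  by (auto simp: Basis_vec_def inner_axis
      intro!: bounded_linear.has_derivative[OF bounded_linear_inner_left] assms)

lemma norm_axis_eq: "norm (axis i x) = norm x" for x :: "'a::real_normed_vector"
proof -
  have "(norm (axis i x))\<^sup>2 = (\<Sum>j\<in>UNIV. if j = i then (norm x)\<^sup>2 else 0)"
    unfolding norm_vec_power2 by (rule sum.cong) (auto simp: axis_def)
  also have "\<dots> = (norm x)\<^sup>2" by simp
  finally show ?thesis by simp
qed

lemma inverse_Suc_tendsto:
  shows "(\<lambda>k. complex_of_real (inverse (real (Suc k)))) \<longlonglongrightarrow> 0"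
    and "complex_of_real (inverse (real (Suc k))) \<noteq> 0"
  using tendsto_of_real[OF LIMSEQ_inverse_real_of_nat, where 'a = complex]
  by (simp_all only: of_real_0 of_real_eq_0_iff inverse_nonzero_iff_nonzero of_nat_eq_0_iff)

lemma holo_curve_deriv:
  fixes f :: "complex ^ 'n \<Rightarrow> complex"
  assumes D: "(f has_derivative D) (at (\<gamma> c))" "\<And>c h. D (c *s h) = c * D h"
    and \<gamma>: "\<And>j. ((\<lambda>c. \<gamma> c $ j) has_field_derivative \<gamma>' $ j) (at c)"
  shows "((\<lambda>c. f (\<gamma> c)) has_field_derivative D \<gamma>') (at c)"
proof -
  have "((\<lambda>c. \<chi> j. \<gamma> c $ j) has_derivative (\<lambda>h. \<chi> j. \<gamma>' $ j * h)) (at c)"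
    using \<gamma> by (intro has_derivative_vec_lambda_euclidean) (simp add: has_field_derivative_def)
  then have "(\<gamma> has_derivative (\<lambda>h. h *s \<gamma>')) (at c)"
    by (simp add: vector_scalar_mult_def mult.commute)
  from has_derivative_compose[OF this D(1)]
  show ?thesis by (simp add: has_field_derivative_def D(2) mult.commute[of _ "D \<gamma>'"])
qed

lemma holo_siegel_along_curves:
  assumes f: "holomorphic_Cn_on f siegel"
  shows "holo_along_curves f"
  unfolding holo_along_curves_def
proof (intro allI impI)
  fix \<gamma> :: "complex \<Rightarrow> 'a cspace" and S
  assume S: "open S" "\<forall>j. (\<lambda>c. \<gamma> c $ j) holomorphic_on S" "\<gamma> ` S \<subseteq> siegel"
  show "(\<lambda>c. f (\<gamma> c)) holomorphic_on S"
    unfolding holomorphic_on_open[OF S(1)]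
  proof
    fix c assume c: "c \<in> S"
    then obtain D where D: "(f has_derivative D) (at (\<gamma> c))" "\<And>c h. D (c *s h) = c * D h"
      using f S(3) unfolding holomorphic_Cn_on_def by blast
    have "((\<lambda>c. \<gamma> c $ j) has_field_derivative (\<chi> j. deriv (\<lambda>c. \<gamma> c $ j) c) $ j) (at c)" for j
      using holomorphic_derivI[OF S(2)[rule_format] S(1) c] by simp
    from holo_curve_deriv[OF D this]
    show "\<exists>f'. ((\<lambda>c. f (\<gamma> c)) has_field_derivative f') (at c)" by blast
  qed
qed

lemma holo_siegel_continuous: "holomorphic_Cn_on f siegel \<Longrightarrow> continuous_on siegel f"
  unfolding holomorphic_Cn_on_def
  by (auto simp: continuous_on_eq_continuous_at[OF open_siegel] dest: has_derivative_continuous)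

lemma cpartial_conv_derivative:
  assumes D: "(f has_derivative D) (at z)" "\<And>c h. D (c *s h) = c * D h"
  shows "((\<lambda>w. f (\<chi> i. if i = j then w else z $ i)) has_field_derivative D (axis j 1)) (at (z $ j))"
    and "cpartial j f z = D (axis j 1)"
proof -
  have "(\<chi> i. if i = j then z $ j else z $ i) = z" by (auto simp: vec_eq_iff)
  then have D': "(f has_derivative D) (at (\<chi> i. if i = j then z $ j else z $ i))" using D by simp
  have "((\<lambda>w. (\<chi> i. if i = j then w else z $ i) $ k) has_field_derivative axis j 1 $ k) (at (z $ j))" for k
    by (cases "k = j") (auto simp: axis_def intro!: derivative_eq_intros)
  from holo_curve_deriv[where \<gamma> = "\<lambda>w. \<chi> i. if i = j then w else z $ i", OF D' D(2) this]
  show 1: "((\<lambda>w. f (\<chi> i. if i = j then w else z $ i)) has_field_derivative D (axis j 1)) (at (z $ j))" .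
  from DERIV_imp_deriv[OF this] show "cpartial j f z = D (axis j 1)"
    by (simp add: cpartial_def)
qed

lemma line_has_field_derivative:
  fixes f :: "complex ^ 'n \<Rightarrow> complex"
  assumes D: "(f has_derivative D) (at (z + c *s v))" "\<And>c h. D (c *s h) = c * D h"
  shows "((\<lambda>c. f (z + c *s v)) has_field_derivative D v) (at c)"
  by (rule holo_curve_deriv[where \<gamma> = "\<lambda>c. z + c *s v", OF D]) (auto intro!: derivative_eq_intros)

text \<open>First order Taylor formula, the second derivative being estimated by Cauchy on circles
  of radius \<open>d / 4\<close> about points of the half disc:
  \<open>2 * M / (d / 4)\<^sup>2\<close> is \<open>32 * M / d\<^sup>2\<close>.\<close>

lemma difference_quotient_bound:
  fixes \<phi> :: "complex \<Rightarrow> complex"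
  assumes d: "d > 0" and hol: "\<phi> holomorphic_on ball 0 d" and M: "\<And>c. c \<in> ball 0 d \<Longrightarrow> cmod (\<phi> c) \<le> M"
    and t: "cmod t \<le> d / 2"
  shows "cmod (\<phi> t - \<phi> 0 - deriv \<phi> 0 * t) \<le> 32 * M / d\<^sup>2 * (cmod t)\<^sup>2"
proof -
  have der: "((deriv ^^ i) \<phi> has_field_derivative (deriv ^^ Suc i) \<phi> c) (at c within cball 0 (d / 2))"
    if "c \<in> cball 0 (d / 2)" for c i
    using holomorphic_derivI[OF holomorphic_higher_deriv[OF hol open_ball] open_ball, of c i] that d
    by (auto intro: has_field_derivative_at_within)
  have B: "cmod ((deriv ^^ Suc 1) \<phi> c) \<le> fact 2 * M / (d / 4) ^ 2" if "c \<in> cball 0 (d / 2)" for c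
  proof -
    have sub: "cball c (d / 4) \<subseteq> ball 0 d"
    proof
      fix x assume "x \<in> cball c (d / 4)"
      then have "cmod x \<le> cmod c + d / 4"
        using norm_triangle_ineq2[of x c] by (simp add: dist_norm norm_minus_commute)
      then show "x \<in> ball 0 d" using that d by simp
    qed
    have "cmod ((deriv ^^ 2) \<phi> c) \<le> fact 2 * M / (d / 4) ^ 2"
    proof (rule Cauchy_inequality)
      show "\<phi> holomorphic_on ball c (d / 4)"
        using hol sub ball_subset_cball by (blast intro: holomorphic_on_subset)
      show "continuous_on (cball c (d / 4)) \<phi>"
        using holomorphic_on_imp_continuous_on[OF hol] sub by (blast intro: continuous_on_subset)
      show "cmod (\<phi> x) \<le> M" if "cmod (c - x) = d / 4" for x
        using that sub by (intro M) (auto simp: dist_norm subset_eq)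
    qed (use d in auto)
    then show ?thesis by (simp add: numeral_2_eq_2)
  qed
  have "cmod ((deriv ^^ 0) \<phi> t - (\<Sum>i\<le>1. (deriv ^^ i) \<phi> 0 * (t - 0) ^ i / fact i)) \<le> (fact 2 * M / (d / 4) ^ 2) * cmod (t - 0) ^ (Suc 1) / fact 1"
    by (rule complex_Taylor[OF convex_cball der B]) (use t d in auto)
  then show ?thesis by (simp add: power2_eq_square algebra_simps)
qed

text \<open>One bound for \<open>f\<close> on a closed ball serves all points of a smaller ball, so
  the Taylor remainder is uniform. Continuity, and for the last variable holomorphy along curves,
  then pass to partial derivatives.\<close>

lemma difference_quotient_uniform_limit:
  fixes f :: "'n::{finite,linorder} cspace \<Rightarrow> complex"
  assumes f: "holomorphic_Cn_on f siegel" and z: "z \<in> siegel"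
    and \<tau>: "\<tau> \<longlonglongrightarrow> 0" "\<And>k. \<tau> k \<noteq> 0"
  obtains d where "d > 0" "ball z (2 * d) \<subseteq> siegel"
    "uniform_limit (ball z d) (\<lambda>k w. (f (w + axis j (\<tau> k)) - f w) / \<tau> k) (cpartial j f) sequentially"
proof -
  obtain e where e: "e > 0" "cball z e \<subseteq> siegel"
    using z open_siegel open_contains_cball by blast
  have "compact (f ` cball z e)"
    by (intro compact_continuous_image continuous_on_subset[OF holo_siegel_continuous[OF f] e(2)]) auto
  then obtain M where M: "\<And>w. w \<in> cball z e \<Longrightarrow> cmod (f w) \<le> M"
    using compact_imp_bounded bounded_iff by (metis image_eqI)
  define d where "d = e / 2"
  have d: "d > 0" using e by (simp add: d_def)
  have sub: "ball z (2 * d) \<subseteq> siegel"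
    using e(2) by (auto simp: d_def)
  have ax: "axis j c = c *s axis j (1 :: complex)" for c by (simp add: vec_eq_iff axis_def)
  have est: "cmod ((f (w + axis j t) - f w) / t - cpartial j f w) \<le> 32 * M / d\<^sup>2 * cmod t"
    if w: "w \<in> ball z d" and t: "t \<noteq> 0" "cmod t \<le> d / 2" for w t
  proof -
    have inb: "w + c *s axis j 1 \<in> cball z e" if "cmod c < d" for c
    proof -
      have "norm (w + c *s axis j 1 - z) \<le> norm (w - z) + norm (c *s axis j (1 :: complex))"
        by (metis add_diff_eq diff_add_eq norm_triangle_ineq)
      also have "\<dots> \<le> e" using w that by (simp add: dist_norm norm_minus_commute norm_scale_vec norm_axis_eq d_def)
      finally show ?thesis by (simp add: dist_norm norm_minus_commute)
    qed
    have der: "\<exists>D. (f has_derivative D) (at (w + c *s axis j 1)) \<and> (\<forall>c h. D (c *s h) = c * D h)" if "cmod c < d" for c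
      using f inb[OF that] e(2) unfolding holomorphic_Cn_on_def by blast
    define \<phi> where "\<phi> c = f (w + c *s axis j 1)" for c
    have hol: "\<phi> holomorphic_on ball 0 d"
      unfolding holomorphic_on_open[OF open_ball] \<phi>_def
    proof
      fix c :: complex assume "c \<in> ball 0 d"
      then obtain D where "(f has_derivative D) (at (w + c *s axis j 1))" "\<forall>c h. D (c *s h) = c * D h"
        using der[of c] by auto
      then show "\<exists>f'. ((\<lambda>c. f (w + c *s axis j 1)) has_field_derivative f') (at c)"
        using line_has_field_derivative by blast
    qed
    obtain D where D: "(f has_derivative D) (at (w + 0 *s axis j 1))" "\<And>c h. D (c *s h) = c * D h"
      using der[of 0] d by auto
    have "deriv \<phi> 0 = D (axis j 1)"
      unfolding \<phi>_def by (intro DERIV_imp_deriv line_has_field_derivative D)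
    also have "\<dots> = cpartial j f w"
      using cpartial_conv_derivative(2)[of f D w j] D by simp
    finally have dphi: "deriv \<phi> 0 = cpartial j f w" .
    have "cmod (\<phi> t - \<phi> 0 - deriv \<phi> 0 * t) \<le> 32 * M / d\<^sup>2 * (cmod t)\<^sup>2"
      by (rule difference_quotient_bound[OF d hol _ t(2)]) (auto simp: \<phi>_def intro!: M inb)
    moreover have "\<phi> t - \<phi> 0 - deriv \<phi> 0 * t = ((\<phi> t - \<phi> 0) / t - deriv \<phi> 0) * t"
    proof -
      have "a - b * t = (a / t - b) * t" for a b
        using t(1) by (simp add: field_simps)
      then show ?thesis by blast
    qed
    ultimately have "cmod ((\<phi> t - \<phi> 0) / t - deriv \<phi> 0) * cmod t \<le> 32 * M / d\<^sup>2 * cmod t * cmod t"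
      by (simp add: norm_mult power2_eq_square mult.assoc)
    then have "cmod ((\<phi> t - \<phi> 0) / t - deriv \<phi> 0) \<le> 32 * M / d\<^sup>2 * cmod t"
      by (rule mult_right_le_imp_le) (use t in simp)
    then show ?thesis by (simp add: dphi \<phi>_def ax[of t])
  qed
  have "uniform_limit (ball z d) (\<lambda>k w. (f (w + axis j (\<tau> k)) - f w) / \<tau> k) (cpartial j f) sequentially"
    unfolding uniform_limit_iff
  proof (intro allI impI)
    fix r :: real assume r: "r > 0"
    have "(\<lambda>k. 32 * M / d\<^sup>2 * cmod (\<tau> k)) \<longlonglongrightarrow> 32 * M / d\<^sup>2 * cmod 0"
      using \<tau>(1) by (intro tendsto_intros)
    then have 1: "\<forall>\<^sub>F k in sequentially. 32 * M / d\<^sup>2 * cmod (\<tau> k) < r"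
      using r by (intro order_tendstoD(2)) auto
    have "(\<lambda>k. cmod (\<tau> k)) \<longlonglongrightarrow> 0" using \<tau>(1) by (rule tendsto_norm_zero)
    then have 2: "\<forall>\<^sub>F k in sequentially. cmod (\<tau> k) < d / 2"
      using d by (intro order_tendstoD(2)) auto
    from 1 2 show "\<forall>\<^sub>F k in sequentially. \<forall>w\<in>ball z d. dist ((f (w + axis j (\<tau> k)) - f w) / \<tau> k) (cpartial j f w) < r"
    proof eventually_elim
      case (elim k)
      show ?case
      proof
        fix w assume w: "w \<in> ball z d"
        have "cmod ((f (w + axis j (\<tau> k)) - f w) / \<tau> k - cpartial j f w) \<le> 32 * M / d\<^sup>2 * cmod (\<tau> k)"
          by (rule est[OF w \<tau>(2)]) (use elim in simp)
        also have "\<dots> < r" by (rule elim)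
        finally show "dist ((f (w + axis j (\<tau> k)) - f w) / \<tau> k) (cpartial j f w) < r"
          by (simp add: dist_norm)
      qed
    qed
  qed
  then show ?thesis using that d sub by blast
qed

lemma continuous_on_cpartial:
  fixes f :: "'n::{finite,linorder} cspace \<Rightarrow> complex"
  assumes f: "holomorphic_Cn_on f siegel"
  shows "continuous_on siegel (cpartial j f)"
  unfolding continuous_on_eq_continuous_at[OF open_siegel]
proof
  fix z :: "'n cspace" assume z: "z \<in> siegel"
  define \<tau> where "\<tau> k = complex_of_real (inverse (real (Suc k)))" for k
  have \<tau>: "\<tau> \<longlonglongrightarrow> 0" "\<And>k. \<tau> k \<noteq> 0"
    unfolding \<tau>_def by (rule inverse_Suc_tendsto)+
  obtain d where d: "d > 0" "ball z (2 * d) \<subseteq> siegel"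
    "uniform_limit (ball z d) (\<lambda>k w. (f (w + axis j (\<tau> k)) - f w) / \<tau> k) (cpartial j f) sequentially"
    by (rule difference_quotient_uniform_limit[OF f z \<tau>])
  have "(\<lambda>k. cmod (\<tau> k)) \<longlonglongrightarrow> 0" using \<tau>(1) by (rule tendsto_norm_zero)
  then have "\<forall>\<^sub>F k in sequentially. cmod (\<tau> k) < d"
    using d by (intro order_tendstoD(2)) auto
  then have "\<forall>\<^sub>F k in sequentially. continuous_on (ball z d) (\<lambda>w. (f (w + axis j (\<tau> k)) - f w) / \<tau> k)"
  proof eventually_elim
    case (elim k)
    have "w + axis j (\<tau> k) \<in> siegel" if "w \<in> ball z d" for w
    proof -
      have "norm (w + axis j (\<tau> k) - z) \<le> norm (w - z) + norm (axis j (\<tau> k))"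
        by (metis add_diff_eq diff_add_eq norm_triangle_ineq)
      also have "\<dots> < 2 * d" using that elim by (simp add: dist_norm norm_minus_commute norm_axis_eq)
      finally show ?thesis using d(2) by (auto simp: dist_norm norm_minus_commute)
    qed
    moreover have "w \<in> siegel" if "w \<in> ball z d" for w using that d by auto
    ultimately show ?case using \<tau>(2)
      by (intro continuous_intros continuous_on_compose2[OF holo_siegel_continuous[OF f]]) auto
  qed
  then have "continuous_on (ball z d) (cpartial j f)"
    by (intro uniform_limit_theorem[OF _ d(3)]) auto
  then show "isCont (cpartial j f) z"
    using d(1) by (simp add: continuous_on_eq_continuous_at)
qed

lemma siegel_add_axis_last: "z \<in> siegel \<Longrightarrow> 0 \<le> Im c \<Longrightarrow> z + axis last_ix c \<in> siegel"
  and rho_add_axis_last: "rho (z + axis last_ix c) = rho z + Im c"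
proof -
  have "(\<Sum>j\<in>UNIV - {last_ix}. (cmod ((z + axis last_ix c) $ j))\<^sup>2) = (\<Sum>j\<in>UNIV - {last_ix}. (cmod (z $ j))\<^sup>2)"
    by (rule sum.cong) (auto simp: axis_def)
  then show *: "rho (z + axis last_ix c) = rho z + Im c"
    by (simp add: rho_def axis_def)
  show "z \<in> siegel \<Longrightarrow> 0 \<le> Im c \<Longrightarrow> z + axis last_ix c \<in> siegel"
    unfolding siegel_def mem_Collect_eq * by simp
qed

lemma cpartial_last_along_curves:
  fixes f :: "'n::{finite,linorder} cspace \<Rightarrow> complex"
  assumes f: "holomorphic_Cn_on f siegel"
  shows "holo_along_curves (cpartial last_ix f)"
  unfolding holo_along_curves_def
proof (intro allI impI)
  fix \<gamma> :: "complex \<Rightarrow> 'n cspace" and S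
  assume S: "open S" "\<forall>j. (\<lambda>c. \<gamma> c $ j) holomorphic_on S" "\<gamma> ` S \<subseteq> siegel"
  \<comment> \<open>Upward increments: they increase \<open>rho\<close>, so the shifted curve stays
    in the domain for every \<open>k\<close> and on all of \<open>S\<close>.\<close>
  define \<tau> where "\<tau> k = \<i> * complex_of_real (inverse (real (Suc k)))" for k
  have \<tau>: "\<tau> \<longlonglongrightarrow> 0" "\<And>k. \<tau> k \<noteq> 0"
    unfolding \<tau>_def using tendsto_mult_left[OF inverse_Suc_tendsto(1), of \<i>] inverse_Suc_tendsto(2) by simp_all
  have \<gamma>: "continuous_on S \<gamma>"
  proof -
    have "continuous_on S (\<lambda>c. \<chi> j. \<gamma> c $ j)"
      by (intro continuous_on_vec_lambda holomorphic_on_imp_continuous_on) (use S(2) in auto)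
    then show ?thesis by simp
  qed
  show "(\<lambda>c. cpartial last_ix f (\<gamma> c)) holomorphic_on S"
  proof (rule holomorphic_uniform_sequence[OF S(1), where f = "\<lambda>k c. (f (\<gamma> c + axis last_ix (\<tau> k)) - f (\<gamma> c)) / \<tau> k"])
    fix k
    have "(\<lambda>c. f (\<gamma> c + axis last_ix (\<tau> k))) holomorphic_on S"
    proof (rule holo_siegel_along_curves[OF f, unfolded holo_along_curves_def, rule_format, OF S(1)])
      show "(\<lambda>c. (\<gamma> c + axis last_ix (\<tau> k)) $ j) holomorphic_on S" for j
        using S(2) by (auto intro!: holomorphic_intros)
      show "(\<lambda>c. \<gamma> c + axis last_ix (\<tau> k)) ` S \<subseteq> siegel"
        using S(3) by (auto intro!: siegel_add_axis_last simp: \<tau>_def)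
    qed
    moreover have "(\<lambda>c. f (\<gamma> c)) holomorphic_on S"
      by (rule holo_siegel_along_curves[OF f, unfolded holo_along_curves_def, rule_format, OF S(1)]) (use S in auto)
    ultimately show "(\<lambda>c. (f (\<gamma> c + axis last_ix (\<tau> k)) - f (\<gamma> c)) / \<tau> k) holomorphic_on S"
      using \<tau>(2) by (intro holomorphic_intros) auto
  next
    fix x assume x: "x \<in> S"
    then have "\<gamma> x \<in> siegel" using S(3) by auto
    then obtain d where d: "d > 0" "ball (\<gamma> x) (2 * d) \<subseteq> siegel"
      "uniform_limit (ball (\<gamma> x) d) (\<lambda>k w. (f (w + axis last_ix (\<tau> k)) - f w) / \<tau> k) (cpartial last_ix f) sequentially"
      by (rule difference_quotient_uniform_limit[OF f _ \<tau>])
    have "open (S \<inter> \<gamma> -` ball (\<gamma> x) d)"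
      using continuous_open_preimage[OF \<gamma> S(1) open_ball] by simp
    moreover have "x \<in> S \<inter> \<gamma> -` ball (\<gamma> x) d" using x d by simp
    ultimately obtain e where e: "e > 0" "cball x e \<subseteq> S \<inter> \<gamma> -` ball (\<gamma> x) d"
      using open_contains_cball by blast
    have "uniform_limit (cball x e) (\<lambda>k c. (f (\<gamma> c + axis last_ix (\<tau> k)) - f (\<gamma> c)) / \<tau> k) (\<lambda>c. cpartial last_ix f (\<gamma> c)) sequentially"
      unfolding uniform_limit_iff
    proof (intro allI impI)
      fix r :: real assume "r > 0"
      from d(3)[unfolded uniform_limit_iff, rule_format, OF this]
      show "\<forall>\<^sub>F k in sequentially. \<forall>c\<in>cball x e. dist ((f (\<gamma> c + axis last_ix (\<tau> k)) - f (\<gamma> c)) / \<tau> k) (cpartial last_ix f (\<gamma> c)) < r"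
        by eventually_elim (use e(2) in blast)
    qed
    then show "\<exists>d>0. cball x d \<subseteq> S \<and> uniform_limit (cball x d) (\<lambda>k c. (f (\<gamma> c + axis last_ix (\<tau> k)) - f (\<gamma> c)) / \<tau> k) (\<lambda>c. cpartial last_ix f (\<gamma> c)) sequentially"
      using e by blast
  qed
qed

section \<open>The Bloch space\<close>

text \<open>The direction in which the derivative of a holomorphic function at \<open>z\<close> is
  \<open>Lop j\<close>. For \<open>j\<close> other than the last index it is complex tangential to
  the level set of \<open>rho\<close> through \<open>z\<close>.\<close>

definition ldir :: "'n::{finite,linorder} \<Rightarrow> 'n cspace \<Rightarrow> 'n cspace" where
  "ldir j z = (if j = last_ix then axis last_ix 1 else axis j 1 + (2 * \<i> * cnj (z $ j)) *s axis last_ix 1)"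

lemma Lop_conv_derivative:
  assumes D: "(f has_derivative D) (at z)" "\<And>c h. D (c *s h) = c * D h"
  shows "Lop j f z = D (ldir j z)"
proof -
  have lin: "linear D" using D(1) by (rule has_derivative_linear)
  show ?thesis
    by (simp add: Lop_def ldir_def cpartial_conv_derivative(2)[OF D] linear_add[OF lin] D(2))
qed

lemma holomorphic_Cn_onE:
  assumes "holomorphic_Cn_on f S" "z \<in> S"
  obtains D where "(f has_derivative D) (at z)" "\<And>c h. D (c *s h) = c * D h"
  using assms unfolding holomorphic_Cn_on_def by blast

lemma holomorphic_Cn_on_combine:
  fixes f g :: "complex ^ 'n \<Rightarrow> complex"
  assumes f: "holomorphic_Cn_on f S" and g: "holomorphic_Cn_on g S"
  shows "holomorphic_Cn_on (\<lambda>z. a * f z + b * g z) S"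
  unfolding holomorphic_Cn_on_def
proof
  fix z assume z: "z \<in> S"
  obtain D where D: "(f has_derivative D) (at z)" "\<And>c h. D (c *s h) = c * D h"
    using holomorphic_Cn_onE[OF f z] by blast
  obtain E where E: "(g has_derivative E) (at z)" "\<And>c h. E (c *s h) = c * E h"
    using holomorphic_Cn_onE[OF g z] by blast
  have "((\<lambda>z. a * f z + b * g z) has_derivative (\<lambda>h. a * D h + b * E h)) (at z)"
    by (intro has_derivative_add has_derivative_mult_right D E)
  then show "\<exists>D. ((\<lambda>z. a * f z + b * g z) has_derivative D) (at z) \<and> (\<forall>c h. D (c *s h) = c * D h)"
    by (intro exI conjI) (auto simp: D(2) E(2) algebra_simps)
qed

lemma Lop_combine:
  assumes f: "holomorphic_Cn_on f siegel" and g: "holomorphic_Cn_on g siegel" and z: "z \<in> siegel"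
  shows "Lop j (\<lambda>z. a * f z + b * g z) z = a * Lop j f z + b * Lop j g z"
proof -
  obtain D where D: "(f has_derivative D) (at z)" "\<And>c h. D (c *s h) = c * D h"
    using holomorphic_Cn_onE[OF f z] by blast
  obtain E where E: "(g has_derivative E) (at z)" "\<And>c h. E (c *s h) = c * E h"
    using holomorphic_Cn_onE[OF g z] by blast
  have "((\<lambda>z. a * f z + b * g z) has_derivative (\<lambda>h. a * D h + b * E h)) (at z)"
    by (intro has_derivative_add has_derivative_mult_right D E)
  from Lop_conv_derivative[OF this] D(2) E(2) show ?thesis
    by (simp add: Lop_conv_derivative[OF D] Lop_conv_derivative[OF E] algebra_simps)
qed

lemma Lop_last: "Lop last_ix f = cpartial last_ix f"
  by (auto simp: Lop_def)

lemma continuous_on_Lop: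
  assumes "holomorphic_Cn_on f siegel"
  shows "continuous_on siegel (Lop j f)"
  using continuous_on_cpartial[OF assms] unfolding Lop_def[abs_def]
  by (cases "j = last_ix") (auto intro!: continuous_intros)

lemma continuous_on_inv_grad:
  "holomorphic_Cn_on f siegel \<Longrightarrow> continuous_on siegel (inv_grad f)"
  unfolding inv_grad_def[abs_def] by (intro continuous_intros continuous_on_Lop)

text \<open>As a weighted Euclidean norm of the derivatives, the gradient inherits the triangle
  inequality and dominates its single components.\<close>

lemma inv_grad_L2:
  assumes "z \<in> siegel"
  shows "inv_grad f z = L2_set (\<lambda>j. (if j = last_ix then sqrt 8 * rho z else sqrt (2 * rho z)) * cmod (Lop j f z)) UNIV"
proof -
  have r: "rho z > 0" using assms by (simp add: siegel_def)
  have "(\<Sum>j\<in>UNIV. ((if j = last_ix then sqrt 8 * rho z else sqrt (2 * rho z)) * cmod (Lop j f z))\<^sup>2)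
    = (sqrt 8 * rho z * cmod (Lop last_ix f z))\<^sup>2
      + (\<Sum>j\<in>UNIV - {last_ix}. ((if j = last_ix then sqrt 8 * rho z else sqrt (2 * rho z)) * cmod (Lop j f z))\<^sup>2)"
    by (subst sum.remove[of _ last_ix]) auto
  also have "(\<Sum>j\<in>UNIV - {last_ix}. ((if j = last_ix then sqrt 8 * rho z else sqrt (2 * rho z)) * cmod (Lop j f z))\<^sup>2)
    = (\<Sum>j\<in>UNIV - {last_ix}. 2 * rho z * (cmod (Lop j f z))\<^sup>2)"
    using r by (intro sum.cong) (auto simp: power_mult_distrib)
  finally show ?thesis
    by (simp add: inv_grad_def L2_set_def sum_distrib_left power_mult_distrib)
qed

lemma inv_grad_nonneg: "z \<in> siegel \<Longrightarrow> 0 \<le> inv_grad f z"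
  by (simp add: inv_grad_L2)

lemma rho_Lop_last_le: "z \<in> siegel \<Longrightarrow> rho z * cmod (cpartial last_ix f z) \<le> inv_grad f z"
proof -
  assume z: "z \<in> siegel"
  then have r: "rho z > 0" by (simp add: siegel_def)
  have "rho z * cmod (cpartial last_ix f z) \<le> sqrt 8 * rho z * cmod (Lop last_ix f z)"
    using r by (simp add: Lop_last mult_right_mono)
  also have "\<dots> \<le> inv_grad f z"
    unfolding inv_grad_L2[OF z]
    using member_le_L2_set[of UNIV last_ix "\<lambda>j. (if j = last_ix then sqrt 8 * rho z else sqrt (2 * rho z)) * cmod (Lop j f z)"] by simp
  finally show ?thesis .
qed

lemma sqrt_rho_Lop_le:
  assumes z: "z \<in> siegel" and j: "j \<noteq> last_ix"
  shows "sqrt (rho z) * cmod (Lop j f z) \<le> inv_grad f z"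
proof -
  have r: "rho z > 0" using z by (simp add: siegel_def)
  have "sqrt (rho z) * cmod (Lop j f z) \<le> sqrt (2 * rho z) * cmod (Lop j f z)"
    using r by (intro mult_right_mono) auto
  also have "\<dots> \<le> inv_grad f z"
    unfolding inv_grad_L2[OF z]
    using member_le_L2_set[of UNIV j "\<lambda>j. (if j = last_ix then sqrt 8 * rho z else sqrt (2 * rho z)) * cmod (Lop j f z)"] j by simp
  finally show ?thesis .
qed

lemma inv_grad_combine_le:
  assumes f: "holomorphic_Cn_on f siegel" and g: "holomorphic_Cn_on g siegel" and z: "z \<in> siegel"
  shows "inv_grad (\<lambda>z. a * f z + b * g z) z \<le> cmod a * inv_grad f z + cmod b * inv_grad g z"
proof -
  let ?c = "\<lambda>j. if j = last_ix then sqrt 8 * rho z else sqrt (2 * rho z)"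
  have r: "rho z > 0" using z by (simp add: siegel_def)
  then have c: "0 \<le> ?c j" for j by simp
  have "inv_grad (\<lambda>z. a * f z + b * g z) z
      \<le> L2_set (\<lambda>j. cmod a * (?c j * cmod (Lop j f z)) + cmod b * (?c j * cmod (Lop j g z))) UNIV"
    unfolding inv_grad_L2[OF z] Lop_combine[OF f g z]
  proof (rule L2_set_mono)
    fix j
    have "cmod (a * Lop j f z + b * Lop j g z) \<le> cmod a * cmod (Lop j f z) + cmod b * cmod (Lop j g z)"
      by (metis norm_mult norm_triangle_ineq)
    from mult_left_mono[OF this c[of j]]
    show "?c j * cmod (a * Lop j f z + b * Lop j g z) \<le> cmod a * (?c j * cmod (Lop j f z)) + cmod b * (?c j * cmod (Lop j g z))"
      by (simp add: algebra_simps)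
  qed (use c in \<open>blast intro: mult_nonneg_nonneg norm_ge_zero\<close>)
  also have "\<dots> \<le> L2_set (\<lambda>j. cmod a * (?c j * cmod (Lop j f z))) UNIV + L2_set (\<lambda>j. cmod b * (?c j * cmod (Lop j g z))) UNIV"
    by (rule L2_set_triangle_ineq)
  also have "\<dots> = cmod a * inv_grad f z + cmod b * inv_grad g z"
    unfolding inv_grad_L2[OF z] by (simp add: L2_set_right_distrib)
  finally show ?thesis .
qed

lemma holo_siegel_combine:
  "f \<in> holo_siegel \<Longrightarrow> g \<in> holo_siegel \<Longrightarrow> (\<lambda>z. a * f z + b * g z) \<in> holo_siegel"
  by (auto simp: holo_siegel_def intro: holomorphic_Cn_on_combine)

lemma base_pt_in_siegel: "base_pt \<in> siegel"
proof -
  have *: "(\<Sum>j\<in>UNIV - {last_ix}. (cmod (base_pt $ j))\<^sup>2) = 0"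
    by (rule sum.neutral) (auto simp: base_pt_def axis_def)
  show ?thesis unfolding siegel_def rho_def mem_Collect_eq * by (simp add: base_pt_def)
qed

lemma inv_grad_le_bloch_norm: "f \<in> bloch \<Longrightarrow> z \<in> siegel \<Longrightarrow> inv_grad f z \<le> bloch_norm f"
  unfolding bloch_norm_def by (rule cSUP_upper) (auto simp: bloch_def)

lemma bloch_norm_le: "(\<And>z. z \<in> siegel \<Longrightarrow> inv_grad f z \<le> M) \<Longrightarrow> bloch_norm f \<le> M"
  unfolding bloch_norm_def using base_pt_in_siegel by (intro cSUP_least) auto

lemma bloch_norm_nonneg: "f \<in> bloch \<Longrightarrow> 0 \<le> bloch_norm f"
  using inv_grad_le_bloch_norm[of f base_pt] inv_grad_nonneg[of base_pt f] base_pt_in_siegel by force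

lemma bloch_combine:
  assumes f: "f \<in> bloch" and g: "g \<in> bloch"
  shows "(\<lambda>z. a * f z + b * g z) \<in> bloch"
    and "bloch_norm (\<lambda>z. a * f z + b * g z) \<le> cmod a * bloch_norm f + cmod b * bloch_norm g"
proof -
  have le: "inv_grad (\<lambda>z. a * f z + b * g z) z \<le> cmod a * bloch_norm f + cmod b * bloch_norm g" if z: "z \<in> siegel" for z
  proof -
    have "inv_grad (\<lambda>z. a * f z + b * g z) z \<le> cmod a * inv_grad f z + cmod b * inv_grad g z"
      by (rule inv_grad_combine_le) (use f g z in \<open>auto simp: bloch_def holo_siegel_def\<close>)
    also have "\<dots> \<le> cmod a * bloch_norm f + cmod b * bloch_norm g"
      using inv_grad_le_bloch_norm f g z by (intro add_mono mult_left_mono) auto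
    finally show ?thesis .
  qed
  then have "bdd_above (inv_grad (\<lambda>z. a * f z + b * g z) ` siegel)"
    by (auto intro!: bdd_aboveI)
  then show "(\<lambda>z. a * f z + b * g z) \<in> bloch"
    using f g by (auto simp: bloch_def holo_siegel_combine)
  show "bloch_norm (\<lambda>z. a * f z + b * g z) \<le> cmod a * bloch_norm f + cmod b * bloch_norm g"
    by (rule bloch_norm_le[OF le])
qed

text \<open>The continuity in \<open>C0_siegel\<close> is automatic for a Bloch function, since its
  partial derivatives are continuous; only the two limits remain.\<close>

lemma bloch0_iff:
  "f \<in> bloch0 \<longleftrightarrow> f \<in> bloch \<and> (\<forall>w\<in>siegel_bd. (inv_grad f \<longlongrightarrow> 0) (at w within siegel))
     \<and> (inv_grad f \<longlongrightarrow> 0) (inf at_infinity (principal siegel))"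
proof -
  have "((\<lambda>z. complex_of_real (inv_grad f z)) \<longlongrightarrow> 0) F \<longleftrightarrow> (inv_grad f \<longlongrightarrow> 0) F" for F
    using tendsto_of_real_iff[of "inv_grad f" 0 F, where 'a = complex] by simp
  moreover have "continuous_on siegel (\<lambda>z. complex_of_real (inv_grad f z))" if "f \<in> bloch"
    using that by (intro continuous_intros continuous_on_inv_grad) (auto simp: bloch_def holo_siegel_def)
  ultimately show ?thesis
    unfolding bloch0_def C0_siegel_def by auto
qed

lemma bloch0_combine:
  assumes f: "f \<in> bloch0" and g: "g \<in> bloch0"
  shows "(\<lambda>z. a * f z + b * g z) \<in> bloch0"
proof -
  have fg: "f \<in> bloch" "g \<in> bloch" using f g by (auto simp: bloch0_iff)
  have le: "inv_grad (\<lambda>z. a * f z + b * g z) z \<le> cmod a * inv_grad f z + cmod b * inv_grad g z" if "z \<in> siegel" for z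
    by (rule inv_grad_combine_le) (use fg that in \<open>auto simp: bloch_def holo_siegel_def\<close>)
  have lim: "(inv_grad (\<lambda>z. a * f z + b * g z) \<longlongrightarrow> 0) F"
    if "(inv_grad f \<longlongrightarrow> 0) F" "(inv_grad g \<longlongrightarrow> 0) F" "\<forall>\<^sub>F z in F. z \<in> siegel" for F
  proof (rule tendsto_sandwich)
    show "\<forall>\<^sub>F z in F. 0 \<le> inv_grad (\<lambda>z. a * f z + b * g z) z"
      using that(3) by eventually_elim (rule inv_grad_nonneg)
    show "\<forall>\<^sub>F z in F. inv_grad (\<lambda>z. a * f z + b * g z) z \<le> cmod a * inv_grad f z + cmod b * inv_grad g z"
      using that(3) by eventually_elim (rule le)
    have "((\<lambda>z. cmod a * inv_grad f z + cmod b * inv_grad g z) \<longlongrightarrow> cmod a * 0 + cmod b * 0) F"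
      using that by (intro tendsto_intros)
    then show "((\<lambda>z. cmod a * inv_grad f z + cmod b * inv_grad g z) \<longlongrightarrow> 0) F" by simp
  qed simp
  have e1: "\<forall>\<^sub>F z in at w within siegel. z \<in> siegel" for w :: "'a cspace"
    by (simp add: eventually_at_filter)
  have e2: "\<forall>\<^sub>F z in inf at_infinity (principal siegel). z \<in> (siegel :: 'a cspace set)"
    by (simp add: eventually_inf_principal)
  show ?thesis
    using f g bloch_combine(1)[OF fg] lim[OF _ _ e1] lim[OF _ _ e2] by (simp add: bloch0_iff)
qed

text \<open>The first order change of \<open>Im (z $ last_ix)\<close> cancels that of the squared
  modulus of \<open>z $ j\<close>; the coefficient \<open>2 * \<i> * cnj (z $ j)\<close> in
  \<open>Lop\<close> is made for this.\<close>

lemma rho_ldir: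
  fixes z :: "'n::{finite,linorder} cspace"
  assumes j: "j \<noteq> last_ix"
  shows "rho (z + c *s ldir j z) = rho z - (cmod c)\<^sup>2"
proof -
  let ?I = "UNIV - {last_ix :: 'n}"
  let ?w = "z + c *s ldir j z"
  have jI: "j \<in> ?I" using j by simp
  have "(\<Sum>k\<in>?I. (cmod (?w $ k))\<^sup>2) = (cmod (?w $ j))\<^sup>2 + (\<Sum>k\<in>?I - {j}. (cmod (?w $ k))\<^sup>2)"
    by (rule sum.remove) (use jI in auto)
  also have "(\<Sum>k\<in>?I - {j}. (cmod (?w $ k))\<^sup>2) = (\<Sum>k\<in>?I - {j}. (cmod (z $ k))\<^sup>2)"
    using j by (intro sum.cong) (auto simp: ldir_def axis_def)
  also have "(cmod (?w $ j))\<^sup>2 = (cmod (z $ j))\<^sup>2 + 2 * Re (c * cnj (z $ j)) + (cmod c)\<^sup>2"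
    using j unfolding cmod_power2 by (simp add: ldir_def axis_def power2_eq_square algebra_simps)
  also have "(cmod (z $ j))\<^sup>2 + 2 * Re (c * cnj (z $ j)) + (cmod c)\<^sup>2 + (\<Sum>k\<in>?I - {j}. (cmod (z $ k))\<^sup>2)
     = (\<Sum>k\<in>?I. (cmod (z $ k))\<^sup>2) + 2 * Re (c * cnj (z $ j)) + (cmod c)\<^sup>2"
    using sum.remove[OF finite jI, of "\<lambda>k. (cmod (z $ k))\<^sup>2"] by simp
  finally have "(\<Sum>k\<in>?I. (cmod (?w $ k))\<^sup>2) = (\<Sum>k\<in>?I. (cmod (z $ k))\<^sup>2) + 2 * Re (c * cnj (z $ j)) + (cmod c)\<^sup>2" .
  moreover have "Im (?w $ last_ix) = Im (z $ last_ix) + 2 * Re (c * cnj (z $ j))"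
    using j by (simp add: ldir_def axis_def algebra_simps)
  ultimately show ?thesis by (simp add: rho_def)
qed

text \<open>Moving upwards can only increase \<open>rho\<close>, so on the whole segment the last
  derivative is bounded by \<open>M / rho z\<close>.\<close>

lemma vertical_increment_bound:
  fixes f :: "'n::{finite,linorder} cspace \<Rightarrow> complex"
  assumes f: "holomorphic_Cn_on f siegel" and z: "z \<in> siegel" and t: "0 \<le> t"
    and M: "\<And>w. w \<in> siegel \<Longrightarrow> rho w * cmod (cpartial last_ix f w) \<le> M"
  shows "cmod (f (z + axis last_ix (\<i> * of_real t)) - f z) \<le> M / rho z * t"
proof -
  have r: "rho z > 0" using z by (simp add: siegel_def)
  define S where "S = closed_segment 0 (\<i> * of_real t)"
  have Im: "0 \<le> Im c" if "c \<in> S" for c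
    using that t by (auto simp: S_def in_segment)
  have ax: "axis last_ix c = c *s axis last_ix (1 :: complex)" for c
    by (simp add: vec_eq_iff axis_def)
  have M0: "M \<ge> 0" using r by (intro order_trans[OF mult_nonneg_nonneg M[OF z]]) auto
  have der: "((\<lambda>c. f (z + axis last_ix c)) has_field_derivative cpartial last_ix f (z + axis last_ix c)) (at c within S)"
    if c: "c \<in> S" for c
  proof -
    have "z + c *s axis last_ix 1 \<in> siegel"
      using siegel_add_axis_last[OF z Im[OF c]] by (simp only: ax[of c])
    then obtain D where D: "(f has_derivative D) (at (z + c *s axis last_ix 1))" "\<And>c h. D (c *s h) = c * D h"
      using holomorphic_Cn_onE[OF f] by blast
    have eq: "(\<lambda>c. f (z + axis last_ix c)) = (\<lambda>c. f (z + c *s axis last_ix 1))"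
      by (rule ext) (subst ax, rule refl)
    have "cpartial last_ix f (z + axis last_ix c) = D (axis last_ix 1)"
      using cpartial_conv_derivative(2)[OF D] unfolding ax[of c, symmetric] .
    with line_has_field_derivative[OF D] show ?thesis
      unfolding eq by (simp only:) (rule has_field_derivative_at_within)
  qed
  have "cmod (f (z + axis last_ix (\<i> * of_real t)) - f (z + axis last_ix 0)) \<le> M / rho z * cmod (\<i> * of_real t - 0)"
  proof (rule field_differentiable_bound[OF _ der])
    show "convex S" by (simp add: S_def)
    fix c assume c: "c \<in> S"
    have s: "z + axis last_ix c \<in> siegel" by (rule siegel_add_axis_last[OF z Im[OF c]])
    have "rho z * cmod (cpartial last_ix f (z + axis last_ix c)) \<le> rho (z + axis last_ix c) * cmod (cpartial last_ix f (z + axis last_ix c))"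
      unfolding rho_add_axis_last using Im[OF c] by (intro mult_right_mono) auto
    also have "\<dots> \<le> M" by (rule M[OF s])
    finally show "cmod (cpartial last_ix f (z + axis last_ix c)) \<le> M / rho z"
      using r by (simp add: field_simps)
  qed (auto simp: S_def)
  moreover have "z + axis last_ix 0 = z" by (simp add: vec_eq_iff axis_def)
  ultimately show ?thesis using t by (simp add: norm_mult)
qed

text \<open>
  Along \<open>ldir j z\<close> the height \<open>rho\<close> drops only quadratically, so Cauchy's estimate applies on a disc of
  radius \<open>sqrt (rho z / 2)\<close>. Comparing \<open>z\<close> with the point at twice its height bounds
  \<open>sup (sqrt rho |L\<^sub>j f|)\<close> by itself divided by \<open>sqrt 2\<close>, plus a multiple of \<open>M\<close>.
\<close>

lemma Lop_vertical_step:
  fixes f :: "'n::{finite,linorder} cspace \<Rightarrow> complex"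
  assumes f: "holomorphic_Cn_on f siegel" and z: "z \<in> siegel" and j: "j \<noteq> last_ix"
    and M: "\<And>w. w \<in> siegel \<Longrightarrow> rho w * cmod (cpartial last_ix f w) \<le> M"
  shows "sqrt (rho z) * cmod (Lop j f (z + axis last_ix (\<i> * of_real (rho z))) - Lop j f z) \<le> 2 * sqrt 2 * M"
proof -
  define r where "r = rho z"
  have r: "r > 0" using z by (simp add: siegel_def r_def)
  define s where "s = sqrt (r / 2)"
  have s: "s > 0" "s\<^sup>2 = r / 2" using r by (auto simp: s_def)
  define e :: "'n cspace" where "e = axis last_ix (\<i> * complex_of_real r)"
  define v where "v = ldir j z"
  \<comment> \<open>\<open>ldir j\<close> sees only the coordinate \<open>j\<close>, which a
    vertical move does not change. Both derivatives are therefore taken along the same direction,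
    and their difference is the derivative of the single function \<open>\<psi>\<close>.\<close>
  have v': "ldir j (z + e) = v" using j by (simp add: ldir_def v_def e_def axis_def)
  have rho_s: "rho (z + c *s v) \<ge> r / 2" if "cmod c \<le> s" for c
  proof -
    have "(cmod c)\<^sup>2 \<le> s\<^sup>2" using that by (intro power_mono) auto
    then show ?thesis unfolding v_def rho_ldir[OF j] s(2) by (simp add: r_def)
  qed
  have in_s: "z + c *s v \<in> siegel" if "cmod c \<le> s" for c
    using rho_s[OF that] r by (simp add: siegel_def)
  have in_s': "z + e + c *s v \<in> siegel" if "cmod c \<le> s" for c
    using siegel_add_axis_last[OF in_s[OF that], of "\<i> * of_real r"] r by (simp add: e_def add_ac)
  define \<psi> where "\<psi> c = f (z + e + c *s v) - f (z + c *s v)" for c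
  have der: "\<exists>D E. (\<psi> has_field_derivative D v - E v) (at c)
      \<and> (f has_derivative D) (at (z + e + c *s v)) \<and> (\<forall>c h. D (c *s h) = c * D h)
      \<and> (f has_derivative E) (at (z + c *s v)) \<and> (\<forall>c h. E (c *s h) = c * E h)" if c: "cmod c \<le> s" for c
  proof -
    obtain D where D: "(f has_derivative D) (at (z + e + c *s v))" "\<And>c h. D (c *s h) = c * D h"
      using holomorphic_Cn_onE[OF f in_s'[OF c]] by blast
    obtain E where E: "(f has_derivative E) (at (z + c *s v))" "\<And>c h. E (c *s h) = c * E h"
      using holomorphic_Cn_onE[OF f in_s[OF c]] by blast
    have "(\<psi> has_field_derivative D v - E v) (at c)"
      unfolding \<psi>_def using line_has_field_derivative[OF D] line_has_field_derivative[OF E]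
      by (rule DERIV_diff)
    then show ?thesis using D E by blast
  qed
  have hol: "\<psi> holomorphic_on ball 0 s"
    unfolding holomorphic_on_open[OF open_ball] using der by (metis less_imp_le mem_ball_0)
  have cont: "continuous_on (cball 0 s) \<psi>"
  proof (intro continuous_at_imp_continuous_on ballI)
    fix c :: complex assume "c \<in> cball 0 s"
    then show "isCont \<psi> c" using der[of c] DERIV_isCont by auto
  qed
  have bnd: "cmod (\<psi> c) \<le> 2 * M" if "cmod c \<le> s" for c
  proof -
    have M0: "M \<ge> 0" using r by (intro order_trans[OF mult_nonneg_nonneg M[OF z]]) (auto simp: r_def)
    have "cmod (\<psi> c) \<le> M / rho (z + c *s v) * r"
      using vertical_increment_bound[OF f in_s[OF that] _ M, of r] r by (simp add: \<psi>_def e_def add_ac)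
    also have "\<dots> \<le> M / (r / 2) * r"
      using rho_s[OF that] r M0 by (intro mult_right_mono divide_left_mono) auto
    finally show ?thesis using r by simp
  qed
  have "cmod ((deriv ^^ 1) \<psi> 0) \<le> fact 1 * (2 * M) / s ^ 1"
    by (rule Cauchy_inequality[OF hol cont s(1)]) (use bnd in auto)
  then have 1: "cmod (deriv \<psi> 0) \<le> 2 * M / s" by simp
  obtain D E where DE: "(\<psi> has_field_derivative D v - E v) (at 0)"
      "(f has_derivative D) (at (z + e + 0 *s v))" "\<And>c h. D (c *s h) = c * D h"
      "(f has_derivative E) (at (z + 0 *s v))" "\<And>c h. E (c *s h) = c * E h"
    using der[of 0] s(1) by auto
  have "Lop j f (z + e) = D v" using Lop_conv_derivative[of f D "z + e" j] DE by (simp add: v')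
  moreover have "Lop j f z = E v" using Lop_conv_derivative[of f E z j] DE by (simp add: v_def)
  ultimately have "Lop j f (z + e) - Lop j f z = deriv \<psi> 0"
    using DERIV_imp_deriv[OF DE(1)] by simp
  then have "sqrt r * cmod (Lop j f (z + e) - Lop j f z) \<le> sqrt r * (2 * M / s)"
    using 1 r by (intro mult_left_mono) auto
  also have "sqrt r * (2 * M / s) = 2 * sqrt 2 * M"
    using r by (simp add: s_def real_sqrt_divide field_simps)
  finally show ?thesis by (simp add: r_def e_def)
qed

lemma sqrt_rho_Lop_bound:
  fixes f :: "'n::{finite,linorder} cspace \<Rightarrow> complex"
  assumes f: "f \<in> bloch" and z: "z \<in> siegel" and j: "j \<noteq> last_ix"
    and M: "\<And>w. w \<in> siegel \<Longrightarrow> rho w * cmod (cpartial last_ix f w) \<le> M"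
  shows "sqrt (rho z) * cmod (Lop j f z) \<le> 10 * M"
proof -
  have hf: "holomorphic_Cn_on f siegel" using f by (simp add: bloch_def holo_siegel_def)
  let ?a = "\<lambda>z. sqrt (rho z) * cmod (Lop j f z)"
  define S where "S = (SUP z\<in>siegel. ?a z)"
  have "?a w \<le> bloch_norm f" if "w \<in> siegel" for w
    using sqrt_rho_Lop_le[OF that j] inv_grad_le_bloch_norm[OF f that] by (rule order_trans)
  \<comment> \<open>Membership in \<open>bloch\<close> makes the supremum finite in advance, so that
    \<open>S / sqrt 2\<close> can later be absorbed.\<close>
  then have bdd: "bdd_above (?a ` siegel)" by (auto intro!: bdd_aboveI)
  have up: "?a w \<le> S" if "w \<in> siegel" for w
    unfolding S_def using that bdd by (rule cSUP_upper)
  have "?a w \<le> S / sqrt 2 + 2 * sqrt 2 * M" if w: "w \<in> siegel" for w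
  proof -
    have r: "rho w > 0" using w by (simp add: siegel_def)
    let ?w = "w + axis last_ix (\<i> * of_real (rho w))"
    have w': "?w \<in> siegel" by (rule siegel_add_axis_last[OF w]) (use r in simp)
    have "cmod (Lop j f w) \<le> cmod (Lop j f ?w) + cmod (Lop j f ?w - Lop j f w)"
      by (metis norm_minus_commute norm_triangle_sub)
    then have "?a w \<le> sqrt (rho w) * cmod (Lop j f ?w) + sqrt (rho w) * cmod (Lop j f ?w - Lop j f w)"
      using r by (simp add: distrib_left[symmetric] mult_left_mono)
    also have "sqrt (rho w) * cmod (Lop j f ?w - Lop j f w) \<le> 2 * sqrt 2 * M"
      by (rule Lop_vertical_step[OF hf w j M])
    \<comment> \<open>\<open>?w\<close> lies at twice the height of \<open>w\<close>, so the factor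
      \<open>sqrt (rho w)\<close> is \<open>1 / sqrt 2\<close> times the one at \<open>?w\<close>;
      this contraction closes the estimate.\<close>
    also have "sqrt (rho w) * cmod (Lop j f ?w) = ?a ?w / sqrt 2"
      by (simp add: rho_add_axis_last real_sqrt_mult)
    also have "?a ?w / sqrt 2 \<le> S / sqrt 2"
      using up[OF w'] by (rule divide_right_mono) simp
    finally show ?thesis by simp
  qed
  then have "S \<le> S / sqrt 2 + 2 * sqrt 2 * M"
    unfolding S_def using base_pt_in_siegel by (intro cSUP_least) auto
  then have "sqrt 2 * S \<le> sqrt 2 * (S / sqrt 2 + 2 * sqrt 2 * M)" by (rule mult_left_mono) simp
  also have "sqrt 2 * (S / sqrt 2 + 2 * sqrt 2 * M) = S + 4 * M" by (simp add: distrib_left)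
  finally have *: "(sqrt 2 - 1) * S \<le> 4 * M" by (simp add: algebra_simps)
  have "?a z \<le> S" by (rule up[OF z])
  moreover have S0: "S \<ge> 0" 
    using z by (intro order_trans[OF mult_nonneg_nonneg up[OF z]]) (auto simp: siegel_def)
  \<comment> \<open>Absorption left \<open>(sqrt 2 - 1) * S\<close> at most \<open>4 * M\<close>;
    with 1.4 for the root this gives the constant 10.\<close>
  moreover have "sqrt 2 \<ge> 1.4" by (rule real_le_rsqrt) (simp add: power2_eq_square)
  then have "0.4 * S \<le> (sqrt 2 - 1) * S" using S0 by (intro mult_right_mono) auto
  ultimately show ?thesis using * by simp
qed

text \<open>Each tangential term contributes at most \<open>2 * (10 * M)\<^sup>2\<close>, counted
  here n instead of n - 1 times; the last derivative contributes
  \<open>8 * M\<^sup>2\<close>.\<close>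

definition bloch_const :: "'n::finite itself \<Rightarrow> real" where
  "bloch_const _ = sqrt (200 * real CARD('n) + 8)"

lemma bloch_norm_le_last:
  fixes f :: "'n::{finite,linorder} cspace \<Rightarrow> complex"
  assumes f: "f \<in> bloch" and M: "\<And>w. w \<in> siegel \<Longrightarrow> rho w * cmod (cpartial last_ix f w) \<le> M"
  shows "bloch_norm f \<le> bloch_const TYPE('n) * M"
proof (rule bloch_norm_le)
  fix z :: "'n cspace" assume z: "z \<in> siegel"
  have r: "rho z > 0" using z by (simp add: siegel_def)
  have M0: "M \<ge> 0" using r by (intro order_trans[OF mult_nonneg_nonneg M[OF z]]) auto
  have 1: "rho z * (cmod (Lop j f z))\<^sup>2 \<le> 100 * M\<^sup>2" if "j \<noteq> last_ix" for j
    using power_mono[OF sqrt_rho_Lop_bound[OF f z that M], of 2] r by (simp add: power_mult_distrib)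
  have 2: "(rho z)\<^sup>2 * (cmod (Lop last_ix f z))\<^sup>2 \<le> M\<^sup>2"
    using power_mono[OF M[OF z], of 2] r by (simp add: power_mult_distrib Lop_last)
  have "rho z * (\<Sum>j\<in>UNIV - {last_ix}. (cmod (Lop j f z))\<^sup>2) \<le> (\<Sum>j\<in>UNIV - {last_ix :: 'n}. 100 * M\<^sup>2)"
    unfolding sum_distrib_left using 1 by (intro sum_mono) auto
  also have "\<dots> \<le> (\<Sum>j\<in>(UNIV :: 'n set). 100 * M\<^sup>2)"
    by (rule sum_mono2) auto
  finally have 3: "rho z * (\<Sum>j\<in>UNIV - {last_ix}. (cmod (Lop j f z))\<^sup>2) \<le> real CARD('n) * 100 * M\<^sup>2"
    by simp
  have "inv_grad f z \<le> sqrt ((200 * real CARD('n) + 8) * M\<^sup>2)"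
    unfolding inv_grad_def using 2 3 by (intro real_sqrt_le_mono) (simp add: algebra_simps)
  then show "inv_grad f z \<le> bloch_const TYPE('n) * M"
    using M0 by (simp add: bloch_const_def real_sqrt_mult)
qed

section \<open>Kernel functions\<close>

text \<open>The map \<open>rr z w\<close> is affine in \<open>z\<close>; this is its complex linear
  part, hence its derivative at every point.\<close>

definition rr_lin :: "'n::{finite,linorder} cspace \<Rightarrow> 'n cspace \<Rightarrow> complex" where
  "rr_lin w h = - \<i> / 2 * h $ last_ix - (\<Sum>j\<in>UNIV - {last_ix}. h $ j * cnj (w $ j))"

lemma rr_add: "rr (z + h) w = rr z w + rr_lin w h"
  by (simp add: rr_def rr_lin_def algebra_simps sum.distrib)

lemma rr_lin_scale: "rr_lin w (c *s h) = c * rr_lin w h"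
  by (simp add: rr_lin_def algebra_simps sum_distrib_left)

lemma rr_lin_add: "rr_lin w (h + k) = rr_lin w h + rr_lin w k"
  by (simp add: rr_lin_def algebra_simps sum.distrib)

lemma rr_has_derivative: "((\<lambda>z. rr z w) has_derivative rr_lin w) (at z)"
  unfolding rr_def[abs_def] rr_lin_def[abs_def]
  by (auto intro!: derivative_eq_intros bounded_linear.has_derivative[OF bounded_linear_vec_nth] simp: algebra_simps)

lemma ker_has_field_derivative:
  assumes "x \<notin> \<real>\<^sub>\<le>\<^sub>0"
  shows "((\<lambda>x. exp (- of_real p * Ln x)) has_field_derivative - of_real p * exp (- of_real (p + 1) * Ln x)) (at x)"
proof -
  have x0: "x \<noteq> 0" using assms by auto
  have "exp (- of_real (p + 1) * Ln x) = exp (- of_real p * Ln x) / x"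
  proof -
    have "- of_real (p + 1) * Ln x = - of_real p * Ln x - Ln x"
      by (simp add: algebra_simps)
    then show ?thesis by (simp only: exp_diff exp_Ln[OF x0])
  qed
  then show ?thesis
    using assms by (auto intro!: derivative_eq_intros simp: divide_inverse mult_ac)
qed

lemma ker_has_derivative:
  assumes "z \<in> siegel" "w \<in> siegel"
  shows "((\<lambda>z. ker p z w) has_derivative (\<lambda>h. - of_real p * ker (p + 1) z w * rr_lin w h)) (at z)"
  unfolding ker_def
  using has_derivative_compose[OF rr_has_derivative ker_has_field_derivative[OF rr_not_nonpos[OF assms], unfolded has_field_derivative_def]]
  by simp

lemma ii_mult_mult_ii: "\<i> * (x * \<i>) = - x"
  by (simp add: mult.commute[of x] flip: mult.assoc)

text \<open>The tangential derivative of \<open>rr\<close> is the conjugate of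
  \<open>z $ j - w $ j\<close>, of the order of the square root of \<open>cmod (rr z w)\<close> by
  \<open>Re_rr_pos\<close>. This gains the half power that the weight \<open>sqrt (rho z)\<close> of
  the tangential part calls for.\<close>

lemma rr_lin_ldir:
  "rr_lin w (ldir j z) = (if j = last_ix then - \<i> / 2 else cnj (z $ j) - cnj (w $ j))"
proof (cases "j = last_ix")
  case True
  have "(\<Sum>k\<in>UNIV - {last_ix}. axis last_ix 1 $ k * cnj (w $ k)) = 0"
    by (rule sum.neutral) (auto simp: axis_def)
  then show ?thesis using True by (simp add: rr_lin_def ldir_def)
next
  case False
  have 1: "rr_lin w (axis last_ix 1) = - \<i> / 2"
  proof -
    have "(\<Sum>k\<in>UNIV - {last_ix}. axis last_ix 1 $ k * cnj (w $ k)) = 0"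
      by (rule sum.neutral) (auto simp: axis_def)
    then show ?thesis by (simp add: rr_lin_def)
  qed
  have "(\<Sum>k\<in>UNIV - {last_ix}. axis j 1 $ k * cnj (w $ k)) = (\<Sum>k\<in>UNIV - {last_ix}. if k = j then cnj (w $ j) else 0)"
    by (rule sum.cong) (auto simp: axis_def)
  also have "\<dots> = cnj (w $ j)" using False by (simp add: sum.delta)
  finally have 2: "rr_lin w (axis j 1) = - cnj (w $ j)"
    using False by (simp add: rr_lin_def) (simp add: axis_def)
  show ?thesis using False by (simp add: ldir_def rr_lin_add rr_lin_scale 1 2 ii_mult_mult_ii)
qed

text \<open>The factor \<open>2 / (\<i> s)\<close> makes the derivative in \<open>z\<^sub>n\<close> equal to \<open>ker (s + 1)\<close>.\<close>

definition kfun :: "real \<Rightarrow> 'n::{finite,linorder} cspace \<Rightarrow> 'n cspace \<Rightarrow> complex" where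
  "kfun s w z = (if z \<in> siegel then 2 / (\<i> * of_real s) * (ker s z w - ker s base_pt w) else 0)"

lemma kfun_has_derivative:
  assumes z: "z \<in> siegel" and w: "w \<in> siegel" and s: "s > 0"
  shows "(kfun s w has_derivative (\<lambda>h. 2 * \<i> * ker (s + 1) z w * rr_lin w h)) (at z)"
proof -
  have "((\<lambda>z. 2 / (\<i> * of_real s) * (ker s z w - ker s base_pt w)) has_derivative
      (\<lambda>h. 2 / (\<i> * of_real s) * (- of_real s * ker (s + 1) z w * rr_lin w h - 0))) (at z)"
    by (intro has_derivative_mult_right has_derivative_diff ker_has_derivative z w has_derivative_const)
  also have "(\<lambda>h. 2 / (\<i> * of_real s) * (- of_real s * ker (s + 1) z w * rr_lin w h - 0))
    = (\<lambda>h. 2 * \<i> * ker (s + 1) z w * rr_lin w h)"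
    using s by (auto simp: field_simps)
  finally show ?thesis
    by (rule has_derivative_transform_within_open[OF _ open_siegel z]) (simp add: kfun_def)
qed

lemma kfun_holo: "w \<in> siegel \<Longrightarrow> s > 0 \<Longrightarrow> kfun s w \<in> holo_siegel"
  unfolding holo_siegel_def holomorphic_Cn_on_def
  using kfun_has_derivative by (fastforce simp: kfun_def rr_lin_scale)

lemma Lop_kfun:
  assumes z: "z \<in> siegel" and w: "w \<in> siegel" and s: "s > 0"
  shows "Lop j (kfun s w) z = 2 * \<i> * ker (s + 1) z w * rr_lin w (ldir j z)"
  by (rule Lop_conv_derivative[OF kfun_has_derivative[OF assms]]) (simp add: rr_lin_scale)

lemma cpartial_last_kfun:
  assumes "z \<in> siegel" "w \<in> siegel" "s > 0"
  shows "cpartial last_ix (kfun s w) z = ker (s + 1) z w"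
  using Lop_kfun[OF assms, of last_ix] by (simp add: Lop_last rr_lin_ldir ii_mult_mult_ii)

text \<open>Two forms for two limits: the first keeps the factor \<open>rho z\<close>, which
  vanishes at the boundary; the second trades it for \<open>2 * cmod (rr z w)\<close> and decays at
  infinity.\<close>

lemma inv_grad_kfun_le:
  assumes z: "z \<in> siegel" and w: "w \<in> siegel" and s: "s > 0"
  shows "(inv_grad (kfun s w) z)\<^sup>2 \<le> 32 * rho z * cmod (rr z w) powr (- (2 * s + 1))"
    and "(inv_grad (kfun s w) z)\<^sup>2 \<le> 64 * cmod (rr z w) powr (- (2 * s))"
proof -
  define R where "R = cmod (rr z w)"
  have R: "R > 0" using rr_nonzero[OF z w] by (simp add: R_def)
  have r: "rho z > 0" "rho z \<le> 2 * R" using z Re_rr_pos(2)[OF z w] by (auto simp: siegel_def R_def)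
  define k where "k = cmod (ker (s + 1) z w)"
  have k: "k\<^sup>2 = R powr (- (2 * s + 2))"
    using R by (simp add: k_def norm_ker[OF z w] R_def[symmetric] powr_power)
  let ?S = "\<Sum>j\<in>UNIV - {last_ix}. (cmod (z $ j - w $ j))\<^sup>2"
  have S: "?S \<le> 2 * R" using Re_rr_pos(4)[OF z w] by (simp add: R_def)
  have L: "cmod (Lop j (kfun s w) z) = 2 * k * (if j = last_ix then 1 / 2 else cmod (z $ j - w $ j))" for j
    unfolding Lop_kfun[OF assms] rr_lin_ldir
    by (auto simp: norm_mult norm_divide k_def simp flip: complex_cnj_diff)
  have "(\<Sum>j\<in>UNIV - {last_ix}. (cmod (Lop j (kfun s w) z))\<^sup>2) = (\<Sum>j\<in>UNIV - {last_ix}. 4 * k\<^sup>2 * (cmod (z $ j - w $ j))\<^sup>2)"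
    by (rule sum.cong) (auto simp: L power_mult_distrib)
  also have "\<dots> = 4 * k\<^sup>2 * ?S" by (simp add: sum_distrib_left)
  finally have "(inv_grad (kfun s w) z)\<^sup>2 = 2 * rho z * (4 * k\<^sup>2 * ?S) + 8 * (rho z)\<^sup>2 * k\<^sup>2"
    unfolding inv_grad_def using r by (simp add: L sum_nonneg)
  also have "\<dots> = 8 * rho z * k\<^sup>2 * (?S + rho z)"
    by (simp add: power2_eq_square algebra_simps)
  also have "\<dots> \<le> 8 * rho z * k\<^sup>2 * (4 * R)"
    using S r by (intro mult_left_mono) auto
  also have "\<dots> = 32 * rho z * R powr (- (2 * s + 1))"
  proof -
    have "R powr (- (2 * s + 1)) = R powr (- (2 * s + 2) + 1)" by (rule arg_cong[where f = "\<lambda>x. R powr x"]) simp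
    also have "\<dots> = k\<^sup>2 * R" unfolding powr_add k using R by simp
    finally show ?thesis by simp
  qed
  finally show 1: "(inv_grad (kfun s w) z)\<^sup>2 \<le> 32 * rho z * cmod (rr z w) powr (- (2 * s + 1))"
    by (simp add: R_def)
  also have "\<dots> \<le> 32 * (2 * R) * R powr (- (2 * s + 1))"
    unfolding R_def[symmetric] using r by (intro mult_right_mono mult_left_mono) auto
  also have "\<dots> = 64 * R powr (- (2 * s))"
  proof -
    have "R powr (- (2 * s)) = R powr (- (2 * s + 1) + 1)" by (rule arg_cong[where f = "\<lambda>x. R powr x"]) simp
    also have "\<dots> = R powr (- (2 * s + 1)) * R" unfolding powr_add using R by simp
    finally show ?thesis by simp
  qed
  finally show "(inv_grad (kfun s w) z)\<^sup>2 \<le> 64 * cmod (rr z w) powr (- (2 * s))"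
    by (simp add: R_def)
qed

text \<open>Properness of \<open>rr\<close> in its first argument. The first coordinates of
  \<open>z\<close> are within \<open>1 + cmod (rr z w)\<close> of those of \<open>w\<close>, and the
  last one is found by solving the definition of \<open>rr\<close> for it.\<close>

lemma norm_le_rr:
  fixes w :: "'n::{finite,linorder} cspace"
  assumes w: "w \<in> siegel"
  obtains K where "K > 0" "\<And>z. z \<in> siegel \<Longrightarrow> norm z \<le> K * (1 + cmod (rr z w))"
proof -
  define A where "A = norm w + 1"
  define B where "B = norm w + 2 + 2 * real CARD('n) * A * norm w"
  define K where "K = B + real CARD('n) * A"
  have A: "A > 0" by (simp add: A_def add_nonneg_pos)
  have B: "B > 0" using A by (simp add: B_def add_nonneg_pos add_pos_nonneg)
  have "norm z \<le> K * (1 + cmod (rr z w))" if z: "z \<in> siegel" for z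
  proof -
    define R where "R = cmod (rr z w)"
    have R: "R \<ge> 0" by (simp add: R_def)
    have 1: "cmod (z $ j) \<le> A * (1 + R)" if j: "j \<noteq> last_ix" for j
    proof -
      have "(cmod (z $ j - w $ j))\<^sup>2 \<le> (\<Sum>j\<in>UNIV - {last_ix}. (cmod (z $ j - w $ j))\<^sup>2)"
        using j by (intro member_le_sum) auto
      also have "\<dots> \<le> 2 * R" using Re_rr_pos(4)[OF z w] by (simp add: R_def)
      also have "\<dots> \<le> (1 + R)\<^sup>2" using R by (simp add: power2_eq_square algebra_simps)
      finally have "cmod (z $ j - w $ j) \<le> 1 + R" using R by (simp add: power2_le_iff_abs_le)
      then have "cmod (z $ j) \<le> 1 + R + norm w"
        using norm_triangle_sub[of "z $ j" "w $ j"] Finite_Cartesian_Product.norm_nth_le[of w j] by linarith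
      also have "\<dots> \<le> A * (1 + R)" using R by (simp add: A_def algebra_simps)
      finally show ?thesis .
    qed
    have 2: "cmod (z $ last_ix) \<le> B * (1 + R)"
    proof -
      define X where "X = real CARD('n) * (A * (1 + R) * norm w)"
      let ?T = "\<Sum>j\<in>UNIV - {last_ix}. z $ j * cnj (w $ j)"
      have "z $ last_ix = cnj (w $ last_ix) + 2 * \<i> * (rr z w + ?T)"
        by (simp add: rr_def algebra_simps)
      then have "cmod (z $ last_ix) \<le> cmod (cnj (w $ last_ix)) + cmod (2 * \<i> * (rr z w + ?T))"
        by (metis norm_triangle_ineq)
      moreover have "cmod (2 * \<i> * (rr z w + ?T)) \<le> 2 * (R + cmod ?T)"
        using norm_triangle_ineq[of "rr z w" ?T] by (simp add: norm_mult R_def)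
      moreover have "cmod ?T \<le> X"
      proof -
        have "cmod ?T \<le> (\<Sum>j\<in>UNIV - {last_ix :: 'n}. A * (1 + R) * norm w)"
          using 1 A R Finite_Cartesian_Product.norm_nth_le[of w]
          by (intro sum_norm_le) (auto simp: norm_mult intro!: mult_mono)
        also have "\<dots> \<le> (\<Sum>j\<in>(UNIV :: 'n set). A * (1 + R) * norm w)"
          using A R by (intro sum_mono2) auto
        finally show ?thesis by (simp add: X_def)
      qed
      moreover have "cmod (cnj (w $ last_ix)) \<le> norm w"
        using Finite_Cartesian_Product.norm_nth_le[of w last_ix] by simp
      moreover have "a \<le> n + 2 * (r + x)" if "a \<le> b + c" "c \<le> 2 * (r + t)" "t \<le> x" "b \<le> n"
        for a b c r t x n :: real
        using that by simp
      ultimately have "cmod (z $ last_ix) \<le> norm w + 2 * (R + X)"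
        by blast
      also have "\<dots> \<le> B * (1 + R)" using R by (simp add: B_def X_def algebra_simps)
      finally show ?thesis .
    qed
    have "norm z \<le> (\<Sum>j\<in>UNIV. cmod (z $ j))"
      unfolding norm_vec_def by (rule L2_set_le_sum) simp
    also have "\<dots> = cmod (z $ last_ix) + (\<Sum>j\<in>UNIV - {last_ix}. cmod (z $ j))"
      by (rule sum.remove) auto
    also have "(\<Sum>j\<in>UNIV - {last_ix}. cmod (z $ j)) \<le> (\<Sum>j\<in>UNIV - {last_ix :: 'n}. A * (1 + R))"
      using 1 by (intro sum_mono) auto
    also have "\<dots> \<le> (\<Sum>j\<in>(UNIV :: 'n set). A * (1 + R))"
      using A R by (intro sum_mono2) auto
    also have "\<dots> = real CARD('n) * A * (1 + R)" by simp
    finally show ?thesis using 2 by (simp add: K_def R_def algebra_simps)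
  qed
  moreover have "K > 0" using A B by (simp add: K_def add_pos_nonneg)
  ultimately show ?thesis using that by blast
qed

text \<open>\<open>cmod (rr z w)\<close> is at least \<open>rho w / 2\<close>, which gives
  boundedness and, with the factor \<open>rho z\<close>, the limit at the boundary. At infinity
  \<open>norm_le_rr\<close> drives the modulus of \<open>rr\<close> to infinity.\<close>

lemma kfun_bloch0:
  fixes w :: "'n::{finite,linorder} cspace"
  assumes w: "w \<in> siegel" and s: "s > 0"
  shows "kfun s w \<in> bloch0"
proof -
  let ?g = "inv_grad (kfun s w)"
  define d where "d = rho w / 2"
  have d: "d > 0" using w by (simp add: d_def siegel_def)
  have rd: "d \<le> cmod (rr z w)" if "z \<in> siegel" for z
    using Re_rr_pos(3)[OF that w] by (simp add: d_def)
  have b: "kfun s w \<in> bloch"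
  proof -
    have "?g z \<le> sqrt (64 * d powr (- (2 * s)))" if z: "z \<in> siegel" for z
    proof (rule real_le_rsqrt)
      have "(?g z)\<^sup>2 \<le> 64 * cmod (rr z w) powr (- (2 * s))" by (rule inv_grad_kfun_le(2)[OF z w s])
      also have "\<dots> \<le> 64 * d powr (- (2 * s))"
        using rd[OF z] d s by (intro mult_left_mono powr_mono2') auto
      finally show "(?g z)\<^sup>2 \<le> 64 * d powr (- (2 * s))" .
    qed
    then have "bdd_above (?g ` siegel)" by (auto intro!: bdd_aboveI)
    then show ?thesis using kfun_holo[OF w s] by (simp add: bloch_def kfun_def)
  qed
  have sq: "(?g \<longlongrightarrow> 0) F" if "((\<lambda>z. (?g z)\<^sup>2) \<longlongrightarrow> 0) F" "\<forall>\<^sub>F z in F. z \<in> siegel" for F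
  proof -
    have "((\<lambda>z. sqrt ((?g z)\<^sup>2)) \<longlongrightarrow> sqrt 0) F" using that(1) by (rule tendsto_real_sqrt)
    then have "((\<lambda>z. \<bar>?g z\<bar>) \<longlongrightarrow> 0) F" by simp
    then show ?thesis by (rule tendsto_rabs_zero_cancel)
  qed
  have 1: "(?g \<longlongrightarrow> 0) (at v within siegel)" if v: "v \<in> siegel_bd" for v
  proof (rule sq)
    have e: "\<forall>\<^sub>F z in at v within siegel. z \<in> siegel" by (simp add: eventually_at_filter)
    then show "\<forall>\<^sub>F z in at v within siegel. z \<in> siegel" .
    have "isCont rho v" using continuous_on_rho[of "UNIV :: 'n cspace set"] by (simp add: continuous_on_eq_continuous_at)
    then have "(rho \<longlongrightarrow> rho v) (at v within siegel)"
      by (auto simp: isCont_def intro: tendsto_within_subset)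
    then have "((\<lambda>z. 32 * rho z * d powr (- (2 * s + 1))) \<longlongrightarrow> 32 * rho v * d powr (- (2 * s + 1))) (at v within siegel)"
      by (intro tendsto_intros)
    then have lim: "((\<lambda>z. 32 * rho z * d powr (- (2 * s + 1))) \<longlongrightarrow> 0) (at v within siegel)"
      using v by (simp add: siegel_bd_def)
    show "((\<lambda>z. (?g z)\<^sup>2) \<longlongrightarrow> 0) (at v within siegel)"
    proof (rule tendsto_sandwich[OF _ _ tendsto_const lim])
      show "\<forall>\<^sub>F z in at v within siegel. (?g z)\<^sup>2 \<le> 32 * rho z * d powr (- (2 * s + 1))"
        using e
      proof eventually_elim
        case (elim z)
        have "(?g z)\<^sup>2 \<le> 32 * rho z * cmod (rr z w) powr (- (2 * s + 1))" by (rule inv_grad_kfun_le(1)[OF elim w s])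
        also have "\<dots> \<le> 32 * rho z * d powr (- (2 * s + 1))"
          using rd[OF elim] d s elim by (intro mult_left_mono powr_mono2') (auto simp: siegel_def)
        finally show ?case .
      qed
    qed simp
  qed
  have 2: "(?g \<longlongrightarrow> 0) (inf at_infinity (principal siegel))"
  proof (rule sq)
    let ?F = "inf at_infinity (principal siegel) :: 'n cspace filter"
    have e: "\<forall>\<^sub>F z in ?F. z \<in> siegel" by (simp add: eventually_inf_principal)
    then show "\<forall>\<^sub>F z in ?F. z \<in> siegel" .
    obtain K where K: "K > 0" "\<And>z. z \<in> siegel \<Longrightarrow> norm z \<le> K * (1 + cmod (rr z w))"
      using norm_le_rr[OF w] by blast
    have "filterlim (norm :: 'n cspace \<Rightarrow> real) at_top ?F"
      by (rule filterlim_mono[OF filterlim_norm_at_top _ inf_le1]) simp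
    then have "filterlim (\<lambda>z :: 'n cspace. - 1 + norm z / K) at_top ?F"
      by (intro filterlim_tendsto_add_at_top[OF tendsto_const] filterlim_at_top_mult_tendsto_pos[OF tendsto_const])
         (use K in \<open>auto simp: divide_inverse intro!: filterlim_at_top_mult_tendsto_pos[OF tendsto_const]\<close>)
    then have "filterlim (\<lambda>z. cmod (rr z w)) at_top ?F"
    proof (rule filterlim_at_top_mono)
      show "\<forall>\<^sub>F z in ?F. - 1 + norm z / K \<le> cmod (rr z w)"
        using e by eventually_elim (use K in \<open>auto simp: field_simps\<close>)
    qed
    then have "((\<lambda>z. cmod (rr z w) powr (- (2 * s))) \<longlongrightarrow> 0) ?F"
      using s by (intro tendsto_neg_powr) auto
    then have lim: "((\<lambda>z. 64 * cmod (rr z w) powr (- (2 * s))) \<longlongrightarrow> 0) ?F"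
      using tendsto_mult_left[of "\<lambda>z. cmod (rr z w) powr (- (2 * s))" 0 ?F 64] by simp
    show "((\<lambda>z. (?g z)\<^sup>2) \<longlongrightarrow> 0) ?F"
    proof (rule tendsto_sandwich[OF _ _ tendsto_const lim])
      show "\<forall>\<^sub>F z in ?F. (?g z)\<^sup>2 \<le> 64 * cmod (rr z w) powr (- (2 * s))"
        using e by eventually_elim (rule inv_grad_kfun_le(2)[OF _ w s])
    qed simp
  qed
  show ?thesis using b 1 2 by (simp add: bloch0_iff)
qed

section \<open>Relative perturbation estimates for the kernel\<close>

lemma segment_norm_ge:
  fixes x y :: complex
  assumes "\<xi> \<in> closed_segment x y" "cmod (y - x) \<le> \<eta> * cmod x" "\<eta> \<le> 1 / 2"
  shows "cmod (\<xi> - x) \<le> \<eta> * cmod x" "cmod x / 2 \<le> cmod \<xi>"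
proof -
  have "cmod (\<xi> - x) \<le> cmod (y - x)"
    using segment_bound(1)[OF assms(1)] .
  then show 1: "cmod (\<xi> - x) \<le> \<eta> * cmod x" using assms(2) by linarith
  also have "\<dots> \<le> 1 / 2 * cmod x" using assms(3) by (intro mult_right_mono) auto
  finally show "cmod x / 2 \<le> cmod \<xi>"
    using norm_triangle_sub[of x \<xi>] by (simp add: norm_minus_commute)
qed

lemma segment_Re_pos:
  assumes "\<xi> \<in> closed_segment x y" "0 < Re x" "0 < Re y"
  shows "0 < Re \<xi>"
proof -
  have "convex {c. 0 < Re c}"
    using convex_halfspace_Re_gt[of 0] by simp
  then show ?thesis using closed_segment_subset[of x "{c. 0 < Re c}" y] assms by auto
qed

definition npow :: "real \<Rightarrow> complex \<Rightarrow> complex" where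
  "npow p x = exp (- of_real p * Ln x)"

lemma norm_npow: "x \<noteq> 0 \<Longrightarrow> cmod (npow p x) = cmod x powr (- p)"
  by (simp add: npow_def powr_def)

lemma ker_npow: "ker p z w = npow p (rr z w)"
  by (simp add: ker_def npow_def)

lemma npow_has_field_derivative:
  assumes "0 < Re x"
  shows "(npow p has_field_derivative - of_real p * npow (p + 1) x) (at x within S)"
proof -
  have "x \<notin> \<real>\<^sub>\<le>\<^sub>0" using assms by (auto simp: complex_nonpos_Reals_iff)
  from has_field_derivative_at_within[OF ker_has_field_derivative[OF this, of p], of S]
  show ?thesis unfolding npow_def[abs_def] .
qed

text \<open>Mean value inequality on the segment from \<open>x\<close> to \<open>y\<close>. There
  the modulus stays above half that of \<open>x\<close>, which costs the factor
  \<open>2 powr (p + 1)\<close> in the derivative; the error is measured against the modulus of the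
  value at \<open>x\<close>.\<close>

lemma npow_diff_bound:
  assumes x: "0 < Re x" and y: "0 < Re y" and \<eta>: "cmod (y - x) \<le> \<eta> * cmod x" "\<eta> \<le> 1 / 2" and p: "p \<ge> 0"
  shows "cmod (npow p y - npow p x) \<le> p * 2 powr (p + 1) * \<eta> * cmod x powr (- p)"
proof -
  have x0: "cmod x > 0" using x by auto
  have "cmod (npow p y - npow p x) \<le> (p * (2 powr (p + 1) * cmod x powr (- p - 1))) * cmod (y - x)"
  proof (rule field_differentiable_bound[where S = "closed_segment x y"])
    fix \<xi> assume \<xi>: "\<xi> \<in> closed_segment x y"
    have R: "0 < Re \<xi>" by (rule segment_Re_pos[OF \<xi> x y])
    then show "(npow p has_field_derivative - of_real p * npow (p + 1) \<xi>) (at \<xi> within closed_segment x y)"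
      by (rule npow_has_field_derivative)
    have "cmod \<xi> powr (- (p + 1)) \<le> (cmod x / 2) powr (- (p + 1))"
      using segment_norm_ge(2)[OF \<xi> \<eta>] x0 p by (intro powr_mono2') auto
    also have "\<dots> = 2 powr (p + 1) * cmod x powr (- p - 1)"
    proof -
      have "(cmod x / 2) powr (- (p + 1)) = cmod x powr (- (p + 1)) / 2 powr (- (p + 1))"
        by (rule powr_divide)
      also have "(2::real) powr (- (p + 1)) = 1 / 2 powr (p + 1)"
        by (rule powr_minus_divide)
      finally show ?thesis by simp
    qed
    finally show "cmod (- of_real p * npow (p + 1) \<xi>) \<le> p * (2 powr (p + 1) * cmod x powr (- p - 1))"
      using R p by (subst norm_mult, subst norm_npow) (auto intro!: mult_left_mono)
  qed auto
  also have "\<dots> \<le> (p * (2 powr (p + 1) * cmod x powr (- p - 1))) * (\<eta> * cmod x)"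
    using \<eta>(1) p by (intro mult_left_mono) auto
  also have "\<dots> = p * 2 powr (p + 1) * \<eta> * (cmod x powr (- p - 1) * cmod x)" by simp
  also have "cmod x powr (- p - 1) * cmod x = cmod x powr (- p)"
    using x0 by (simp add: powr_diff)
  finally show ?thesis .
qed

lemma npow_second_order_bound:
  assumes x: "0 < Re x" and y: "0 < Re y" and \<eta>: "cmod (y - x) \<le> \<eta> * cmod x" "\<eta> \<le> 1 / 2" and p: "p \<ge> 0"
  shows "cmod (npow p y - npow p x + of_real p * npow (p + 1) x * (y - x))
    \<le> p * (p + 1) * 2 powr (p + 2) * \<eta>\<^sup>2 * cmod x powr (- p)"
proof -
  have x0: "cmod x > 0" using x by auto
  have "0 \<le> \<eta> * cmod x" using \<eta>(1) norm_ge_zero order_trans by blast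
  then have \<eta>0: "\<eta> \<ge> 0" using x0 by (simp add: zero_le_mult_iff)
  define B where "B = p * ((p + 1) * 2 powr (p + 2) * \<eta> * cmod x powr (- (p + 1)))"
  \<comment> \<open>Up to an additive constant this is \<open>npow p\<close> minus its linear part
    at \<open>x\<close>. Its derivative is a multiple of a difference of values of
    \<open>npow (p + 1)\<close>, to which the first order bound applies and yields the second factor
    \<open>\<eta>\<close>.\<close>
  define q where "q \<xi> = npow p \<xi> + of_real p * npow (p + 1) x * \<xi>" for \<xi>
  have "cmod (q y - q x) \<le> B * cmod (y - x)"
  proof (rule field_differentiable_bound[where S = "closed_segment x y"])
    fix \<xi> assume \<xi>: "\<xi> \<in> closed_segment x y"
    have R: "0 < Re \<xi>" by (rule segment_Re_pos[OF \<xi> x y])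
    show "(q has_field_derivative - of_real p * (npow (p + 1) \<xi> - npow (p + 1) x)) (at \<xi> within closed_segment x y)"
      unfolding q_def using npow_has_field_derivative[OF R]
      by (auto intro!: derivative_eq_intros simp: algebra_simps)
    have "cmod (npow (p + 1) \<xi> - npow (p + 1) x) \<le> (p + 1) * 2 powr (p + 1 + 1) * \<eta> * cmod x powr (- (p + 1))"
      by (rule npow_diff_bound[OF x R segment_norm_ge(1)[OF \<xi> \<eta>] \<eta>(2)]) (use p in auto)
    then show "cmod (- of_real p * (npow (p + 1) \<xi> - npow (p + 1) x)) \<le> B"
      unfolding norm_mult B_def using p by (auto intro!: mult_left_mono simp: add.assoc)
  qed auto
  also have "\<dots> \<le> B * (\<eta> * cmod x)"
    using \<eta>(1) p \<eta>0 by (intro mult_left_mono) (auto simp: B_def)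
  also have "\<dots> = p * (p + 1) * 2 powr (p + 2) * \<eta>\<^sup>2 * (cmod x powr (- p - 1) * cmod x)"
    by (simp add: B_def power2_eq_square)
  also have "cmod x powr (- p - 1) * cmod x = cmod x powr (- p)"
    using x0 by (simp add: powr_diff)
  finally show ?thesis by (simp add: q_def algebra_simps)
qed

text \<open>The coefficients of \<open>rr_lin z\<close> grow with the first coordinates of
  \<open>z\<close>, but each of these is at most \<open>R + 1 + cmod (rr z w)\<close>, and constants
  are absorbed because \<open>cmod (rr z w)\<close> is at least \<open>m / 2\<close>. The factor
  depends on \<open>w\<close> only through \<open>m\<close> and \<open>R\<close>, hence is uniform
  on compact sets.\<close>

lemma coord_sum_le_rr:
  fixes w z :: "'n::{finite,linorder} cspace"
  assumes w: "w \<in> siegel" and z: "z \<in> siegel" and m: "0 < m" "m \<le> rho w" and R: "norm w \<le> R"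
  shows "1 + (\<Sum>j\<in>UNIV - {last_ix}. cmod (z $ j))
    \<le> ((1 + real CARD('n) * (R + 1)) * (2 / m) + real CARD('n)) * cmod (rr z w)"
proof -
  define r where "r = cmod (rr z w)"
  have rm: "1 \<le> (2 / m) * r" using Re_rr_pos(3)[OF z w] m by (simp add: r_def field_simps)
  have r0: "r \<ge> 0" by (simp add: r_def)
  have R0: "R \<ge> 0" using R norm_ge_zero order_trans by blast
  have "cmod (z $ j) \<le> R + 1 + r" if "j \<noteq> last_ix" for j
  proof -
    have "(cmod (z $ j - w $ j))\<^sup>2 \<le> (\<Sum>j\<in>UNIV - {last_ix}. (cmod (z $ j - w $ j))\<^sup>2)"
      using that by (intro member_le_sum) auto
    also have "\<dots> \<le> 2 * r" using Re_rr_pos(4)[OF z w] by (simp add: r_def)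
    also have "\<dots> \<le> (1 + r)\<^sup>2" using r0 by (simp add: power2_eq_square algebra_simps)
    finally have "cmod (z $ j - w $ j) \<le> 1 + r" using r0 by (simp add: power2_le_iff_abs_le)
    then show ?thesis
      using norm_triangle_sub[of "z $ j" "w $ j"] Finite_Cartesian_Product.norm_nth_le[of w j] R by linarith
  qed
  then have "(\<Sum>j\<in>UNIV - {last_ix}. cmod (z $ j)) \<le> (\<Sum>j\<in>UNIV - {last_ix :: 'n}. R + 1 + r)"
    by (intro sum_mono) auto
  also have "\<dots> \<le> (\<Sum>j\<in>(UNIV :: 'n set). R + 1 + r)"
    using R0 r0 by (intro sum_mono2) auto
  also have "\<dots> = real CARD('n) * (R + 1) + real CARD('n) * r" by (simp add: algebra_simps)
  finally have "1 + (\<Sum>j\<in>UNIV - {last_ix}. cmod (z $ j)) \<le> (1 + real CARD('n) * (R + 1)) * 1 + real CARD('n) * r"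
    by simp
  also have "\<dots> \<le> (1 + real CARD('n) * (R + 1)) * ((2 / m) * r) + real CARD('n) * r"
    using rm R0 by (intro add_right_mono mult_left_mono) auto
  finally show ?thesis unfolding r_def by (simp only: distrib_right mult.assoc)
qed

lemma norm_rr_lin_le:
  "cmod (rr_lin z h) \<le> norm h * (1 + (\<Sum>j\<in>UNIV - {last_ix}. cmod (z $ j)))"
proof -
  have "cmod (rr_lin z h) \<le> cmod (- \<i> / 2 * h $ last_ix) + cmod (\<Sum>j\<in>UNIV - {last_ix}. h $ j * cnj (z $ j))"
    unfolding rr_lin_def by (rule norm_triangle_ineq4)
  also have "cmod (\<Sum>j\<in>UNIV - {last_ix}. h $ j * cnj (z $ j)) \<le> (\<Sum>j\<in>UNIV - {last_ix}. norm h * cmod (z $ j))"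
    by (rule sum_norm_le) (auto simp: norm_mult Finite_Cartesian_Product.norm_nth_le intro!: mult_right_mono)
  also have "cmod (- \<i> / 2 * h $ last_ix) \<le> norm h"
  proof -
    have "cmod (- \<i> / 2 * h $ last_ix) = cmod (h $ last_ix) / 2"
      by (simp add: norm_mult norm_divide)
    then show ?thesis
      using Finite_Cartesian_Product.norm_nth_le[of h last_ix] norm_ge_zero[of h] by linarith
  qed
  finally show ?thesis by (simp add: distrib_left sum_distrib_left)
qed

lemma rr_diff_le:
  fixes w z h :: "'n::{finite,linorder} cspace"
  assumes w: "w \<in> siegel" and z: "z \<in> siegel" and m: "0 < m" "m \<le> rho w" and R: "norm w \<le> R"
  shows "cmod (rr_lin z h) \<le> norm h * (((1 + real CARD('n) * (R + 1)) * (2 / m) + real CARD('n)) * cmod (rr z w))"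
  by (rule order_trans[OF norm_rr_lin_le mult_left_mono[OF coord_sum_le_rr[OF assms]]]) simp

lemma compact_siegel_bounds:
  assumes K: "compact K" "K \<subseteq> siegel"
  obtains m R where "m > 0" "\<And>w. w \<in> K \<Longrightarrow> m \<le> rho w" "\<And>w. w \<in> K \<Longrightarrow> norm w \<le> R"
proof -
  obtain R where R: "\<And>w. w \<in> K \<Longrightarrow> norm w \<le> R"
    using compact_imp_bounded[OF K(1)] bounded_iff by metis
  show ?thesis
  proof (cases "K = {}")
    case True then show ?thesis using that[of 1 R] by simp
  next
    case False
    then obtain w0 where "w0 \<in> K" "\<And>w. w \<in> K \<Longrightarrow> rho w0 \<le> rho w"
      using continuous_attains_inf[OF K(1) _ continuous_on_rho] by blast
    then show ?thesis using that[of "rho w0" R] R K(2) by (auto simp: siegel_def)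
  qed
qed

text \<open>By \<open>rr_diff_le\<close> a small displacement of \<open>w\<close> changes
  \<open>rr\<close> by a small fraction of its modulus, uniformly in \<open>z\<close>, and
  \<open>npow_diff_bound\<close> turns this into a small relative change of the power.\<close>

lemma ker_close:
  fixes K :: "'n::{finite,linorder} cspace set"
  assumes K: "compact K" "K \<subseteq> siegel" and p: "p \<ge> 0" and \<epsilon>: "\<epsilon> > 0"
  shows "\<exists>\<delta>>0. \<forall>w\<in>K. \<forall>v\<in>siegel. \<forall>z\<in>siegel. dist w v < \<delta> \<longrightarrow>
    cmod (ker p z v - ker p z w) \<le> \<epsilon> * cmod (ker p z w)"
proof -
  obtain m R where mR: "m > 0" "\<And>w. w \<in> K \<Longrightarrow> m \<le> rho w" "\<And>w. w \<in> K \<Longrightarrow> norm w \<le> R"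
    using compact_siegel_bounds[OF K] by blast
  define R' where "R' = max R 0"
  define C where "C = (1 + real CARD('n) * (R' + 1)) * (2 / m) + real CARD('n)"
  have C: "C > 0" using mR(1) by (auto simp: C_def R'_def intro!: add_pos_nonneg mult_pos_pos divide_pos_pos)
  define A where "A = p * 2 powr (p + 1)"
  have A: "A \<ge> 0" using p by (simp add: A_def)
  define \<eta> where "\<eta> = min (1 / 2) (\<epsilon> / (A + 1))"
  have \<eta>: "\<eta> > 0" "\<eta> \<le> 1 / 2"
    using \<epsilon> A unfolding \<eta>_def by (simp, intro min.cobounded1)
  have A\<eta>: "A * \<eta> \<le> \<epsilon>"
  proof -
    have "A * \<eta> \<le> (A + 1) * (\<epsilon> / (A + 1))" using A \<eta> by (intro mult_mono) (auto simp: \<eta>_def)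
    then show ?thesis using A by simp
  qed
  have "cmod (ker p z v - ker p z w) \<le> \<epsilon> * cmod (ker p z w)"
    if w: "w \<in> K" and v: "v \<in> siegel" and z: "z \<in> siegel" and d: "dist w v < \<eta> / C" for w v z
  proof -
    have wU: "w \<in> siegel" using w K by auto
    have "rr v z = rr w z + rr_lin z (v - w)"
      using rr_add[of w "v - w" z] by simp
    then have "cmod (rr v z - rr w z) = cmod (rr_lin z (v - w))" by simp
    also have "\<dots> \<le> norm (v - w) * (C * cmod (rr z w))"
      unfolding C_def using mR(3)[OF w] by (intro rr_diff_le[OF wU z mR(1) mR(2)[OF w]]) (simp add: R'_def)
    also have "\<dots> \<le> \<eta> / C * (C * cmod (rr z w))"
      using d C by (intro mult_right_mono) (auto simp: dist_norm norm_minus_commute)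
    also have "\<dots> = \<eta> * cmod (rr w z)" using C rr_cnj[of w z] by simp
    finally have le: "cmod (rr v z - rr w z) \<le> \<eta> * cmod (rr w z)" .
    have "cmod (ker p v z - ker p w z) \<le> p * 2 powr (p + 1) * \<eta> * cmod (rr w z) powr (- p)"
      unfolding ker_npow by (rule npow_diff_bound[OF Re_rr_pos(1)[OF wU z] Re_rr_pos(1)[OF v z] le \<eta>(2) p])
    also have "\<dots> = A * \<eta> * cmod (ker p w z)" by (simp add: norm_ker[OF wU z] A_def)
    also have "\<dots> \<le> \<epsilon> * cmod (ker p w z)" using A\<eta> by (rule mult_right_mono) simp
    finally have "cmod (ker p v z - ker p w z) \<le> \<epsilon> * cmod (ker p w z)" .
    \<comment> \<open>The displacement was estimated in the first argument, where \<open>rr\<close>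
      is affine; conjugate symmetry moves it to the second.\<close>
    moreover have "ker p v z - ker p w z = cnj (ker p z v - ker p z w)"
      using ker_cnj[OF z v, of p] ker_cnj[OF z wU, of p] by simp
    ultimately show ?thesis using ker_cnj[OF z wU, of p] by (simp only: complex_mod_cnj)
  qed
  moreover have "\<eta> / C > 0" using \<eta> C by simp
  ultimately show ?thesis by blast
qed

text \<open>The factor \<open>rho z\<close> cancels one power of \<open>cmod (rr z w)\<close>, and
  the remaining nonpositive power is largest at the lower bound \<open>rho w / 2\<close>.\<close>

lemma rho_ker_le:
  assumes z: "z \<in> siegel" and w: "w \<in> siegel" and p: "p \<ge> 1"
  shows "rho z * cmod (ker p z w) \<le> 2 * (rho w / 2) powr (1 - p)"
proof -
  have r0: "cmod (rr z w) > 0" using rr_nonzero[OF z w] by simp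
  have "rho z * cmod (ker p z w) \<le> (2 * cmod (rr z w)) * cmod (rr z w) powr (- p)"
    unfolding norm_ker[OF z w] using Re_rr_pos(2)[OF z w] by (rule mult_right_mono) simp
  also have "\<dots> = 2 * cmod (rr z w) powr (1 - p)"
    using r0 by (simp add: powr_diff powr_minus field_simps)
  also have "\<dots> \<le> 2 * (rho w / 2) powr (1 - p)"
    using Re_rr_pos(3)[OF z w] w p by (intro mult_left_mono powr_mono2') (auto simp: siegel_def)
  finally show ?thesis .
qed

section \<open>Kernel integrals and the reproducing formula for the weighted measure\<close>

lemma space_dV [simp]: "space (dV lam) = siegel"
  by (simp add: dV_def space_restrict_space)

lemma sets_dV: "sets (dV lam) = sets (restrict_space borel siegel)"
  by (simp add: dV_def sets_restrict_space)

lemma measurable_dV_restrict: "borel_measurable (dV lam) = borel_measurable (restrict_space borel siegel)"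
  by (rule measurable_cong_sets) (simp_all add: sets_dV)

lemma measurable_dV_continuous:
  fixes f :: "'n::{finite,linorder} cspace \<Rightarrow> 'b::{second_countable_topology,real_normed_vector}"
  shows "continuous_on siegel f \<Longrightarrow> f \<in> borel_measurable (dV lam)"
  unfolding measurable_dV_restrict by (rule borel_measurable_continuous_on_restrict)

lemma c_lam_pos: "lam > - 1 \<Longrightarrow> c_lam TYPE('n::{finite,linorder}) lam > 0"
  unfolding c_lam_def by (intro divide_pos_pos mult_pos_pos Gamma_real_pos) auto

lemma dV_lborel:
  fixes f :: "'n::{finite,linorder} cspace \<Rightarrow> 'b::{banach,second_countable_topology}"
  assumes lam: "lam > - 1" and f: "f \<in> borel_measurable (dV lam)"
  shows "(\<integral>\<^sup>+w. ennreal (norm (f w)) \<partial>dV lam)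
      = (\<integral>\<^sup>+w. ennreal (c_lam TYPE('n) lam * rho w powr lam * norm (f w)) * indicator siegel w \<partial>lborel)"
    and "integrable (dV lam) f \<longleftrightarrow> integrable lborel (\<lambda>w. indicator siegel w *\<^sub>R ((c_lam TYPE('n) lam * rho w powr lam) *\<^sub>R f w))"
    and "integral\<^sup>L (dV lam) f = (\<integral>w. indicator siegel w *\<^sub>R ((c_lam TYPE('n) lam * rho w powr lam) *\<^sub>R f w) \<partial>lborel)"
proof -
  let ?M = "restrict_space lborel siegel :: 'n cspace measure"
  let ?c = "c_lam TYPE('n) lam"
  have c: "0 \<le> ?c * rho w powr lam" for w :: "'n cspace" using c_lam_pos[OF lam, where 'n = 'n] by simp
  have sM: "borel_measurable ?M = borel_measurable (restrict_space borel siegel)"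
    by (rule measurable_cong_sets) (simp_all add: sets_restrict_space)
  have f' [measurable]: "f \<in> borel_measurable ?M"
    using f by (simp add: measurable_dV_restrict sM)
  have w [measurable]: "(\<lambda>w. ?c * rho w powr lam) \<in> borel_measurable ?M"
    unfolding sM by (rule measurable_restrict_space1) measurable
  have S: "siegel \<inter> space lborel \<in> sets lborel" by simp
  show "(\<integral>\<^sup>+w. ennreal (norm (f w)) \<partial>dV lam)
      = (\<integral>\<^sup>+w. ennreal (?c * rho w powr lam * norm (f w)) * indicator siegel w \<partial>lborel)"
    unfolding dV_def
    by (subst nn_integral_density, measurable, subst nn_integral_restrict_space[OF S])
      (auto intro!: nn_integral_cong simp: ennreal_mult'')
  show "integrable (dV lam) f \<longleftrightarrow> integrable lborel (\<lambda>w. indicator siegel w *\<^sub>R ((?c * rho w powr lam) *\<^sub>R f w))"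
    unfolding dV_def using c by (subst integrable_density) (auto simp: integrable_restrict_space[OF S])
  show "integral\<^sup>L (dV lam) f = (\<integral>w. indicator siegel w *\<^sub>R ((?c * rho w powr lam) *\<^sub>R f w) \<partial>lborel)"
    unfolding dV_def using c by (subst integral_density) (auto simp: integral_restrict_space[OF S])
qed

definition FRv :: "'n::{finite,linorder} itself \<Rightarrow> real \<Rightarrow> real" where
  "FRv T lam = c_lam T lam * FRc T lam"

definition repc :: "'n::{finite,linorder} itself \<Rightarrow> real \<Rightarrow> real" where
  "repc T lam = c_lam T lam * ballc T (lam + 1)"

lemma repc_pos: "lam > - 1 \<Longrightarrow> repc TYPE('n::{finite,linorder}) lam > 0"
  using c_lam_pos[where 'n = 'n] ballc_pos[of "lam + 1", where 'n = 'n] by (simp add: repc_def)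

lemma FRv_nonneg: "lam > - 1 \<Longrightarrow> FRv TYPE('n::{finite,linorder}) lam \<ge> 0"
  using c_lam_pos[of lam, where 'n = 'n] by (simp add: FRv_def FRc_def)

lemma ker_integral_dV:
  fixes z :: "'n::{finite,linorder} cspace"
  assumes lam: "lam > - 1" and z: "z \<in> siegel"
  defines "p \<equiv> real CARD('n) + 2 + lam"
  shows "integrable (dV lam) (ker p z)" "(\<integral>w. cmod (ker p z w) \<partial>dV lam) = FRv TYPE('n) lam / rho z"
proof -
  let ?c = "c_lam TYPE('n) lam"
  have c: "?c > 0" by (rule c_lam_pos[OF lam])
  have r: "rho z > 0" using z by (simp add: siegel_def)
  have m: "ker p z \<in> borel_measurable (dV lam)"
    by (rule measurable_dV_continuous[OF continuous_on_ker(1)[OF z]])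
  have "(\<integral>\<^sup>+w. ennreal (norm (ker p z w)) \<partial>dV lam)
      = (\<integral>\<^sup>+w. ennreal ?c * (ennreal (rho w powr lam * cmod (rr z w) powr (- (real CARD('n) + 2 + lam))) * indicator siegel w) \<partial>lborel)"
    unfolding dV_lborel(1)[OF lam m]
    using c by (intro nn_integral_cong) (auto simp: indicator_def norm_ker[OF z] p_def ennreal_mult[symmetric] mult.assoc)
  also have "\<dots> = ennreal ?c * ennreal (FRc TYPE('n) lam / rho z)"
    by (subst nn_integral_cmult) (measurable, simp only: forelli_rudin[OF lam z])
  also have "\<dots> = ennreal (FRv TYPE('n) lam / rho z)"
    using c r by (simp add: ennreal_mult[symmetric] FRv_def FRc_def)
  finally have nn: "(\<integral>\<^sup>+w. ennreal (norm (ker p z w)) \<partial>dV lam) = ennreal (FRv TYPE('n) lam / rho z)" .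
  show "integrable (dV lam) (ker p z)"
    using m by (rule integrableI_bounded) (simp add: nn)
  show "(\<integral>w. cmod (ker p z w) \<partial>dV lam) = FRv TYPE('n) lam / rho z"
    by (rule integral_eq_nn_integral[THEN trans]) (use m nn r FRv_nonneg[OF lam, where 'n = 'n] in auto)
qed

text \<open>The exponent \<open>n + 2 + lam\<close> is that of \<open>reproducing\<close> for the
  weight \<open>lam + 1\<close>: one power of \<open>rho\<close> stands in the integrand, as in the
  pairing, and the rest belongs to \<open>dV lam\<close>.\<close>

lemma reproducing_dV:
  fixes u :: "'n::{finite,linorder} cspace \<Rightarrow> complex"
  assumes lam: "lam > - 1" and z: "z \<in> siegel" and u: "continuous_on siegel u" "holo_along_curves u"
  defines "p \<equiv> real CARD('n) + 2 + lam"
  assumes int: "integrable (dV lam) (\<lambda>w. of_real (rho w) * u w * ker p z w)"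
  shows "(\<integral>w. of_real (rho w) * u w * ker p z w \<partial>dV lam) = of_real (repc TYPE('n) lam) * u z"
proof -
  let ?c = "c_lam TYPE('n) lam"
  have c: "?c > 0" by (rule c_lam_pos[OF lam])
  have p: "p = real CARD('n) + 1 + (lam + 1)" by (simp add: p_def)
  have m: "(\<lambda>w. of_real (rho w) * u w * ker p z w) \<in> borel_measurable (dV lam)"
    using int by simp
  have eq: "indicator siegel w *\<^sub>R ((?c * rho w powr lam) *\<^sub>R (of_real (rho w) * u w * ker p z w))
    = ?c *\<^sub>R (indicator siegel w *\<^sub>R (u w * of_real (rho w powr (lam + 1)) * ker p z w))" for w
    by (cases "w \<in> siegel") (auto simp: siegel_def powr_add scaleR_conv_of_real)
  have i: "integrable lborel (\<lambda>w. ?c *\<^sub>R (indicator siegel w *\<^sub>R (u w * of_real (rho w powr (lam + 1)) * ker p z w)))"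
    using int unfolding dV_lborel(2)[OF lam m] eq .
  then have "integrable lborel (\<lambda>w. indicator siegel w *\<^sub>R (u w * of_real (rho w powr (lam + 1)) * ker p z w))"
    using integrable_scaleR_right[of "1 / ?c", OF i] c by simp
  then have "(\<integral>w. indicator siegel w *\<^sub>R (u w * of_real (rho w powr (lam + 1)) * ker p z w) \<partial>lborel) = of_real (ballc TYPE('n) (lam + 1)) * u z"
    unfolding p by (intro reproducing z u) (use lam in auto)
  then show ?thesis
    unfolding dV_lborel(3)[OF lam m] eq by (simp add: repc_def scaleR_conv_of_real)
qed

section \<open>Functionals on the little Bloch space\<close>

lemma finite_cover_disjoint:
  assumes "finite X" "\<And>x. x \<in> X \<Longrightarrow> A x \<in> sets M"
  shows "\<exists>E. (\<forall>x\<in>X. E x \<in> sets M \<and> E x \<subseteq> A x) \<and> disjoint_family_on E X \<and> (\<Union>x\<in>X. E x) = (\<Union>x\<in>X. A x)"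
    using assms
  proof (induction X rule: finite_induct)
    case empty
    show ?case by (auto simp: disjoint_family_on_def)
  next
    case (insert y X)
    then obtain E where E: "\<forall>x\<in>X. E x \<in> sets M \<and> E x \<subseteq> A x" "disjoint_family_on E X" "(\<Union>x\<in>X. E x) = (\<Union>x\<in>X. A x)"
      by auto
    define E' where "E' = E(y := A y - (\<Union>x\<in>X. E x))"
    have eq: "E' x = E x" if "x \<in> X" for x using that insert.hyps by (auto simp: E'_def)
    have "(\<Union>x\<in>X. E x) \<in> sets M" using E(1) insert.hyps by (intro sets.finite_UN) auto
    then have "\<forall>x\<in>insert y X. E' x \<in> sets M \<and> E' x \<subseteq> A x"
      using E(1) eq insert.prems by (auto simp: E'_def)
    moreover have "disjoint_family_on E' (insert y X)"
      unfolding disjoint_family_on_insert[OF insert.hyps(2)]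
      using E(2) eq by (auto simp: disjoint_family_on_def E'_def)
    moreover have "(\<Union>x\<in>insert y X. E' x) = (\<Union>x\<in>insert y X. A x)"
    proof -
      have "(\<Union>x\<in>X. E' x) = (\<Union>x\<in>X. E x)" using eq by auto
      then show ?thesis using E(3) by (auto simp: E'_def)
    qed
    ultimately show ?case by blast
  qed

text \<open>The index \<open>x\<close> serves as sample point of \<open>E x\<close>. After the
  pieces have been made disjoint it need not lie in its own piece, so closeness is recorded as
  \<open>dist w x < \<delta>\<close> for all \<open>w\<close> in \<open>E x\<close>.\<close>

lemma compact_small_partition:
  fixes K :: "'a::metric_space set"
  assumes K: "compact K" and \<delta>: "\<delta> > 0"
  shows "\<exists>X E. finite X \<and> X \<subseteq> K \<and> (\<forall>x\<in>X. E x \<in> sets borel \<and> (\<forall>w\<in>E x. dist w x < \<delta>))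
    \<and> disjoint_family_on E X \<and> (\<Union>x\<in>X. E x) = K"
proof -
  have "K \<subseteq> (\<Union>x\<in>K. ball x \<delta>)" using \<delta> by auto
  then obtain X where X: "X \<subseteq> K" "finite X" "K \<subseteq> (\<Union>x\<in>X. ball x \<delta>)"
    by (rule compactE_image[OF K open_ball])
  have bor: "K \<inter> ball x \<delta> \<in> sets borel" for x
    using compact_imp_closed[OF K] by auto
  from finite_cover_disjoint[of X "\<lambda>x. K \<inter> ball x \<delta>", OF X(2) bor]
  obtain E where E: "\<forall>x\<in>X. E x \<in> sets borel \<and> E x \<subseteq> K \<inter> ball x \<delta>"
    "disjoint_family_on E X" "(\<Union>x\<in>X. E x) = (\<Union>x\<in>X. K \<inter> ball x \<delta>)"
    by (elim exE conjE) (rule that)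
  have "\<forall>w\<in>E x. dist w x < \<delta>" if "x \<in> X" for x
  proof
    fix w assume "w \<in> E x"
    then have "w \<in> ball x \<delta>" using E(1) that by blast
    then show "dist w x < \<delta>" by (simp add: dist_commute)
  qed
  moreover have "(\<Union>x\<in>X. E x) = K" unfolding E(3) using X(3) by auto
  ultimately show ?thesis using X(1,2) E(1,2)
    by (intro exI[of _ X] exI[of _ E]) simp
qed

lemma sum_indicator_partition:
  fixes f :: "'a \<Rightarrow> 'b::real_vector"
  assumes X: "finite X" and E: "disjoint_family_on E X"
  shows "x \<in> X \<Longrightarrow> w \<in> E x \<Longrightarrow> (\<Sum>x\<in>X. indicator (E x) w *\<^sub>R f x) = f x"
    and "w \<notin> (\<Union>x\<in>X. E x) \<Longrightarrow> (\<Sum>x\<in>X. indicator (E x) w *\<^sub>R f x) = 0"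
proof -
  assume x: "x \<in> X" "w \<in> E x"
  have "indicator (E y) w *\<^sub>R f y = (if y = x then f x else 0)" if "y \<in> X" for y
    using x that E by (auto simp: disjoint_family_on_def indicator_def)
  then have "(\<Sum>y\<in>X. indicator (E y) w *\<^sub>R f y) = (\<Sum>y\<in>X. if y = x then f x else 0)"
    by (intro sum.cong) auto
  then show "(\<Sum>x\<in>X. indicator (E x) w *\<^sub>R f x) = f x" using x X by simp
next
  assume "w \<notin> (\<Union>x\<in>X. E x)"
  then show "(\<Sum>x\<in>X. indicator (E x) w *\<^sub>R f x) = 0"
    by (intro sum.neutral) auto
qed

lemma sets_dV_subset: "A \<in> sets borel \<Longrightarrow> A \<subseteq> siegel \<Longrightarrow> A \<in> sets (dV lam)"
  unfolding sets_dV by (auto simp: sets_restrict_space)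

text \<open>Chebyshev's inequality: the kernel at \<open>base_pt\<close> is integrable, and being
  continuous without zeros it is bounded below on \<open>K\<close>.\<close>

lemma emeasure_dV_compact:
  fixes K :: "'n::{finite,linorder} cspace set"
  assumes lam: "lam > - 1" and K: "compact K" "K \<subseteq> siegel"
  shows "K \<in> sets (dV lam)" "emeasure (dV lam) K < \<infinity>"
proof -
  show KM: "K \<in> sets (dV lam)"
    using compact_imp_closed[OF K(1)] by (intro sets_dV_subset K(2)) auto
  define p where "p = real CARD('n) + 2 + lam"
  obtain d where d: "d > 0" "\<And>w. w \<in> K \<Longrightarrow> d \<le> cmod (ker p base_pt w)"
  proof (cases "K = {}")
    case False
    have "continuous_on K (\<lambda>w. cmod (ker p base_pt w))"
      using K(2) by (intro continuous_on_norm continuous_on_subset[OF continuous_on_ker(1)[OF base_pt_in_siegel]])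
    then obtain w0 where "w0 \<in> K" "\<And>w. w \<in> K \<Longrightarrow> cmod (ker p base_pt w0) \<le> cmod (ker p base_pt w)"
      using continuous_attains_inf[OF K(1) False] by blast
    then show ?thesis using that[of "cmod (ker p base_pt w0)"] by (simp add: ker_def)
  qed (use that[of 1] in simp)
  have i: "integrable (dV lam) (ker p (base_pt :: 'n cspace))"
    unfolding p_def by (rule ker_integral_dV(1)[OF lam base_pt_in_siegel])
  have "ennreal d * emeasure (dV lam) K = (\<integral>\<^sup>+w. ennreal d * indicator K w \<partial>dV lam)"
    by (rule nn_integral_cmult_indicator[OF KM, symmetric])
  also have "\<dots> \<le> (\<integral>\<^sup>+w. ennreal (norm (ker p (base_pt :: 'n cspace) w)) \<partial>dV lam)"
    using d by (intro nn_integral_mono) (auto simp: indicator_def intro!: ennreal_leI)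
  also have "\<dots> < \<infinity>" using i by (simp add: integrable_iff_bounded)
  finally show "emeasure (dV lam) K < \<infinity>"
    using d(1) by (auto simp: ennreal_mult_less_top ennreal_mult_eq_top_iff less_top[symmetric])
qed

text \<open>Keeps the bound \<open>B\<close> explicit and nonnegative and imposes nothing outside
  \<open>bloch0\<close>, so that one set of estimates serves both elements of the dual and pairings,
  whose bound is an \<open>A1_norm\<close>.\<close>

definition bloch0_functional :: "real \<Rightarrow> (('n::{finite,linorder} cspace \<Rightarrow> complex) \<Rightarrow> complex) \<Rightarrow> bool" where
  "bloch0_functional B \<Phi> \<longleftrightarrow>
     (\<forall>f\<in>bloch0. \<forall>g\<in>bloch0. \<forall>a b. \<Phi> (\<lambda>z. a * f z + b * g z) = a * \<Phi> f + b * \<Phi> g)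
     \<and> (\<forall>f\<in>bloch0. cmod (\<Phi> f) \<le> B * bloch_norm f) \<and> 0 \<le> B"

text \<open>In this form a functional is controlled by a supremum of \<open>rho\<close> times the
  last derivative, which kernel integrals can bound.\<close>

lemma bloch0_functional_bound:
  fixes f :: "'n::{finite,linorder} cspace \<Rightarrow> complex"
  assumes "bloch0_functional B \<Phi>" "f \<in> bloch0"
    and "\<And>w. w \<in> siegel \<Longrightarrow> rho w * cmod (cpartial last_ix f w) \<le> M"
  shows "cmod (\<Phi> f) \<le> B * (bloch_const TYPE('n) * M)"
proof -
  have "cmod (\<Phi> f) \<le> B * bloch_norm f" using assms by (simp add: bloch0_functional_def)
  also have "\<dots> \<le> B * (bloch_const TYPE('n) * M)"
    using assms by (intro mult_left_mono bloch_norm_le_last) (auto simp: bloch0_functional_def bloch0_iff)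
  finally show ?thesis .
qed

lemma bloch0_functional_sum:
  fixes \<Phi> :: "('n::{finite,linorder} cspace \<Rightarrow> complex) \<Rightarrow> complex"
  assumes \<Phi>: "bloch0_functional B \<Phi>" and s: "s > 0" and X: "finite X" "X \<subseteq> siegel"
  shows "(\<lambda>z. \<Sum>x\<in>X. a x * kfun s x z) \<in> bloch0"
    and "\<Phi> (\<lambda>z. \<Sum>x\<in>X. a x * kfun s x z) = (\<Sum>x\<in>X. a x * \<Phi> (kfun s x))"
    and "z \<in> siegel \<Longrightarrow> cpartial last_ix (\<lambda>z. \<Sum>x\<in>X. a x * kfun s x z) z = (\<Sum>x\<in>X. a x * ker (s + 1) z x)"
proof -
  have lin: "\<Phi> (\<lambda>z. a * f z + b * g z) = a * \<Phi> f + b * \<Phi> g" if "f \<in> bloch0" "g \<in> bloch0" for f g a b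
    using \<Phi> that by (simp add: bloch0_functional_def)
  have h: "holomorphic_Cn_on f siegel" if "f \<in> bloch0" for f :: "'n cspace \<Rightarrow> complex"
    using that by (simp add: bloch0_iff bloch_def holo_siegel_def)
  have "(\<lambda>z. \<Sum>x\<in>X. a x * kfun s x z) \<in> bloch0
    \<and> \<Phi> (\<lambda>z. \<Sum>x\<in>X. a x * kfun s x z) = (\<Sum>x\<in>X. a x * \<Phi> (kfun s x))
    \<and> (\<forall>z\<in>siegel. cpartial last_ix (\<lambda>z. \<Sum>x\<in>X. a x * kfun s x z) z = (\<Sum>x\<in>X. a x * ker (s + 1) z x))"
    using X
  proof (induction X rule: finite_induct)
    case empty
    have k: "kfun s base_pt \<in> (bloch0 :: ('n cspace \<Rightarrow> complex) set)" by (rule kfun_bloch0[OF base_pt_in_siegel s])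
    have "(\<lambda>z. 0) \<in> (bloch0 :: ('n cspace \<Rightarrow> complex) set)"
      using bloch0_combine[OF k k, of 0 0] by simp
    moreover have "\<Phi> (\<lambda>z. 0) = 0" using lin[OF k k, of 0 0] by simp
    ultimately show ?case by (simp add: cpartial_def)
  next
    case (insert y X)
    have y: "y \<in> siegel" using insert.prems by simp
    have k: "kfun s y \<in> bloch0" by (rule kfun_bloch0[OF y s])
    let ?f = "\<lambda>z. \<Sum>x\<in>X. a x * kfun s x z"
    have f: "?f \<in> bloch0" using insert by simp
    have eq: "(\<lambda>z. \<Sum>x\<in>insert y X. a x * kfun s x z) = (\<lambda>z. a y * kfun s y z + 1 * ?f z)"
      using insert.hyps by simp
    have "\<Phi> (\<lambda>z. a y * kfun s y z + 1 * ?f z) = a y * \<Phi> (kfun s y) + 1 * \<Phi> ?f" by (rule lin[OF k f])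
    moreover have "cpartial last_ix (\<lambda>z. a y * kfun s y z + 1 * ?f z) z = (\<Sum>x\<in>insert y X. a x * ker (s + 1) z x)"
      if z: "z \<in> siegel" for z
      using Lop_combine[OF h[OF k] h[OF f] z, of last_ix "a y" 1] insert z
      by (simp add: Lop_last cpartial_last_kfun[OF z y s])
    ultimately show ?case
      unfolding eq using bloch0_combine[OF k f, of "a y" 1] insert by auto
  qed
  then show "(\<lambda>z. \<Sum>x\<in>X. a x * kfun s x z) \<in> bloch0"
    "\<Phi> (\<lambda>z. \<Sum>x\<in>X. a x * kfun s x z) = (\<Sum>x\<in>X. a x * \<Phi> (kfun s x))"
    "z \<in> siegel \<Longrightarrow> cpartial last_ix (\<lambda>z. \<Sum>x\<in>X. a x * kfun s x z) z = (\<Sum>x\<in>X. a x * ker (s + 1) z x)"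
    by auto
qed

lemma bloch_const_pos: "bloch_const T > 0"
  by (simp add: bloch_const_def add_nonneg_pos)

text \<open>\<open>kfun s w\<close> depends continuously on \<open>w\<close> in the Bloch norm:
  \<open>ker_close\<close> for the set containing only \<open>w\<close> bounds the change of the
  last derivative relative to the kernel, and \<open>rho_ker_le\<close> bounds \<open>rho\<close>
  times the kernel.\<close>

lemma functional_kfun_continuous:
  fixes \<Phi> :: "('n::{finite,linorder} cspace \<Rightarrow> complex) \<Rightarrow> complex"
  assumes \<Phi>: "bloch0_functional B \<Phi>" and s: "s > 0"
  shows "continuous_on siegel (\<lambda>w. \<Phi> (kfun s w))"
  unfolding continuous_on_iff
proof (intro ballI allI impI)
  fix w :: "'n cspace" and e :: real assume w: "w \<in> siegel" and e: "e > 0"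
  have B: "B \<ge> 0" using \<Phi> by (simp add: bloch0_functional_def)
  define N where "N = B * bloch_const TYPE('n) * (2 * (rho w / 2) powr (1 - (s + 1)))"
  have N: "N \<ge> 0" using B bloch_const_pos[of "TYPE('n)"] by (simp add: N_def)
  define \<epsilon> where "\<epsilon> = e / (N + 1)"
  have \<epsilon>: "\<epsilon> > 0" using e N by (simp add: \<epsilon>_def)
  have "\<exists>\<delta>>0. \<forall>w'\<in>{w}. \<forall>v\<in>siegel. \<forall>z\<in>siegel. dist w' v < \<delta> \<longrightarrow>
      cmod (ker (s + 1) z v - ker (s + 1) z w') \<le> \<epsilon> * cmod (ker (s + 1) z w')"
    by (rule ker_close) (use w s \<epsilon> in auto)
  then obtain \<delta> where \<delta>: "\<delta> > 0" "\<forall>v\<in>siegel. \<forall>z\<in>siegel. dist w v < \<delta> \<longrightarrow>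
      cmod (ker (s + 1) z v - ker (s + 1) z w) \<le> \<epsilon> * cmod (ker (s + 1) z w)"
    by blast
  have "dist (\<Phi> (kfun s v)) (\<Phi> (kfun s w)) < e" if v: "v \<in> siegel" and d: "dist v w < \<delta>" for v
  proof -
    have k: "kfun s v \<in> bloch0" "kfun s w \<in> bloch0" by (auto intro: kfun_bloch0 v w s)
    let ?f = "\<lambda>z. 1 * kfun s v z + (- 1) * kfun s w z"
    have f: "?f \<in> bloch0" by (rule bloch0_combine[OF k])
    have h: "holomorphic_Cn_on (kfun s v) siegel" "holomorphic_Cn_on (kfun s w) siegel"
      using k by (simp_all add: bloch0_iff bloch_def holo_siegel_def)
    have "rho z * cmod (cpartial last_ix ?f z) \<le> \<epsilon> * (2 * (rho w / 2) powr (1 - (s + 1)))" if z: "z \<in> siegel" for z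
    proof -
      have "cpartial last_ix ?f z = ker (s + 1) z v - ker (s + 1) z w"
        using Lop_combine[OF h z, of last_ix 1 "- 1"] by (simp add: Lop_last cpartial_last_kfun z v w s)
      then have "rho z * cmod (cpartial last_ix ?f z) \<le> rho z * (\<epsilon> * cmod (ker (s + 1) z w))"
        using \<delta>(2) v d z by (intro mult_left_mono) (auto simp: dist_commute siegel_def)
      also have "\<dots> = \<epsilon> * (rho z * cmod (ker (s + 1) z w))" by simp
      also have "\<dots> \<le> \<epsilon> * (2 * (rho w / 2) powr (1 - (s + 1)))"
        using rho_ker_le[OF z w, of "s + 1"] s \<epsilon> by (intro mult_left_mono) auto
      finally show ?thesis .
    qed
    from bloch0_functional_bound[OF \<Phi> f this]
    have "cmod (\<Phi> ?f) \<le> \<epsilon> * N" by (simp add: N_def mult_ac)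
    also have "\<dots> < e" using N e by (simp add: \<epsilon>_def field_simps)
    finally have "cmod (\<Phi> ?f) < e" .
    moreover have "\<Phi> ?f = 1 * \<Phi> (kfun s v) + (- 1) * \<Phi> (kfun s w)"
      using \<Phi> k unfolding bloch0_functional_def by blast
    ultimately show ?thesis by (simp add: dist_norm)
  qed
  then show "\<exists>d>0. \<forall>x'\<in>siegel. dist x' w < d \<longrightarrow> dist (\<Phi> (kfun s x')) (\<Phi> (kfun s w)) < e"
    using \<delta>(1) by blast
qed

text \<open>The bound does not involve \<open>K\<close>, which the later exhaustion relies on. The
  measure of \<open>K\<close> occurs only in the error of the Riemann sum for the integral of the
  modulus, and this error tends to 0 with \<open>\<epsilon>\<close>.\<close>

lemma functional_kfun_L1_compact:
  fixes \<Phi> :: "('n::{finite,linorder} cspace \<Rightarrow> complex) \<Rightarrow> complex"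
  assumes lam: "lam > - 1" and \<Phi>: "bloch0_functional B \<Phi>"
    and K: "compact K" "K \<subseteq> siegel"
  defines "s \<equiv> real CARD('n) + 1 + lam"
  shows "(\<integral>w. indicator K w * cmod (\<Phi> (kfun s w)) \<partial>dV lam) \<le> B * (bloch_const TYPE('n) * (2 * FRv TYPE('n) lam))"
proof -
  let ?M = "dV lam :: 'n cspace measure"
  define \<gamma> where "\<gamma> w = \<Phi> (kfun s w)" for w
  have s: "s > 0" using lam by (simp add: s_def)
  have p: "s + 1 = real CARD('n) + 2 + lam" by (simp add: s_def)
  have B: "B \<ge> 0" using \<Phi> by (simp add: bloch0_functional_def)
  have \<gamma>: "continuous_on siegel \<gamma>" unfolding \<gamma>_def by (rule functional_kfun_continuous[OF \<Phi> s])
  have \<gamma>K: "continuous_on K \<gamma>" using \<gamma> K(2) by (rule continuous_on_subset)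
  note KM = emeasure_dV_compact[OF lam K]
  let ?\<mu> = "measure ?M"
  have step: "(\<integral>w. indicator K w * cmod (\<gamma> w) \<partial>?M) \<le> B * (bloch_const TYPE('n) * (2 * FRv TYPE('n) lam)) + \<epsilon> * ?\<mu> K"
    if \<epsilon>: "\<epsilon> > 0" for \<epsilon>
  proof -
    \<comment> \<open>Relative error 1 is enough here: on each piece the kernel at the sample point
      is at most twice the kernel at \<open>w\<close>, the source of the factor 2 in the
      bound.\<close>
    have "\<exists>\<delta>>0. \<forall>w\<in>K. \<forall>v\<in>siegel. \<forall>z\<in>siegel. dist w v < \<delta> \<longrightarrow>
        cmod (ker (s + 1) z v - ker (s + 1) z w) \<le> 1 * cmod (ker (s + 1) z w)"
      by (rule ker_close[OF K]) (use s in auto)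
    then obtain \<delta>1 where \<delta>1: "\<delta>1 > 0" "\<forall>w\<in>K. \<forall>v\<in>siegel. \<forall>z\<in>siegel. dist w v < \<delta>1 \<longrightarrow>
        cmod (ker (s + 1) z v - ker (s + 1) z w) \<le> 1 * cmod (ker (s + 1) z w)"
      by blast
    obtain \<delta>2 where \<delta>2: "\<delta>2 > 0" "\<forall>w\<in>K. \<forall>v\<in>K. dist v w < \<delta>2 \<longrightarrow> dist (\<gamma> v) (\<gamma> w) < \<epsilon>"
      using compact_uniformly_continuous[OF \<gamma>K K(1)] \<epsilon> unfolding uniformly_continuous_on_def by blast
    have m: "min \<delta>1 \<delta>2 > 0" using \<delta>1(1) \<delta>2(1) by simp
    from compact_small_partition[OF K(1) m]
    obtain X E where XE: "finite X" "X \<subseteq> K" "\<forall>x\<in>X. E x \<in> sets borel \<and> (\<forall>w\<in>E x. dist w x < min \<delta>1 \<delta>2)"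
        "disjoint_family_on E X" "(\<Union>x\<in>X. E x) = K"
      by (elim exE conjE) (rule that)
    have X: "finite X" "X \<subseteq> K" "\<And>x. x \<in> X \<Longrightarrow> E x \<in> sets borel"
      "\<And>x w. x \<in> X \<Longrightarrow> w \<in> E x \<Longrightarrow> dist w x < min \<delta>1 \<delta>2" "disjoint_family_on E X" "(\<Union>x\<in>X. E x) = K"
      using XE by auto
    have EK: "E x \<subseteq> K" if "x \<in> X" for x using X(6) that by auto
    have ES: "E x \<in> sets ?M" if "x \<in> X" for x
      using X(3)[OF that] EK[OF that] K(2) by (intro sets_dV_subset) auto
    have Efin: "emeasure ?M (E x) < \<infinity>" if "x \<in> X" for x
      using emeasure_mono[OF EK[OF that] KM(1)] KM(2) by (rule le_less_trans)
    \<comment> \<open>Each phase turns \<open>\<gamma> x\<close> into its modulus, so the functional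
      maps the combination to a Riemann sum of the modulus; where \<open>\<gamma> x\<close>
      vanishes, \<open>sgn\<close> is 0 and the term drops out on both sides.\<close>
    define a where "a x = complex_of_real (?\<mu> (E x)) * cnj (sgn (\<gamma> x))" for x
    have XU: "X \<subseteq> siegel" using X(2) K(2) by auto
    let ?f = "\<lambda>z. \<Sum>x\<in>X. a x * kfun s x z"
    have f: "?f \<in> bloch0" "\<Phi> ?f = (\<Sum>x\<in>X. a x * \<gamma> x)"
      "\<And>z. z \<in> siegel \<Longrightarrow> cpartial last_ix ?f z = (\<Sum>x\<in>X. a x * ker (s + 1) z x)"
      using bloch0_functional_sum[OF \<Phi> s X(1) XU] by (simp_all add: \<gamma>_def)
    have bound: "rho z * cmod (cpartial last_ix ?f z) \<le> 2 * FRv TYPE('n) lam" if z: "z \<in> siegel" for z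
    proof -
      have r: "rho z > 0" using z by (simp add: siegel_def)
      have ik: "integrable ?M (\<lambda>w. cmod (ker (s + 1) z w))"
        using ker_integral_dV(1)[OF lam z] unfolding p by (rule integrable_norm)
      have iE: "integrable ?M (\<lambda>w. indicator (E x) w *\<^sub>R (2 * cmod (ker (s + 1) z w)))" if "x \<in> X" for x
        using ik ES[OF that] by (intro integrable_mult_indicator) auto
      have "cmod (cpartial last_ix ?f z) \<le> (\<Sum>x\<in>X. cmod (a x * ker (s + 1) z x))"
        unfolding f(3)[OF z] by (rule norm_sum)
      also have "\<dots> \<le> (\<Sum>x\<in>X. \<integral>w. indicator (E x) w *\<^sub>R (2 * cmod (ker (s + 1) z w)) \<partial>?M)"
      proof (rule sum_mono)
        fix x assume x: "x \<in> X"
        have "cmod (a x) \<le> ?\<mu> (E x)"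
          by (auto simp: a_def norm_mult norm_sgn)
        then have "cmod (a x * ker (s + 1) z x) \<le> ?\<mu> (E x) * cmod (ker (s + 1) z x)"
          unfolding norm_mult by (rule mult_right_mono) simp
        also have "\<dots> = (\<integral>w. indicator (E x) w *\<^sub>R cmod (ker (s + 1) z x) \<partial>?M)"
          using ES[OF x] Efin[OF x] sets.sets_into_space[OF ES[OF x]] by (simp add: Int_absorb2 less_top)
        also have "\<dots> \<le> (\<integral>w. indicator (E x) w *\<^sub>R (2 * cmod (ker (s + 1) z w)) \<partial>?M)"
        proof (rule integral_mono)
          show "integrable ?M (\<lambda>w. indicator (E x) w *\<^sub>R cmod (ker (s + 1) z x))"
            using ES[OF x] Efin[OF x] by simp
          show "indicator (E x) w *\<^sub>R cmod (ker (s + 1) z x) \<le> indicator (E x) w *\<^sub>R (2 * cmod (ker (s + 1) z w))"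
            if "w \<in> space ?M" for w
          proof (cases "w \<in> E x")
            case True
            have "cmod (ker (s + 1) z x - ker (s + 1) z w) \<le> cmod (ker (s + 1) z w)"
            proof -
              have "w \<in> K" "x \<in> siegel" "dist w x < \<delta>1" using X(4)[OF x True] EK[OF x] True XU x by auto
              then show ?thesis using \<delta>1(2) z by auto
            qed
            then show ?thesis using True norm_triangle_sub[of "ker (s + 1) z x" "ker (s + 1) z w"] by simp
          qed simp
        qed (rule iE[OF x])
        finally show "cmod (a x * ker (s + 1) z x) \<le> (\<integral>w. indicator (E x) w *\<^sub>R (2 * cmod (ker (s + 1) z w)) \<partial>?M)" .
      qed
      also have "\<dots> = (\<integral>w. (\<Sum>x\<in>X. indicator (E x) w *\<^sub>R (2 * cmod (ker (s + 1) z w))) \<partial>?M)"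
        using iE by (rule Bochner_Integration.integral_sum[symmetric])
      also have "\<dots> \<le> (\<integral>w. 2 * cmod (ker (s + 1) z w) \<partial>?M)"
      proof (rule integral_mono)
        show "integrable ?M (\<lambda>w. \<Sum>x\<in>X. indicator (E x) w *\<^sub>R (2 * cmod (ker (s + 1) z w)))"
          using iE by (rule Bochner_Integration.integrable_sum)
        show "(\<Sum>x\<in>X. indicator (E x) w *\<^sub>R (2 * cmod (ker (s + 1) z w))) \<le> 2 * cmod (ker (s + 1) z w)" for w
        proof (cases "w \<in> (\<Union>x\<in>X. E x)")
          case True
          then obtain x where x: "x \<in> X" "w \<in> E x" by auto
          show ?thesis
            using sum_indicator_partition(1)[OF X(1,5) x, of "\<lambda>x. 2 * cmod (ker (s + 1) z w)"] by simp
        next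
          case False
          show ?thesis
            using sum_indicator_partition(2)[OF X(1,5) False, of "\<lambda>x. 2 * cmod (ker (s + 1) z w)"] by simp
        qed
      qed (use ik in simp)
      also have "\<dots> = 2 * (FRv TYPE('n) lam / rho z)"
        using ker_integral_dV(2)[OF lam z] by (simp add: p)
      finally have "rho z * cmod (cpartial last_ix ?f z) \<le> rho z * (2 * (FRv TYPE('n) lam / rho z))"
        using r by (intro mult_left_mono) auto
      then show ?thesis using r by simp
    qed
    have "(\<Sum>x\<in>X. a x * \<gamma> x) = of_real (\<Sum>x\<in>X. ?\<mu> (E x) * cmod (\<gamma> x))"
    proof -
      have "cnj (sgn c) * c = of_real (cmod c)" for c
        by (cases "c = 0") (simp_all add: sgn_eq complex_norm_square[symmetric] power2_eq_square field_simps mult.commute[of "cnj c"])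
      then show ?thesis by (simp add: a_def mult.assoc)
    qed
    then have "cmod (\<Phi> ?f) = (\<Sum>x\<in>X. ?\<mu> (E x) * cmod (\<gamma> x))"
      unfolding f(2) by (simp add: sum_nonneg del: of_real_sum)
    then have S: "(\<Sum>x\<in>X. ?\<mu> (E x) * cmod (\<gamma> x)) \<le> B * (bloch_const TYPE('n) * (2 * FRv TYPE('n) lam))"
      using bloch0_functional_bound[OF \<Phi> f(1) bound] by simp
    have iK: "integrable ?M (indicator K :: _ \<Rightarrow> real)" using KM by simp
    have iE: "integrable ?M (\<lambda>w. indicator (E x) w *\<^sub>R c)" if "x \<in> X" for x and c :: real
      using ES[OF that] Efin[OF that] by simp
    have "(\<integral>w. indicator K w * cmod (\<gamma> w) \<partial>?M)
      \<le> (\<integral>w. (\<Sum>x\<in>X. indicator (E x) w *\<^sub>R cmod (\<gamma> x)) + \<epsilon> * indicator K w \<partial>?M)"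
    proof (rule integral_mono')
      show "integrable ?M (\<lambda>w. (\<Sum>x\<in>X. indicator (E x) w *\<^sub>R cmod (\<gamma> x)) + \<epsilon> * indicator K w)"
        using iE iK by (intro Bochner_Integration.integrable_add Bochner_Integration.integrable_sum) auto
      fix w assume "w \<in> space ?M"
      show "0 \<le> (\<Sum>x\<in>X. indicator (E x) w *\<^sub>R cmod (\<gamma> x)) + \<epsilon> * indicator K w"
        using \<epsilon> by (intro add_nonneg_nonneg sum_nonneg) auto
      show "indicator K w * cmod (\<gamma> w) \<le> (\<Sum>x\<in>X. indicator (E x) w *\<^sub>R cmod (\<gamma> x)) + \<epsilon> * indicator K w"
      proof (cases "w \<in> K")
        case True
        then obtain x where x: "x \<in> X" "w \<in> E x" using X(6) by auto
        have "x \<in> K" "dist w x < \<delta>2" using X(2) X(4)[OF x] x(1) by auto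
        then have "dist (\<gamma> w) (\<gamma> x) < \<epsilon>" using \<delta>2(2) True by blast
        then have "cmod (\<gamma> w) \<le> cmod (\<gamma> x) + \<epsilon>"
          using norm_triangle_sub[of "\<gamma> w" "\<gamma> x"] by (simp add: dist_norm)
        then show ?thesis
          using True sum_indicator_partition(1)[OF X(1,5) x, of "\<lambda>x. cmod (\<gamma> x)"] by simp
      next
        case False
        then show ?thesis
          using sum_indicator_partition(2)[OF X(1,5), of w "\<lambda>x. cmod (\<gamma> x)"] X(6) by simp
      qed
    qed
    also have "\<dots> = (\<Sum>x\<in>X. \<integral>w. indicator (E x) w *\<^sub>R cmod (\<gamma> x) \<partial>?M) + \<epsilon> * ?\<mu> K"
    proof -
      have "integrable ?M (\<lambda>w. \<Sum>x\<in>X. indicator (E x) w *\<^sub>R cmod (\<gamma> x))"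
        using iE by (rule Bochner_Integration.integrable_sum)
      moreover have "integrable ?M (\<lambda>w. \<epsilon> * indicator K w)" using iK by simp
      moreover have "(\<integral>w. (\<Sum>x\<in>X. indicator (E x) w *\<^sub>R cmod (\<gamma> x)) \<partial>?M) = (\<Sum>x\<in>X. \<integral>w. indicator (E x) w *\<^sub>R cmod (\<gamma> x) \<partial>?M)"
        using iE by (rule Bochner_Integration.integral_sum)
      moreover have "(\<integral>w. \<epsilon> * indicator K w \<partial>?M) = \<epsilon> * ?\<mu> K"
        using K(2) by (simp add: Int_absorb2)
      ultimately show ?thesis by (simp only: Bochner_Integration.integral_add)
    qed
    also have "(\<Sum>x\<in>X. \<integral>w. indicator (E x) w *\<^sub>R cmod (\<gamma> x) \<partial>?M) = (\<Sum>x\<in>X. ?\<mu> (E x) * cmod (\<gamma> x))"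
      using ES Efin EK K(2) by (intro sum.cong) (auto simp: Int_absorb2 less_top subset_trans[OF EK])
    finally show ?thesis using S by linarith
  qed
  have "(\<integral>w. indicator K w * cmod (\<gamma> w) \<partial>?M) \<le> B * (bloch_const TYPE('n) * (2 * FRv TYPE('n) lam))"
  proof (rule field_le_epsilon)
    fix e :: real assume e: "e > 0"
    have q: "e / (m + 1) * m \<le> e" "e / (m + 1) > 0" if "m \<ge> 0" for m
      using that e by (auto simp: field_simps)
    from q(1)[OF measure_nonneg[of ?M K]] step[OF q(2)[OF measure_nonneg[of ?M K]]]
    show "(\<integral>w. indicator K w * cmod (\<gamma> w) \<partial>?M) \<le> B * (bloch_const TYPE('n) * (2 * FRv TYPE('n) lam)) + e"
      by linarith
  qed
  then show ?thesis by (simp add: \<gamma>_def)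
qed

definition siegel_exh :: "nat \<Rightarrow> ('n::{finite,linorder} cspace) set" where
  "siegel_exh m = {w. inverse (real (Suc m)) \<le> rho w} \<inter> cball 0 (real m)"

lemma siegel_exh:
  defines "S \<equiv> siegel_exh :: nat \<Rightarrow> 'n::{finite,linorder} cspace set"
  shows "compact (S m)" "S m \<subseteq> siegel" "incseq S" "(\<Union>m. S m) = siegel"
  unfolding S_def
proof -
  have "closed {w :: 'n cspace. inverse (real (Suc m)) \<le> rho w}"
    by (intro closed_Collect_le continuous_intros)
  then show "compact (siegel_exh m :: 'n cspace set)"
    unfolding siegel_exh_def by (intro closed_Int_compact) auto
  show sub: "siegel_exh m \<subseteq> (siegel :: 'n cspace set)" for m
  proof
    fix w :: "'n cspace" assume "w \<in> siegel_exh m"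
    then have "inverse (real (Suc m)) \<le> rho w" by (simp add: siegel_exh_def)
    moreover have "0 < inverse (real (Suc m))" by simp
    ultimately have "0 < rho w" by linarith
    then show "w \<in> siegel" by (simp add: siegel_def)
  qed
  show "incseq (siegel_exh :: nat \<Rightarrow> 'n cspace set)"
  proof (rule incseq_SucI, rule subsetI)
    fix m and w :: "'n cspace" assume w: "w \<in> siegel_exh m"
    have "inverse (real (Suc (Suc m))) \<le> inverse (real (Suc m))"
      by (intro le_imp_inverse_le) auto
    also have "\<dots> \<le> rho w" using w by (simp add: siegel_exh_def)
    finally show "w \<in> siegel_exh (Suc m)" using w by (auto simp: siegel_exh_def simp del: of_nat_Suc)
  qed
  show "(\<Union>m. siegel_exh m) = (siegel :: 'n cspace set)"
  proof (intro subset_antisym subsetI)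
    fix w :: "'n cspace" assume "w \<in> siegel"
    then have "rho w > 0" by (simp add: siegel_def)
    then obtain k where k: "inverse (real (Suc k)) < rho w"
      using reals_Archimedean by blast
    obtain l where l: "norm w \<le> real l" using real_arch_simple by blast
    have "inverse (real (Suc (max k l))) \<le> inverse (real (Suc k))"
      by (intro le_imp_inverse_le) auto
    also have "\<dots> \<le> rho w" using k by simp
    finally have "w \<in> siegel_exh (max k l)"
      using l by (auto simp: siegel_exh_def simp del: of_nat_Suc)
    then show "w \<in> (\<Union>m. siegel_exh m)" by blast
  qed (use sub in blast)
qed

text \<open>Monotone convergence along the compact exhaustion, the bound being the same at every
  stage.\<close>

lemma functional_kfun_L1:
  fixes \<Phi> :: "('n::{finite,linorder} cspace \<Rightarrow> complex) \<Rightarrow> complex"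
  assumes lam: "lam > - 1" and \<Phi>: "bloch0_functional B \<Phi>"
  defines "s \<equiv> real CARD('n) + 1 + lam"
  shows "integrable (dV lam) (\<lambda>w. \<Phi> (kfun s w))"
    and "(\<integral>w. cmod (\<Phi> (kfun s w)) \<partial>dV lam) \<le> B * (bloch_const TYPE('n) * (2 * FRv TYPE('n) lam))"
proof -
  let ?M = "dV lam :: 'n cspace measure"
  define \<gamma> where "\<gamma> w = \<Phi> (kfun s w)" for w
  define C where "C = B * (bloch_const TYPE('n) * (2 * FRv TYPE('n) lam))"
  have s: "s > 0" using lam by (simp add: s_def)
  have "continuous_on siegel \<gamma>" unfolding \<gamma>_def by (rule functional_kfun_continuous[OF \<Phi> s])
  then have \<gamma>m [measurable]: "\<gamma> \<in> borel_measurable ?M" by (rule measurable_dV_continuous)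
  have \<gamma>c: "continuous_on (siegel_exh m) \<gamma>" for m
    using \<open>continuous_on siegel \<gamma>\<close> siegel_exh(2) by (rule continuous_on_subset)
  have KM: "siegel_exh m \<in> sets ?M" "emeasure ?M (siegel_exh m) < \<infinity>" for m
    using emeasure_dV_compact[OF lam siegel_exh(1,2)] by auto
  note KM(1)[measurable]
  have C0: "0 \<le> C"
    using \<Phi> bloch_const_pos[of "TYPE('n)"] FRv_nonneg[OF lam, where 'n = 'n] by (simp add: C_def bloch0_functional_def)
  have step: "(\<integral>\<^sup>+w. ennreal (indicator (siegel_exh m) w * cmod (\<gamma> w)) \<partial>?M) \<le> ennreal C" for m
  proof -
    obtain N where N: "\<And>w. w \<in> siegel_exh m \<Longrightarrow> cmod (\<gamma> w) \<le> N"
      using compact_imp_bounded[OF compact_continuous_image[OF \<gamma>c siegel_exh(1)]] unfolding bounded_iff by blast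
    have i: "integrable ?M (\<lambda>w. indicator (siegel_exh m) w * cmod (\<gamma> w))"
      by (rule integrableI_bounded_set[where A = "siegel_exh m" and B = N])
        (use KM N in \<open>auto simp: indicator_def intro!: AE_I2\<close>)
    have "(\<integral>\<^sup>+w. ennreal (indicator (siegel_exh m) w * cmod (\<gamma> w)) \<partial>?M)
      = ennreal (\<integral>w. indicator (siegel_exh m) w * cmod (\<gamma> w) \<partial>?M)"
      by (rule nn_integral_eq_integral[OF i]) simp
    also have "\<dots> \<le> ennreal C"
      using functional_kfun_L1_compact[OF lam \<Phi> siegel_exh(1,2)]
      by (intro ennreal_leI) (simp add: C_def \<gamma>_def s_def)
    finally show ?thesis .
  qed
  have sup: "(SUP m. ennreal (indicator (siegel_exh m) w * cmod (\<gamma> w))) = ennreal (cmod (\<gamma> w))" if w: "w \<in> siegel" for w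
  proof (rule antisym)
    show "(SUP m. ennreal (indicator (siegel_exh m) w * cmod (\<gamma> w))) \<le> ennreal (cmod (\<gamma> w))"
      by (intro SUP_least ennreal_leI) (auto simp: indicator_def)
    obtain m where "w \<in> siegel_exh m" using w siegel_exh(4) by blast
    then show "ennreal (cmod (\<gamma> w)) \<le> (SUP m. ennreal (indicator (siegel_exh m) w * cmod (\<gamma> w)))"
      by (intro SUP_upper2[of m]) auto
  qed
  have "(\<integral>\<^sup>+w. ennreal (cmod (\<gamma> w)) \<partial>?M) = (\<integral>\<^sup>+w. (SUP m. ennreal (indicator (siegel_exh m) w * cmod (\<gamma> w))) \<partial>?M)"
    using sup by (intro nn_integral_cong) simp
  also have "\<dots> = (SUP m. \<integral>\<^sup>+w. ennreal (indicator (siegel_exh m) w * cmod (\<gamma> w)) \<partial>?M)"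
  proof (rule nn_integral_monotone_convergence_SUP)
    have "siegel_exh m \<subseteq> (siegel_exh (Suc m) :: 'n cspace set)" for m
      by (rule incseq_SucD[OF siegel_exh(3)])
    then show "incseq (\<lambda>m w. ennreal (indicator (siegel_exh m) w * cmod (\<gamma> w)))"
      by (intro incseq_SucI le_funI ennreal_leI mult_right_mono) (auto simp: indicator_def)
  qed measurable
  also have "\<dots> \<le> ennreal C" by (intro SUP_least step)
  finally have nn: "(\<integral>\<^sup>+w. ennreal (cmod (\<gamma> w)) \<partial>?M) \<le> ennreal C" .
  have i: "integrable ?M \<gamma>"
    using \<gamma>m by (rule integrableI_bounded) (use nn in \<open>auto intro: le_less_trans\<close>)
  then show "integrable (dV lam) (\<lambda>w. \<Phi> (kfun s w))" by (simp add: \<gamma>_def[abs_def])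
  have "ennreal (\<integral>w. cmod (\<gamma> w) \<partial>?M) = (\<integral>\<^sup>+w. ennreal (cmod (\<gamma> w)) \<partial>?M)"
    by (rule nn_integral_eq_integral[symmetric]) (use i in auto)
  with nn have "ennreal (\<integral>w. cmod (\<gamma> w) \<partial>?M) \<le> ennreal C" by simp
  then have "(\<integral>w. cmod (\<gamma> w) \<partial>?M) \<le> C" using C0 by (simp add: ennreal_le_iff)
  then show "(\<integral>w. cmod (\<Phi> (kfun s w)) \<partial>dV lam) \<le> B * (bloch_const TYPE('n) * (2 * FRv TYPE('n) lam))"
    by (simp add: \<gamma>_def C_def)
qed

text \<open>The form in which membership in \<open>bloch0\<close> is used: outside a compact subset
  of the domain the gradient is below \<open>e\<close>. The limit at infinity gives boundedness, and
  the limits at the boundary keep a convergent sequence of the set from ending on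
  \<open>siegel_bd\<close>.\<close>

lemma bloch0_superlevel_compact:
  fixes f :: "'n::{finite,linorder} cspace \<Rightarrow> complex"
  assumes f: "f \<in> bloch0" and e: "e > 0"
  shows "compact {w \<in> siegel. e \<le> inv_grad f w}"
proof -
  let ?K = "{w \<in> siegel. e \<le> inv_grad f w}"
  have hf: "holomorphic_Cn_on f siegel" using f by (simp add: bloch0_iff bloch_def holo_siegel_def)
  have lim1: "\<And>w. w \<in> siegel_bd \<Longrightarrow> (inv_grad f \<longlongrightarrow> 0) (at w within siegel)"
    and lim2: "(inv_grad f \<longlongrightarrow> 0) (inf at_infinity (principal siegel))"
    using f by (auto simp: bloch0_iff)
  have "\<forall>\<^sub>F w in inf at_infinity (principal siegel). inv_grad f w < e"
    using lim2 e by (rule order_tendstoD)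
  then obtain b where b: "\<And>w. b \<le> norm w \<Longrightarrow> w \<in> siegel \<Longrightarrow> inv_grad f w < e"
    unfolding eventually_inf_principal eventually_at_infinity by blast
  have "bounded ?K"
    unfolding bounded_iff using b by (intro exI[of _ b]) (force simp: not_le[symmetric])
  moreover have "closed ?K"
    unfolding closed_sequential_limits
  proof (intro allI impI, elim conjE)
    fix x l assume x: "\<forall>n. x n \<in> ?K" and l: "x \<longlonglongrightarrow> l"
    have xs: "x n \<in> siegel" "e \<le> inv_grad f (x n)" for n using x by auto
    have "(\<lambda>n. rho (x n)) \<longlonglongrightarrow> rho l"
      using continuous_on_rho[of "UNIV :: 'n cspace set"] l by (intro continuous_on_tendsto_compose[of UNIV rho]) auto
    then have r0: "0 \<le> rho l"
      using xs(1) by (intro LIMSEQ_le_const) (auto simp: siegel_def less_imp_le)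
    have contra: False if "(\<lambda>n. inv_grad f (x n)) \<longlonglongrightarrow> 0"
      using LIMSEQ_le_const[OF that, of e] xs(2) e by auto
    show "l \<in> ?K"
    proof (cases "rho l = 0")
      case True
      then have lbd: "l \<in> siegel_bd" by (simp add: siegel_bd_def)
      have "x n \<noteq> l" for n using xs(1)[of n] True by (auto simp: siegel_def)
      then have "filterlim x (at l within siegel) sequentially"
        unfolding filterlim_at using l xs(1) by auto
      from filterlim_compose[OF lim1[OF lbd] this] show ?thesis using contra by blast
    next
      case False
      then have ls: "l \<in> siegel" using r0 by (simp add: siegel_def)
      have "(\<lambda>n. inv_grad f (x n)) \<longlonglongrightarrow> inv_grad f l"
        using continuous_on_inv_grad[OF hf] l ls xs(1)
        by (intro continuous_on_tendsto_compose[of siegel "inv_grad f"]) auto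
      then have "e \<le> inv_grad f l" using xs(2) by (intro LIMSEQ_le_const) auto
      then show ?thesis using ls by simp
    qed
  qed
  ultimately show ?thesis by (simp add: compact_eq_bounded_closed)
qed

text \<open>Two comparisons with one Riemann sum over a superlevel set \<open>K\<close>. The first,
  of the multiple of \<open>f\<close> with the sum in Bloch norm, has an error relative to the
  kernel, so the measure of \<open>K\<close> does not enter. The second, of scalars with the
  integral against \<open>\<gamma>\<close>, has an absolute error on \<open>K\<close>. Off
  \<open>K\<close> both errors are small because \<open>rho\<close> times the last derivative is
  below \<open>e\<close>.\<close>

lemma functional_representation:
  fixes \<Phi> :: "('n::{finite,linorder} cspace \<Rightarrow> complex) \<Rightarrow> complex"
  assumes lam: "lam > - 1" and \<Phi>: "bloch0_functional B \<Phi>" and f: "f \<in> bloch0"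
  defines "s \<equiv> real CARD('n) + 1 + lam"
  shows "of_real (repc TYPE('n) lam) * \<Phi> f
    = (\<integral>w. of_real (rho w) * cpartial last_ix f w * \<Phi> (kfun s w) \<partial>dV lam)"
proof -
  let ?M = "dV lam :: 'n cspace measure"
  let ?\<mu> = "measure ?M"
  define b where "b = repc TYPE('n) lam"
  have b: "b > 0" unfolding b_def by (rule repc_pos[OF lam])
  define \<gamma> where "\<gamma> w = \<Phi> (kfun s w)" for w
  define u where "u = cpartial last_ix f"
  define F where "F w = of_real (rho w) * u w" for w
  have s: "s > 0" using lam by (simp add: s_def)
  have p: "s + 1 = real CARD('n) + 2 + lam" by (simp add: s_def)
  have B: "B \<ge> 0" using \<Phi> by (simp add: bloch0_functional_def)
  have fb: "f \<in> bloch" using f by (simp add: bloch0_iff)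
  have hf: "holomorphic_Cn_on f siegel" using fb by (simp add: bloch_def holo_siegel_def)
  have \<gamma>: "continuous_on siegel \<gamma>" unfolding \<gamma>_def by (rule functional_kfun_continuous[OF \<Phi> s])
  have u: "continuous_on siegel u" unfolding u_def by (rule continuous_on_cpartial[OF hf])
  have F: "continuous_on siegel F" unfolding F_def using u by (intro continuous_intros)
  have i\<gamma>: "integrable ?M \<gamma>" unfolding \<gamma>_def s_def by (rule functional_kfun_L1(1)[OF lam \<Phi>])
  define N where "N = bloch_norm f"
  have N: "N \<ge> 0" unfolding N_def by (rule bloch_norm_nonneg[OF fb])
  have Fi: "cmod (F w) \<le> inv_grad f w" if "w \<in> siegel" for w
    using rho_Lop_last_le[OF that, of f] that by (simp add: F_def u_def norm_mult siegel_def)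
  have FN: "cmod (F w) \<le> N" if "w \<in> siegel" for w
    using Fi[OF that] inv_grad_le_bloch_norm[OF fb that] by (simp add: N_def)
  have Fm [measurable]: "F \<in> borel_measurable ?M" by (rule measurable_dV_continuous[OF F])
  have bnd: "integrable ?M (\<lambda>w. F w * g w)" if g: "integrable ?M g" for g :: "'n cspace \<Rightarrow> complex"
  proof (rule Bochner_Integration.integrable_bound[of _ "\<lambda>w. N * cmod (g w)"])
    show "integrable ?M (\<lambda>w. N * cmod (g w))" using g by simp
    show "(\<lambda>w. F w * g w) \<in> borel_measurable ?M" using g by simp
    show "AE w in ?M. norm (F w * g w) \<le> norm (N * cmod (g w))"
      using FN N by (intro AE_I2) (auto simp: norm_mult intro!: mult_right_mono)
  qed
  have iF\<gamma>: "integrable ?M (\<lambda>w. F w * \<gamma> w)" by (rule bnd[OF i\<gamma>])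
  have ik: "integrable ?M (ker (s + 1) z)" if "z \<in> siegel" for z
    unfolding p by (rule ker_integral_dV(1)[OF lam that])
  have rep: "(\<integral>w. F w * ker (s + 1) z w \<partial>?M) = of_real b * u z" if z: "z \<in> siegel" for z
    unfolding F_def p b_def u_def
    by (rule reproducing_dV[OF lam z continuous_on_cpartial[OF hf] cpartial_last_along_curves[OF hf]])
       (use bnd[OF ik[OF z]] in \<open>simp add: F_def u_def p\<close>)
  \<comment> \<open>The total error per unit of \<open>e\<close>: \<open>D\<close> comes from the
    Bloch norm of the difference, while \<open>G\<close> and the final 1 come from the scalar
    Riemann sum.\<close>
  define D where "D = B * bloch_const TYPE('n) * ((1 + N) * FRv TYPE('n) lam)"
  define G where "G = (\<integral>w. cmod (\<gamma> w) \<partial>?M)"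
  have G: "G \<ge> 0" by (simp add: G_def)
  have D: "D \<ge> 0" using B N bloch_const_pos[of "TYPE('n)"] FRv_nonneg[OF lam, where 'n = 'n] by (simp add: D_def)
  have step: "cmod (of_real b * \<Phi> f - (\<integral>w. F w * \<gamma> w \<partial>?M)) \<le> (D + G + 1) * e" if e: "e > 0" for e
  proof -
    define K where "K = {w \<in> siegel. e \<le> inv_grad f w}"
    have K: "compact K" "K \<subseteq> siegel"
      unfolding K_def using bloch0_superlevel_compact[OF f e] by auto
    note KM = emeasure_dV_compact[OF lam K]
    \<comment> \<open>In the scalar comparison the error on \<open>K\<close> is absolute and must be
      small against the measure of \<open>K\<close>; adding 1 avoids division by 0.\<close>
    define \<epsilon> where "\<epsilon> = e / (?\<mu> K + 1)"
    have q: "e / (m + 1) * m \<le> e" "e / (m + 1) > 0" if "m \<ge> 0" for m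
      using that e by (auto simp: field_simps)
    have \<epsilon>: "\<epsilon> > 0" "\<epsilon> * ?\<mu> K \<le> e"
      using q(1)[OF measure_nonneg[of ?M K]] q(2)[OF measure_nonneg[of ?M K]] by (simp_all add: \<epsilon>_def)
    have "\<exists>\<delta>>0. \<forall>w\<in>K. \<forall>v\<in>siegel. \<forall>z\<in>siegel. dist w v < \<delta> \<longrightarrow>
        cmod (ker (s + 1) z v - ker (s + 1) z w) \<le> e * cmod (ker (s + 1) z w)"
      by (rule ker_close[OF K]) (use s e in auto)
    then obtain \<delta>1 where \<delta>1: "\<delta>1 > 0" "\<forall>w\<in>K. \<forall>v\<in>siegel. \<forall>z\<in>siegel. dist w v < \<delta>1 \<longrightarrow>
        cmod (ker (s + 1) z v - ker (s + 1) z w) \<le> e * cmod (ker (s + 1) z w)"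
      by blast
    have cK: "continuous_on K F" "continuous_on K (\<lambda>w. F w * \<gamma> w)"
      using continuous_on_subset[OF F K(2)] continuous_on_subset[OF \<gamma> K(2)] by (auto intro: continuous_on_mult)
    obtain \<delta>2 where \<delta>2: "\<delta>2 > 0" "\<forall>w\<in>K. \<forall>v\<in>K. dist v w < \<delta>2 \<longrightarrow> dist (F v) (F w) < e"
      using compact_uniformly_continuous[OF cK(1) K(1)] e unfolding uniformly_continuous_on_def by blast
    obtain \<delta>3 where \<delta>3: "\<delta>3 > 0" "\<forall>w\<in>K. \<forall>v\<in>K. dist v w < \<delta>3 \<longrightarrow> dist (F v * \<gamma> v) (F w * \<gamma> w) < \<epsilon>"
      using compact_uniformly_continuous[OF cK(2) K(1)] \<epsilon>(1) unfolding uniformly_continuous_on_def by blast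
    define \<delta> where "\<delta> = min \<delta>1 (min \<delta>2 \<delta>3)"
    have \<delta>: "\<delta> > 0" using \<delta>1(1) \<delta>2(1) \<delta>3(1) by (simp add: \<delta>_def)
    from compact_small_partition[OF K(1) \<delta>]
    obtain X E where XE: "finite X" "X \<subseteq> K" "\<forall>x\<in>X. E x \<in> sets borel \<and> (\<forall>w\<in>E x. dist w x < \<delta>)"
        "disjoint_family_on E X" "(\<Union>x\<in>X. E x) = K"
      by (elim exE conjE) (rule that)
    have XU: "X \<subseteq> siegel" using XE(2) K(2) by auto
    have EK: "E x \<subseteq> K" if "x \<in> X" for x using XE(5) that by auto
    have ES: "E x \<in> sets ?M" if "x \<in> X" for x
      using XE(3) that EK[OF that] K(2) by (intro sets_dV_subset) auto
    have Efin: "emeasure ?M (E x) < \<infinity>" if "x \<in> X" for x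
      using emeasure_mono[OF EK[OF that] KM(1)] KM(2) by (rule le_less_trans)
    have iE: "integrable ?M (\<lambda>w. indicator (E x) w *\<^sub>R c)" if "x \<in> X" for x and c :: complex
      using ES[OF that] Efin[OF that] by (intro integrable_scaleR_left) (simp add: less_top)
    have IE: "(\<integral>w. indicator (E x) w *\<^sub>R c \<partial>?M) = of_real (?\<mu> (E x)) * c" if "x \<in> X" for x and c :: complex
      using ES[OF that] Efin[OF that] sets.sets_into_space[OF ES[OF that]]
      by (simp add: Int_absorb2 less_top scaleR_conv_of_real)
    define a where "a x = F x * of_real (?\<mu> (E x))" for x
    let ?P = "\<lambda>z. \<Sum>x\<in>X. a x * kfun s x z"
    have P: "?P \<in> bloch0" "\<Phi> ?P = (\<Sum>x\<in>X. a x * \<gamma> x)"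
      "\<And>z. z \<in> siegel \<Longrightarrow> cpartial last_ix ?P z = (\<Sum>x\<in>X. a x * ker (s + 1) z x)"
      using bloch0_functional_sum[OF \<Phi> s XE(1) XU] by (simp_all add: \<gamma>_def)
    have hP: "holomorphic_Cn_on ?P siegel" using P(1) by (simp add: bloch0_iff bloch_def holo_siegel_def)
    let ?H = "\<lambda>z. of_real b * f z + (- 1) * ?P z"
    have H: "?H \<in> bloch0" by (rule bloch0_combine[OF f P(1)])
    have \<Phi>H: "\<Phi> ?H = of_real b * \<Phi> f + (- 1) * \<Phi> ?P"
      by (rule \<Phi>[unfolded bloch0_functional_def, THEN conjunct1, rule_format, OF f P(1)])
    have loc: "w \<in> K" "x \<in> K" "x \<in> siegel" "dist w x < \<delta>1" "dist w x < \<delta>2" "dist w x < \<delta>3"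
      if "x \<in> X" "w \<in> E x" for x w
      using that XE(2,3) EK[OF that(1)] K(2) by (auto simp: \<delta>_def)
    have bound: "rho z * cmod (cpartial last_ix ?H z) \<le> (1 + N) * e * FRv TYPE('n) lam" if z: "z \<in> siegel" for z
    proof -
      have r: "rho z > 0" using z by (simp add: siegel_def)
      let ?S = "\<lambda>w. \<Sum>x\<in>X. indicator (E x) w *\<^sub>R (F x * ker (s + 1) z x)"
      have iS: "integrable ?M ?S" using iE by (intro Bochner_Integration.integrable_sum)
      have iFk: "integrable ?M (\<lambda>w. F w * ker (s + 1) z w)" by (rule bnd[OF ik[OF z]])
      have "cpartial last_ix ?H z = of_real b * u z - (\<Sum>x\<in>X. a x * ker (s + 1) z x)"
        using Lop_combine[OF hf hP z, of last_ix "of_real b" "- 1"] P(3)[OF z] by (simp add: Lop_last u_def)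
      also have "(\<Sum>x\<in>X. a x * ker (s + 1) z x) = (\<Sum>x\<in>X. \<integral>w. indicator (E x) w *\<^sub>R (F x * ker (s + 1) z x) \<partial>?M)"
        by (rule sum.cong) (auto simp: IE a_def)
      also have "\<dots> = (\<integral>w. ?S w \<partial>?M)"
        using iE by (rule Bochner_Integration.integral_sum[symmetric])
      also have "of_real b * u z - (\<integral>w. ?S w \<partial>?M) = (\<integral>w. F w * ker (s + 1) z w - ?S w \<partial>?M)"
        unfolding rep[OF z, symmetric] using iFk iS by (rule Bochner_Integration.integral_diff[symmetric])
      finally have "cmod (cpartial last_ix ?H z) = cmod (\<integral>w. F w * ker (s + 1) z w - ?S w \<partial>?M)" by simp
      also have "\<dots> \<le> (\<integral>w. (1 + N) * e * cmod (ker (s + 1) z w) \<partial>?M)"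
      proof (rule Bochner_Integration.integral_norm_bound_integral)
        show "integrable ?M (\<lambda>w. F w * ker (s + 1) z w - ?S w)" using iFk iS by (rule Bochner_Integration.integrable_diff)
        show "integrable ?M (\<lambda>w. (1 + N) * e * cmod (ker (s + 1) z w))" using ik[OF z] by simp
        fix w assume "w \<in> space ?M"
        then have w: "w \<in> siegel" by simp
        show "cmod (F w * ker (s + 1) z w - ?S w) \<le> (1 + N) * e * cmod (ker (s + 1) z w)"
        proof (cases "w \<in> K")
          case True
          then obtain x where x: "x \<in> X" "w \<in> E x" using XE(5) by auto
          have S: "?S w = F x * ker (s + 1) z x"
            by (rule sum_indicator_partition(1)[OF XE(1,4) x])
          \<comment> \<open>The first term carries the variation of \<open>F\<close>, at most
            \<open>e\<close>; the second the relative variation of the kernel, at most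
            \<open>e\<close>, times the modulus of \<open>F x\<close>, at most
            \<open>N\<close>.\<close>
          have "F w * ker (s + 1) z w - F x * ker (s + 1) z x
            = (F w - F x) * ker (s + 1) z w - F x * (ker (s + 1) z x - ker (s + 1) z w)"
            by (simp add: algebra_simps)
          then have "cmod (F w * ker (s + 1) z w - ?S w)
            \<le> cmod (F w - F x) * cmod (ker (s + 1) z w) + cmod (F x) * cmod (ker (s + 1) z x - ker (s + 1) z w)"
            unfolding S by (metis norm_mult norm_triangle_ineq4)
          also have "\<dots> \<le> e * cmod (ker (s + 1) z w) + N * (e * cmod (ker (s + 1) z w))"
          proof (intro add_mono mult_right_mono mult_mono)
            have "dist (F w) (F x) < e" using \<delta>2(2) loc[OF x] by blast
            then show "cmod (F w - F x) \<le> e" by (simp add: dist_norm)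
            show "cmod (F x) \<le> N" by (rule FN[OF loc(3)[OF x]])
            show "cmod (ker (s + 1) z x - ker (s + 1) z w) \<le> e * cmod (ker (s + 1) z w)"
              using \<delta>1(2) loc[OF x] z by blast
          qed (use N in auto)
          finally show ?thesis by (simp add: algebra_simps)
        next
          case False
          have S: "?S w = 0" by (rule sum_indicator_partition(2)[OF XE(1,4)]) (use False XE(5) in simp)
          have "inv_grad f w < e" using False w by (auto simp: K_def)
          then have "cmod (F w) \<le> (1 + N) * e"
          proof -
            have "cmod (F w) \<le> e" using Fi[OF w] \<open>inv_grad f w < e\<close> by linarith
            moreover have "0 \<le> N * e" using N e by simp
            ultimately show ?thesis unfolding distrib_right by linarith
          qed
          then show ?thesis unfolding S by (simp add: norm_mult mult_right_mono)
        qed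
      qed
      also have "\<dots> = (1 + N) * e * (FRv TYPE('n) lam / rho z)"
        using ker_integral_dV(2)[OF lam z] by (simp add: p)
      finally have "rho z * cmod (cpartial last_ix ?H z) \<le> rho z * ((1 + N) * e * (FRv TYPE('n) lam / rho z))"
        using r by (intro mult_left_mono) auto
      then show ?thesis using r by simp
    qed
    have 1: "cmod (of_real b * \<Phi> f - \<Phi> ?P) \<le> D * e"
      using bloch0_functional_bound[OF \<Phi> H bound] unfolding \<Phi>H by (simp add: D_def mult_ac)
    have 2: "cmod (\<Phi> ?P - (\<integral>w. F w * \<gamma> w \<partial>?M)) \<le> G * e + e"
    proof -
      let ?S = "\<lambda>w. \<Sum>x\<in>X. indicator (E x) w *\<^sub>R (F x * \<gamma> x)"
      have iS: "integrable ?M ?S" using iE by (intro Bochner_Integration.integrable_sum)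
      have "\<Phi> ?P = (\<Sum>x\<in>X. \<integral>w. indicator (E x) w *\<^sub>R (F x * \<gamma> x) \<partial>?M)"
        unfolding P(2) by (rule sum.cong) (auto simp: IE a_def)
      also have "\<dots> = (\<integral>w. ?S w \<partial>?M)"
        using iE by (rule Bochner_Integration.integral_sum[symmetric])
      finally have "\<Phi> ?P - (\<integral>w. F w * \<gamma> w \<partial>?M) = (\<integral>w. ?S w - F w * \<gamma> w \<partial>?M)"
        using iS iF\<gamma> by (simp only: Bochner_Integration.integral_diff)
      then have "cmod (\<Phi> ?P - (\<integral>w. F w * \<gamma> w \<partial>?M)) = cmod (\<integral>w. ?S w - F w * \<gamma> w \<partial>?M)" by simp
      also have "\<dots> \<le> (\<integral>w. e * cmod (\<gamma> w) + \<epsilon> * indicator K w \<partial>?M)"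
      proof (rule Bochner_Integration.integral_norm_bound_integral)
        show "integrable ?M (\<lambda>w. ?S w - F w * \<gamma> w)" using iS iF\<gamma> by (rule Bochner_Integration.integrable_diff)
        show "integrable ?M (\<lambda>w. e * cmod (\<gamma> w) + \<epsilon> * indicator K w)" using i\<gamma> KM by simp
        fix w assume "w \<in> space ?M"
        then have w: "w \<in> siegel" by simp
        show "cmod (?S w - F w * \<gamma> w) \<le> e * cmod (\<gamma> w) + \<epsilon> * indicator K w"
        proof (cases "w \<in> K")
          case True
          then obtain x where x: "x \<in> X" "w \<in> E x" using XE(5) by auto
          have S: "?S w = F x * \<gamma> x" by (rule sum_indicator_partition(1)[OF XE(1,4) x])
          have "dist (F w * \<gamma> w) (F x * \<gamma> x) < \<epsilon>" using \<delta>3(2) loc[OF x] by blast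
          then have "cmod (F x * \<gamma> x - F w * \<gamma> w) \<le> \<epsilon>" by (simp add: dist_norm norm_minus_commute)
          then show ?thesis unfolding S using True e by (simp add: add_increasing)
        next
          case False
          have S: "?S w = 0" by (rule sum_indicator_partition(2)[OF XE(1,4)]) (use False XE(5) in simp)
          have "inv_grad f w < e" using False w by (auto simp: K_def)
          then show ?thesis unfolding S using Fi[OF w] False by (simp add: norm_mult mult_right_mono)
        qed
      qed
      also have "\<dots> = e * G + \<epsilon> * ?\<mu> K"
        using i\<gamma> KM K(2) by (simp add: G_def Int_absorb2)
      finally show ?thesis using \<epsilon>(2) by (simp add: mult.commute)
    qed
    have "cmod (of_real b * \<Phi> f - (\<integral>w. F w * \<gamma> w \<partial>?M)) \<le> cmod (of_real b * \<Phi> f - \<Phi> ?P) + cmod (\<Phi> ?P - (\<integral>w. F w * \<gamma> w \<partial>?M))"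
    proof -
      have "cmod (x - z) \<le> cmod (x - y) + cmod (y - z)" for x y z
        using norm_triangle_ineq[of "x - y" "y - z"] by simp
      then show ?thesis .
    qed
    also have "\<dots> \<le> (D + G + 1) * e" using 1 2 by (simp add: algebra_simps)
    finally show ?thesis .
  qed
  have "cmod (of_real b * \<Phi> f - (\<integral>w. F w * \<gamma> w \<partial>?M)) \<le> 0 + e" if e: "e > 0" for e
  proof -
    have "D + G + 1 > 0" using D G by simp
    then show ?thesis using step[of "e / (D + G + 1)"] e by simp
  qed
  then have "cmod (of_real b * \<Phi> f - (\<integral>w. F w * \<gamma> w \<partial>?M)) \<le> 0"
    by (rule field_le_epsilon)
  then show ?thesis by (simp add: b_def F_def u_def \<gamma>_def)
qed

section \<open>The duality\<close>

text \<open>Differentiation under the integral sign. The second order remainder of the kernel in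
  \<open>w\<close>, multiplied by \<open>rho z\<close>, is at most a constant times the square of
  \<open>norm h\<close>, uniformly in \<open>z\<close>, so the integrability of \<open>g\<close>
  dominates it.\<close>

lemma holomorphic_if_reproduced:
  fixes g :: "'n::{finite,linorder} cspace \<Rightarrow> complex"
  assumes b: "b \<noteq> 0" and p: "p \<ge> 1" and g: "integrable (dV lam) g"
    and rep: "\<And>w. w \<in> siegel \<Longrightarrow> b * g w = (\<integral>z. of_real (rho z) * g z * ker p w z \<partial>dV lam)"
  shows "holomorphic_Cn_on g siegel"
  unfolding holomorphic_Cn_on_def
proof
  fix w :: "'n cspace" assume w: "w \<in> siegel"
  let ?M = "dV lam :: 'n cspace measure"
  have r: "rho w > 0" using w by (simp add: siegel_def)
  define C where "C = (1 + real CARD('n) * (norm w + 1)) * (2 / rho w) + real CARD('n)"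
  have C: "C > 0" using r by (auto simp: C_def intro!: add_pos_nonneg mult_pos_pos divide_pos_pos)
  have lin: "cmod (rr_lin z h) \<le> norm h * (C * cmod (rr w z))" if "z \<in> siegel" for z h :: "'n cspace"
    using rr_diff_le[OF w that r order_refl order_refl, of h] rr_cnj[of w z] by (simp add: C_def)
  define N where "N = 2 * (rho w / 2) powr (1 - p)"
  have N: "N \<ge> 0" by (simp add: N_def)
  have kN: "rho z * cmod (rr w z) powr (- p) \<le> N" if "z \<in> siegel" for z
    using rho_ker_le[OF that w p] norm_ker[OF w that, of p] ker_cnj[OF w that, of p] by (simp add: N_def)
  have bnd: "integrable ?M (\<lambda>z. q z * g z)"
    if q: "continuous_on siegel q" "\<And>z. z \<in> siegel \<Longrightarrow> cmod (q z) \<le> L" for q :: "'n cspace \<Rightarrow> complex" and L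
  proof (rule Bochner_Integration.integrable_bound[of _ "\<lambda>z. L * cmod (g z)"])
    show "integrable ?M (\<lambda>z. L * cmod (g z))" using g by simp
    have [measurable]: "q \<in> borel_measurable ?M" by (rule measurable_dV_continuous[OF q(1)])
    show "(\<lambda>z. q z * g z) \<in> borel_measurable ?M" using g by simp
    show "AE z in ?M. norm (q z * g z) \<le> norm (L * cmod (g z))"
    proof (rule AE_I2)
      fix z assume "z \<in> space ?M"
      then have "cmod (q z) * cmod (g z) \<le> L * cmod (g z)" using q(2) by (intro mult_right_mono) auto
      also have "\<dots> \<le> norm (L * cmod (g z))" by (simp only: real_norm_def abs_ge_self)
      finally show "norm (q z * g z) \<le> norm (L * cmod (g z))" by (simp only: norm_mult[of "q z"])
    qed
  qed
  have rho0: "0 \<le> rho z" if "z \<in> siegel" for z :: "'n cspace" using that by (simp add: siegel_def)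
  have ib: "integrable ?M (\<lambda>z. of_real (rho z) * ker p v z * g z)" if v: "v \<in> siegel" for v
  proof (rule bnd)
    show "continuous_on siegel (\<lambda>z. of_real (rho z) * ker p v z)"
      by (intro continuous_intros continuous_on_ker(1)[OF v])
    show "cmod (of_real (rho z) * ker p v z) \<le> 2 * (rho v / 2) powr (1 - p)" if "z \<in> siegel" for z
      using rho_ker_le[OF that v p] ker_cnj[OF v that, of p] rho0[OF that] by (simp add: norm_mult)
  qed
  \<comment> \<open>The derivative along \<open>h\<close> of the kernel in \<open>w\<close>, times
    \<open>rho z\<close>. It carries one more negative power of \<open>rr\<close>, for which the
    factor \<open>rr_lin z h\<close> compensates by \<open>lin\<close>.\<close>
  define q where "q h z = of_real (rho z) * (- of_real p * ker (p + 1) w z * rr_lin z h)" for z h :: "'n cspace"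
  have iq: "integrable ?M (\<lambda>z. q h z * g z)" for h
  proof (rule bnd)
    show "continuous_on siegel (q h)"
      unfolding q_def rr_lin_def by (intro continuous_intros continuous_on_ker(1)[OF w])
    fix z :: "'n cspace" assume z: "z \<in> siegel"
    have x0: "cmod (rr w z) > 0" using rr_nonzero[OF w z] by simp
    have "cmod (q h z) = rho z * (p * cmod (rr w z) powr (- (p + 1)) * cmod (rr_lin z h))"
      using rho0[OF z] p by (simp add: q_def norm_mult norm_ker[OF w z])
    also have "\<dots> \<le> rho z * (p * cmod (rr w z) powr (- (p + 1)) * (norm h * (C * cmod (rr w z))))"
      using lin[OF z] p rho0[OF z] by (intro mult_left_mono) auto
    also have "\<dots> = p * norm h * C * (rho z * cmod (rr w z) powr (- p))"
      using x0 by (simp add: powr_diff)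
    also have "\<dots> \<le> p * norm h * C * N"
      using kN[OF z] p C by (intro mult_left_mono) auto
    finally show "cmod (q h z) \<le> p * norm h * C * N" .
  qed
  define D where "D h = (\<integral>z. q h z * g z \<partial>?M) / b" for h
  have qc: "q (c *s h) z = c * q h z" and qa: "q (h + k) z = q h z + q k z" for c h k z
    by (simp_all add: q_def rr_lin_scale rr_lin_add algebra_simps)
  have Dc: "D (c *s h) = c * D h" for c h
    unfolding D_def qc by (simp add: mult.assoc)
  have Da: "D (h + k) = D h + D k" for h k
    unfolding D_def qa distrib_right using Bochner_Integration.integral_add[OF iq iq, of h k] by (simp add: add_divide_distrib)
  have "linear D"
  proof (rule linearI)
    show "D (t *\<^sub>R h) = t *\<^sub>R D h" for t h
    proof -
      have "t *\<^sub>R h = complex_of_real t *s h" by (simp add: vec_eq_iff complex_eq_iff)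
      then show ?thesis by (simp add: Dc scaleR_conv_of_real)
    qed
  qed (rule Da)
  then have bl: "bounded_linear D" by (simp add: linear_conv_bounded_linear)
  define A where "A = p * (p + 1) * 2 powr (p + 2)"
  define G where "G = (\<integral>z. cmod (g z) \<partial>?M)"
  define Q where "Q = A * C\<^sup>2 * N * G / cmod b"
  obtain d where d: "d > 0" "ball w d \<subseteq> siegel" using w open_siegel open_contains_ball by blast
  have est: "cmod (g (w + h) - g w - D h) \<le> Q * (norm h)\<^sup>2" if h: "norm h < d" "C * norm h \<le> 1 / 2" for h
  proof -
    have wh: "w + h \<in> siegel" using d(2) h by (auto simp: dist_norm)
    have "b * (g (w + h) - g w - D h)
      = (\<integral>z. of_real (rho z) * ker p (w + h) z * g z \<partial>?M) - (\<integral>z. of_real (rho z) * ker p w z * g z \<partial>?M) - (\<integral>z. q h z * g z \<partial>?M)"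
      using b rep[OF wh] rep[OF w] by (simp add: right_diff_distrib D_def mult_ac)
    also have "\<dots> = (\<integral>z. of_real (rho z) * ker p (w + h) z * g z - of_real (rho z) * ker p w z * g z - q h z * g z \<partial>?M)"
      using ib[OF wh] ib[OF w] iq[of h] by simp
    finally have "cmod b * cmod (g (w + h) - g w - D h)
      = cmod (\<integral>z. of_real (rho z) * ker p (w + h) z * g z - of_real (rho z) * ker p w z * g z - q h z * g z \<partial>?M)"
      by (simp flip: norm_mult)
    also have "\<dots> \<le> (\<integral>z. A * C\<^sup>2 * N * (norm h)\<^sup>2 * cmod (g z) \<partial>?M)"
    proof (rule Bochner_Integration.integral_norm_bound_integral)
      show "integrable ?M (\<lambda>z. of_real (rho z) * ker p (w + h) z * g z - of_real (rho z) * ker p w z * g z - q h z * g z)"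
        by (intro Bochner_Integration.integrable_diff ib iq wh w)
      show "integrable ?M (\<lambda>z. A * C\<^sup>2 * N * (norm h)\<^sup>2 * cmod (g z))" using g by simp
      fix z assume "z \<in> space ?M"
      then have z: "z \<in> siegel" by simp
      have "cmod (rr (w + h) z - rr w z) \<le> (C * norm h) * cmod (rr w z)"
        using lin[OF z, of h] by (simp add: rr_add mult_ac)
      from npow_second_order_bound[OF Re_rr_pos(1)[OF w z] Re_rr_pos(1)[OF wh z] this h(2), of p] p
      have 1: "cmod (npow p (rr (w + h) z) - npow p (rr w z) + of_real p * npow (p + 1) (rr w z) * rr_lin z h)
        \<le> A * (C * norm h)\<^sup>2 * cmod (rr w z) powr (- p)"
        by (simp add: A_def rr_add)
      have "of_real (rho z) * ker p (w + h) z * g z - of_real (rho z) * ker p w z * g z - q h z * g z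
        = of_real (rho z) * (npow p (rr (w + h) z) - npow p (rr w z) + of_real p * npow (p + 1) (rr w z) * rr_lin z h) * g z"
        by (simp add: q_def ker_npow algebra_simps)
      then have "cmod (of_real (rho z) * ker p (w + h) z * g z - of_real (rho z) * ker p w z * g z - q h z * g z)
        = rho z * cmod (npow p (rr (w + h) z) - npow p (rr w z) + of_real p * npow (p + 1) (rr w z) * rr_lin z h) * cmod (g z)"
        using rho0[OF z] by (simp only: norm_mult norm_of_real abs_of_nonneg)
      also have "\<dots> \<le> rho z * (A * (C * norm h)\<^sup>2 * cmod (rr w z) powr (- p)) * cmod (g z)"
        using 1 rho0[OF z] by (intro mult_right_mono mult_left_mono) auto
      also have "\<dots> = A * (C * norm h)\<^sup>2 * (rho z * cmod (rr w z) powr (- p)) * cmod (g z)" by simp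
      also have "\<dots> \<le> A * (C * norm h)\<^sup>2 * N * cmod (g z)"
        using kN[OF z] p by (intro mult_right_mono mult_left_mono) (auto simp: A_def)
      also have "\<dots> = A * C\<^sup>2 * N * (norm h)\<^sup>2 * cmod (g z)" by (simp add: power_mult_distrib)
      finally show "cmod (of_real (rho z) * ker p (w + h) z * g z - of_real (rho z) * ker p w z * g z - q h z * g z)
        \<le> A * C\<^sup>2 * N * (norm h)\<^sup>2 * cmod (g z)" .
    qed
    also have "\<dots> = A * C\<^sup>2 * N * (norm h)\<^sup>2 * G" by (simp add: G_def)
    finally show ?thesis using b by (simp add: Q_def field_simps)
  qed
  have "((\<lambda>h. norm (g (w + h) - g w - D h) / norm h) \<longlongrightarrow> 0) (at 0)"
  proof (rule Lim_null_comparison)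
    have "((\<lambda>h :: 'n cspace. Q * norm h) \<longlongrightarrow> Q * norm (0 :: 'n cspace)) (at 0)"
      by (intro tendsto_intros)
    then show "((\<lambda>h :: 'n cspace. Q * norm h) \<longlongrightarrow> 0) (at 0)" by simp
    show "\<forall>\<^sub>F h in at 0. norm (norm (g (w + h) - g w - D h) / norm h) \<le> Q * norm h"
      unfolding eventually_at
    proof (intro exI[of _ "min d (1 / (2 * C))"] conjI ballI impI)
      show "0 < min d (1 / (2 * C))" using d C by simp
      fix h :: "'n cspace" assume h: "h \<noteq> 0 \<and> dist h 0 < min d (1 / (2 * C))"
      then have "norm h < d" "C * norm h \<le> 1 / 2" using C by (auto simp: field_simps)
      from est[OF this] h show "norm (norm (g (w + h) - g w - D h) / norm h) \<le> Q * norm h"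
        by (simp add: divide_le_eq power2_eq_square mult.assoc)
    qed
  qed
  then have "(g has_derivative D) (at w)" using bl by (simp add: has_derivative_at)
  then show "\<exists>D. (g has_derivative D) (at w) \<and> (\<forall>c h. D (c *s h) = c * D h)" using Dc by blast
qed

lemma A1_D:
  assumes "g \<in> A1 lam"
  shows "holomorphic_Cn_on g siegel" "integrable (dV lam) g" "z \<notin> siegel \<Longrightarrow> g z = 0"
  using assms by (auto simp: A1_def holo_siegel_def)

text \<open>The last derivative of \<open>kfun s w\<close> is \<open>ker (s + 1) z w\<close>, the
  conjugate of \<open>ker (s + 1) w z\<close>; so the conjugate of the pairing is the reproducing
  formula for \<open>g\<close> at \<open>w\<close>.\<close>

lemma pairing_kfun:
  fixes g :: "'n::{finite,linorder} cspace \<Rightarrow> complex"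
  assumes lam: "lam > - 1" and g: "g \<in> A1 lam" and w: "w \<in> siegel"
  defines "s \<equiv> real CARD('n) + 1 + lam"
  shows "pairing lam (kfun s w) g = of_real (repc TYPE('n) lam) * cnj (g w)"
proof -
  let ?M = "dV lam :: 'n cspace measure"
  have s: "s > 0" using lam by (simp add: s_def)
  have p: "s + 1 = real CARD('n) + 2 + lam" by (simp add: s_def)
  note g' = A1_D[OF g]
  define L where "L = 2 * (rho w / 2) powr (1 - (s + 1))"
  have int: "integrable ?M (\<lambda>z. of_real (rho z) * g z * ker (s + 1) w z)"
  proof (rule Bochner_Integration.integrable_bound[of _ "\<lambda>z. L * cmod (g z)"])
    show "integrable ?M (\<lambda>z. L * cmod (g z))" using g'(2) by simp
    show "(\<lambda>z. of_real (rho z) * g z * ker (s + 1) w z) \<in> borel_measurable ?M"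
      by (intro measurable_dV_continuous continuous_intros holo_siegel_continuous[OF g'(1)] continuous_on_ker(1)[OF w])
    show "AE z in ?M. norm (of_real (rho z) * g z * ker (s + 1) w z) \<le> norm (L * cmod (g z))"
    proof (rule AE_I2)
      fix z assume "z \<in> space ?M"
      then have z: "z \<in> siegel" by simp
      have "rho z * cmod (ker (s + 1) w z) * cmod (g z) \<le> L * cmod (g z)"
        using rho_ker_le[OF z w, of "s + 1"] ker_cnj[OF w z, of "s + 1"] s by (intro mult_right_mono) (auto simp: L_def)
      moreover have "norm (of_real (rho z) * g z * ker (s + 1) w z) = rho z * cmod (ker (s + 1) w z) * cmod (g z)"
        using z by (simp add: norm_mult siegel_def)
      moreover have "L * cmod (g z) \<le> norm (L * cmod (g z))" by (simp only: real_norm_def abs_ge_self)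
      ultimately show "norm (of_real (rho z) * g z * ker (s + 1) w z) \<le> norm (L * cmod (g z))" by linarith
    qed
  qed
  have "(\<integral>z. of_real (rho z) * g z * ker (s + 1) w z \<partial>?M) = of_real (repc TYPE('n) lam) * g w"
    unfolding p
    by (rule reproducing_dV[OF lam w holo_siegel_continuous[OF g'(1)] holo_siegel_along_curves[OF g'(1)]])
       (use int in \<open>simp add: p\<close>)
  then have "cnj (\<integral>z. of_real (rho z) * g z * ker (s + 1) w z \<partial>?M) = of_real (repc TYPE('n) lam) * cnj (g w)"
    by simp
  moreover have "pairing lam (kfun s w) g = (\<integral>z. cnj (of_real (rho z) * g z * ker (s + 1) w z) \<partial>?M)"
    unfolding pairing_def pair_integrand_def
    by (rule Bochner_Integration.integral_cong)
      (auto simp: Lop_last cpartial_last_kfun[OF _ w s] ker_cnj[OF w, of _ "s + 1"])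
  ultimately show ?thesis by (simp only: Bochner_Integration.integral_cnj)
qed

lemma pairing_integrable_bound:
  fixes f g :: "'n::{finite,linorder} cspace \<Rightarrow> complex"
  assumes f: "f \<in> bloch0" and g: "g \<in> A1 lam"
  shows "integrable (dV lam) (pair_integrand f g)"
    and "cmod (pairing lam f g) \<le> A1_norm lam g * bloch_norm f"
proof -
  let ?M = "dV lam :: 'n cspace measure"
  have fb: "f \<in> bloch" using f by (simp add: bloch0_iff)
  have hf: "holomorphic_Cn_on f siegel" using fb by (simp add: bloch_def holo_siegel_def)
  note g' = A1_D[OF g]
  have gi: "integrable ?M (\<lambda>z. bloch_norm f * cmod (g z))" using g'(2) by simp
  have le: "cmod (pair_integrand f g z) \<le> bloch_norm f * cmod (g z)" if z: "z \<in> siegel" for z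
  proof -
    have "rho z * cmod (cpartial last_ix f z) \<le> bloch_norm f"
      using rho_Lop_last_le[OF z] inv_grad_le_bloch_norm[OF fb z] by (rule order_trans)
    then have "rho z * cmod (cpartial last_ix f z) * cmod (g z) \<le> bloch_norm f * cmod (g z)"
      by (rule mult_right_mono) simp
    then show ?thesis using z by (simp add: pair_integrand_def norm_mult Lop_last siegel_def)
  qed
  have "pair_integrand f g \<in> borel_measurable ?M"
    unfolding pair_integrand_def[abs_def]
    by (intro measurable_dV_continuous continuous_intros holo_siegel_continuous[OF g'(1)] continuous_on_Lop[OF hf])
  then show i: "integrable ?M (pair_integrand f g)"
  proof (rule Bochner_Integration.integrable_bound[OF gi])
    show "AE z in ?M. norm (pair_integrand f g z) \<le> norm (bloch_norm f * cmod (g z))"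
      using le bloch_norm_nonneg[OF fb] by (intro AE_I2) simp
  qed
  have "cmod (pairing lam f g) \<le> (\<integral>z. bloch_norm f * cmod (g z) \<partial>?M)"
    unfolding pairing_def by (rule Bochner_Integration.integral_norm_bound_integral[OF i gi]) (simp add: le)
  then show "cmod (pairing lam f g) \<le> A1_norm lam g * bloch_norm f"
    by (simp add: A1_norm_def mult.commute)
qed

lemma pair_functional_bounded:
  fixes g :: "'n::{finite,linorder} cspace \<Rightarrow> complex"
  assumes g: "g \<in> A1 lam"
  shows "bloch0_functional (A1_norm lam g) (pair_functional lam g)"
proof -
  have "pair_functional lam g (\<lambda>z. a * f z + b * h z) = a * pair_functional lam g f + b * pair_functional lam g h"
    if f: "f \<in> bloch0" and h: "h \<in> bloch0" for f h :: "'n cspace \<Rightarrow> complex" and a b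
  proof -
    have hol: "holomorphic_Cn_on f siegel" "holomorphic_Cn_on h siegel"
      using f h by (auto simp: bloch0_iff bloch_def holo_siegel_def)
    have "pairing lam (\<lambda>z. a * f z + b * h z) g = (\<integral>z. a * pair_integrand f g z + b * pair_integrand h g z \<partial>dV lam)"
      unfolding pairing_def
      by (rule Bochner_Integration.integral_cong)
         (auto simp: pair_integrand_def Lop_combine[OF hol] algebra_simps)
    also have "\<dots> = a * pairing lam f g + b * pairing lam h g"
      using pairing_integrable_bound(1)[OF f g] pairing_integrable_bound(1)[OF h g] by (simp add: pairing_def)
    finally show ?thesis using f h bloch0_combine[OF f h] by (simp add: pair_functional_def)
  qed
  moreover have "0 \<le> A1_norm lam g" by (simp add: A1_norm_def)
  ultimately show ?thesis
    using pairing_integrable_bound(2)[OF _ g] by (simp add: bloch0_functional_def pair_functional_def)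
qed

text \<open>Turns the supremum over the unit ball into a bound on all of \<open>bloch0\<close> with
  the best constant; the a priori bound \<open>B\<close> keeps the supremum finite.\<close>

lemma dual_norm_bounds:
  fixes \<Phi> :: "('n::{finite,linorder} cspace \<Rightarrow> complex) \<Rightarrow> complex"
  assumes \<Phi>: "bloch0_functional B \<Phi>"
  shows "dual_norm \<Phi> \<le> B" "bloch0_functional (dual_norm \<Phi>) \<Phi>"
proof -
  have lin: "\<Phi> (\<lambda>z. a * f z + b * g z) = a * \<Phi> f + b * \<Phi> g" if "f \<in> bloch0" "g \<in> bloch0" for f g a b
    using \<Phi> that by (simp add: bloch0_functional_def)
  have bd: "cmod (\<Phi> f) \<le> B * bloch_norm f" if "f \<in> bloch0" for f
    using \<Phi> that by (simp add: bloch0_functional_def)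
  have B: "0 \<le> B" using \<Phi> by (simp add: bloch0_functional_def)
  let ?S = "{f \<in> bloch0. bloch_norm f \<le> 1} :: ('n cspace \<Rightarrow> complex) set"
  have k: "kfun 1 base_pt \<in> (bloch0 :: ('n cspace \<Rightarrow> complex) set)"
    by (rule kfun_bloch0[OF base_pt_in_siegel]) simp
  have zero: "(\<lambda>z. 0) \<in> ?S"
  proof -
    have "(\<lambda>z. 0) \<in> (bloch0 :: ('n cspace \<Rightarrow> complex) set)" using bloch0_combine[OF k k, of 0 0] by simp
    moreover have "bloch_norm (\<lambda>z :: 'n cspace. 0) \<le> 1"
    proof -
      have "kfun 1 base_pt \<in> (bloch :: ('n cspace \<Rightarrow> complex) set)" using k by (simp add: bloch0_iff)
      from bloch_combine(2)[OF this this, of 0 0] show ?thesis by simp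
    qed
    ultimately show ?thesis by simp
  qed
  have le1: "cmod (\<Phi> f) \<le> B" if "f \<in> ?S" for f
    using bd[of f] that B mult_left_mono[of "bloch_norm f" 1 B] by auto
  have bdd: "bdd_above ((\<lambda>f. cmod (\<Phi> f)) ` ?S)" using le1 by (auto intro!: bdd_aboveI)
  show "dual_norm \<Phi> \<le> B" unfolding dual_norm_def using zero le1 by (intro cSUP_least) auto
  have up: "cmod (\<Phi> f) \<le> dual_norm \<Phi>" if "f \<in> ?S" for f
    unfolding dual_norm_def using that bdd by (rule cSUP_upper)
  have "cmod (\<Phi> f) \<le> dual_norm \<Phi> * bloch_norm f" if f: "f \<in> bloch0" for f
  \<comment> \<open>A function of norm 0 cannot be normalised, but the a priori bound already sends
    it to 0.\<close>
  proof (cases "bloch_norm f = 0")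
    case True
    then show ?thesis using bd[OF f] by simp
  next
    case False
    have fb: "f \<in> bloch" using f by (simp add: bloch0_iff)
    define N where "N = bloch_norm f"
    have N: "N > 0" using False bloch_norm_nonneg[OF fb] by (simp add: N_def)
    let ?h = "\<lambda>z. of_real (1 / N) * f z + 0 * f z"
    have "bloch_norm ?h \<le> cmod (of_real (1 / N)) * bloch_norm f + cmod 0 * bloch_norm f"
      by (rule bloch_combine(2)[OF fb fb])
    moreover have "cmod (of_real (1 / N)) * bloch_norm f = 1"
      using N by (simp add: N_def norm_divide)
    ultimately have "bloch_norm ?h \<le> 1" by simp
    then have "?h \<in> ?S" using bloch0_combine[OF f f, of "of_real (1 / N)" 0] by simp
    from up[OF this] lin[OF f f, of "of_real (1 / N)" 0]
    have "cmod (\<Phi> f) / N \<le> dual_norm \<Phi>" using N by (simp add: norm_mult norm_divide)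
    then show ?thesis using N by (simp add: N_def pos_divide_le_eq)
  qed
  moreover have "0 \<le> dual_norm \<Phi>" using up[OF zero] norm_ge_zero order_trans by blast
  ultimately show "bloch0_functional (dual_norm \<Phi>) \<Phi>" using lin by (simp add: bloch0_functional_def)
qed

text \<open>On \<open>kfun s w\<close> the functional takes the value \<open>repc\<close> times
  \<open>cnj (g w)\<close>, so the integral bound for arbitrary functionals reads as a bound for
  \<open>A1_norm\<close>.\<close>

lemma A1_norm_le_dual_norm:
  fixes g :: "'n::{finite,linorder} cspace \<Rightarrow> complex"
  assumes lam: "lam > - 1" and g: "g \<in> A1 lam"
  shows "repc TYPE('n) lam * A1_norm lam g
    \<le> dual_norm (pair_functional lam g) * (bloch_const TYPE('n) * (2 * FRv TYPE('n) lam))"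
proof -
  define s where "s = real CARD('n) + 1 + lam"
  have s: "s > 0" using lam by (simp add: s_def)
  have "(\<integral>w. cmod (pair_functional lam g (kfun s w)) \<partial>dV lam) = (\<integral>w. repc TYPE('n) lam * cmod (g w) \<partial>dV lam)"
  proof (rule Bochner_Integration.integral_cong)
    fix w :: "'n cspace" assume "w \<in> space (dV lam)"
    then have w: "w \<in> siegel" by simp
    have "pair_functional lam g (kfun s w) = of_real (repc TYPE('n) lam) * cnj (g w)"
      using pairing_kfun[OF lam g w] kfun_bloch0[OF w s] by (simp add: pair_functional_def s_def)
    then show "cmod (pair_functional lam g (kfun s w)) = repc TYPE('n) lam * cmod (g w)"
      using repc_pos[OF lam, where 'n = 'n] by (simp add: norm_mult)
  qed simp
  also have "\<dots> = repc TYPE('n) lam * A1_norm lam g" by (simp add: A1_norm_def)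
  finally show ?thesis
    using functional_kfun_L1(2)[OF lam dual_norm_bounds(2)[OF pair_functional_bounded[OF g]]]
    by (simp add: s_def)
qed

lemma bloch0_dual_functional:
  assumes "\<Phi> \<in> bloch0_dual"
  obtains B where "bloch0_functional B \<Phi>"
proof -
  obtain K where K': "\<forall>f\<in>bloch0. cmod (\<Phi> f) \<le> K * bloch_norm f"
    using assms unfolding bloch0_dual_def by blast
  then have K: "cmod (\<Phi> f) \<le> K * bloch_norm f" if "f \<in> bloch0" for f using that by blast
  \<comment> \<open>The constant in \<open>bloch0_dual\<close> has no prescribed sign, hence the
    maximum with 0.\<close>
  have "cmod (\<Phi> f) \<le> max K 0 * bloch_norm f" if f: "f \<in> bloch0" for f
  proof -
    have "K * bloch_norm f \<le> max K 0 * bloch_norm f"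
      using bloch_norm_nonneg[of f] f by (intro mult_right_mono) (auto simp: bloch0_iff)
    then show ?thesis using K[OF f] by linarith
  qed
  then have "bloch0_functional (max K 0) \<Phi>"
    using assms by (auto simp: bloch0_functional_def bloch0_dual_def)
  then show ?thesis using that by blast
qed

lemma functional_is_pairing:
  fixes \<Phi> :: "('n::{finite,linorder} cspace \<Rightarrow> complex) \<Rightarrow> complex"
  assumes lam: "lam > - 1" and \<Phi>: "\<Phi> \<in> bloch0_dual"
  shows "\<exists>g\<in>A1 lam. pair_functional lam g = \<Phi>"
proof -
  let ?M = "dV lam :: 'n cspace measure"
  obtain B where B: "bloch0_functional B \<Phi>" using bloch0_dual_functional[OF \<Phi>] .
  define s where "s = real CARD('n) + 1 + lam"
  have s: "s > 0" using lam by (simp add: s_def)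
  define b where "b = repc TYPE('n) lam"
  have b: "b > 0" unfolding b_def by (rule repc_pos[OF lam])
  define \<gamma> where "\<gamma> w = \<Phi> (kfun s w)" for w
  \<comment> \<open>The conjugate undoes the one in the pairing, and dividing by \<open>b\<close>
    removes the constant of the representation. The value 0 outside the domain is what
    \<open>holo_siegel\<close> demands.\<close>
  define g where "g w = (if w \<in> siegel then cnj (\<gamma> w) / of_real b else 0)" for w
  have i\<gamma>: "integrable ?M \<gamma>" unfolding \<gamma>_def s_def by (rule functional_kfun_L1(1)[OF lam B])
  have gi: "integrable ?M g"
  proof -
    have "integrable ?M (\<lambda>w. cnj (\<gamma> w) / of_real b)" using i\<gamma> b by simp
    then show ?thesis
      by (subst Bochner_Integration.integrable_cong[OF refl, of _ _ "\<lambda>w. cnj (\<gamma> w) / of_real b"]) (simp_all add: g_def)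
  qed
  have rep: "of_real b * \<Phi> f = (\<integral>w. of_real (rho w) * cpartial last_ix f w * \<gamma> w \<partial>?M)" if "f \<in> bloch0" for f
    using functional_representation[OF lam B that] by (simp add: b_def \<gamma>_def s_def)
  \<comment> \<open>The representation of \<open>\<Phi>\<close> applied to \<open>kfun s w\<close>
    and conjugated: \<open>g\<close> reproduces itself, from which its holomorphy follows.\<close>
  have "of_real b * g w = (\<integral>z. of_real (rho z) * g z * ker (s + 1) w z \<partial>?M)" if w: "w \<in> siegel" for w
  proof -
    have "of_real b * \<gamma> w = (\<integral>z. of_real (rho z) * cpartial last_ix (kfun s w) z * \<gamma> z \<partial>?M)"
      using rep[OF kfun_bloch0[OF w s]] by (simp add: \<gamma>_def)
    then have "of_real b * g w = cnj (\<integral>z. of_real (rho z) * cpartial last_ix (kfun s w) z * \<gamma> z \<partial>?M) / of_real b"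
    proof -
      assume "of_real b * \<gamma> w = (\<integral>z. of_real (rho z) * cpartial last_ix (kfun s w) z * \<gamma> z \<partial>?M)"
      from arg_cong[OF this, of cnj]
      have c: "cnj (\<integral>z. of_real (rho z) * cpartial last_ix (kfun s w) z * \<gamma> z \<partial>?M) = of_real b * cnj (\<gamma> w)"
        by simp
      show ?thesis unfolding c using b w by (simp add: g_def)
    qed
    also have "\<dots> = (\<integral>z. cnj (of_real (rho z) * cpartial last_ix (kfun s w) z * \<gamma> z) / of_real b \<partial>?M)"
      by (simp only: Bochner_Integration.integral_cnj integral_divide_zero)
    also have "\<dots> = (\<integral>z. of_real (rho z) * g z * ker (s + 1) w z \<partial>?M)"
      by (rule Bochner_Integration.integral_cong)
        (auto simp: g_def cpartial_last_kfun[OF _ w s] ker_cnj[OF _ w, of _ "s + 1"])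
    finally show ?thesis .
  qed
  then have "holomorphic_Cn_on g siegel"
    using b s by (intro holomorphic_if_reproduced[OF _ _ gi, of "of_real b" "s + 1"]) auto
  then have gA: "g \<in> A1 lam" using gi by (simp add: A1_def holo_siegel_def g_def)
  have "pair_functional lam g f = \<Phi> f" for f
  proof (cases "f \<in> bloch0")
    case True
    have "pairing lam f g = (\<integral>w. (of_real (rho w) * cpartial last_ix f w * \<gamma> w) / of_real b \<partial>?M)"
      unfolding pairing_def pair_integrand_def
      by (rule Bochner_Integration.integral_cong) (auto simp: g_def Lop_last)
    also have "\<dots> = \<Phi> f" using rep[OF True] b by (simp add: field_simps)
    finally show ?thesis using True by (simp add: pair_functional_def)
  next
    case False
    then show ?thesis using \<Phi> by (simp add: pair_functional_def bloch0_dual_def)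
  qed
  then show ?thesis using gA by (intro bexI[of _ g]) auto
qed

theorem theorem1p3:
  fixes lam :: real
  assumes "lam > - 1"
  shows "(\<forall>f\<in>bloch0. \<forall>g\<in>(A1 lam :: ('n::{finite,linorder} cspace \<Rightarrow> complex) set).
            integrable (dV lam) (pair_integrand f g))
    \<and> (\<forall>g\<in>(A1 lam :: ('n cspace \<Rightarrow> complex) set). \<forall>h\<in>A1 lam. \<forall>a b.
            pair_functional lam (\<lambda>z. a * g z + b * h z)
              = (\<lambda>f. cnj a * pair_functional lam g f + cnj b * pair_functional lam h f))
    \<and> bij_betw (pair_functional lam) (A1 lam :: ('n cspace \<Rightarrow> complex) set) bloch0_dual
    \<and> (\<exists>c C. 0 < c \<and> c \<le> C \<and>
          (\<forall>g\<in>(A1 lam :: ('n cspace \<Rightarrow> complex) set).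
             c * A1_norm lam g \<le> dual_norm (pair_functional lam g)
             \<and> dual_norm (pair_functional lam g) \<le> C * A1_norm lam g))"
proof (intro conjI ballI allI)
  note lam = assms
  define s where "s = real CARD('n) + 1 + lam"
  have s: "s > 0" using lam by (simp add: s_def)
  define b where "b = repc TYPE('n) lam"
  have b: "b > 0" unfolding b_def by (rule repc_pos[OF lam])
  show "integrable (dV lam) (pair_integrand f g)"
    if "f \<in> bloch0" "g \<in> A1 lam" for f g :: "'n cspace \<Rightarrow> complex"
    using that by (rule pairing_integrable_bound(1))
  show "pair_functional lam (\<lambda>z. a * g z + b * h z)
      = (\<lambda>f. cnj a * pair_functional lam g f + cnj b * pair_functional lam h f)"
    if g: "g \<in> A1 lam" and h: "h \<in> A1 lam" for g h :: "'n cspace \<Rightarrow> complex" and a b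
  proof
    fix f :: "'n cspace \<Rightarrow> complex"
    show "pair_functional lam (\<lambda>z. a * g z + b * h z) f
      = cnj a * pair_functional lam g f + cnj b * pair_functional lam h f"
    proof (cases "f \<in> bloch0")
      case True
      have "pair_integrand f (\<lambda>z. a * g z + b * h z)
          = (\<lambda>z. cnj a * pair_integrand f g z + cnj b * pair_integrand f h z)"
        by (auto simp: pair_integrand_def algebra_simps)
      then have "pairing lam f (\<lambda>z. a * g z + b * h z) = cnj a * pairing lam f g + cnj b * pairing lam f h"
        using pairing_integrable_bound(1)[OF True g] pairing_integrable_bound(1)[OF True h] by (simp add: pairing_def)
      then show ?thesis using True by (simp add: pair_functional_def)
    qed (simp add: pair_functional_def)
  qed
  show "bij_betw (pair_functional lam) (A1 lam :: ('n cspace \<Rightarrow> complex) set) bloch0_dual"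
    unfolding bij_betw_def
  proof (intro conjI inj_onI set_eqI iffI)
    fix g h :: "'n cspace \<Rightarrow> complex"
    assume g: "g \<in> A1 lam" and h: "h \<in> A1 lam" and eq: "pair_functional lam g = pair_functional lam h"
    show "g = h"
    proof
      fix w :: "'n cspace"
      show "g w = h w"
      proof (cases "w \<in> siegel")
        case True
        \<comment> \<open>Pairing with \<open>kfun s w\<close> recovers the value at
          \<open>w\<close>.\<close>
        have "of_real b * cnj (g w) = of_real b * cnj (h w)"
          using pairing_kfun[OF lam g True] pairing_kfun[OF lam h True] kfun_bloch0[OF True s]
            fun_cong[OF eq, of "kfun s w"] by (simp add: pair_functional_def s_def b_def)
        then show ?thesis using b by simp
      next
        case False
        then show ?thesis using A1_D(3)[OF g] A1_D(3)[OF h] by simp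
      qed
    qed
  next
    fix \<Phi> :: "('n cspace \<Rightarrow> complex) \<Rightarrow> complex"
    assume "\<Phi> \<in> pair_functional lam ` A1 lam"
    then obtain g where g: "g \<in> A1 lam" "\<Phi> = pair_functional lam g" by auto
    show "\<Phi> \<in> bloch0_dual"
      using pair_functional_bounded[OF g(1)] unfolding g(2) bloch0_functional_def bloch0_dual_def
      by (auto simp: pair_functional_def)
  next
    fix \<Phi> :: "('n cspace \<Rightarrow> complex) \<Rightarrow> complex"
    assume "\<Phi> \<in> bloch0_dual"
    then show "\<Phi> \<in> pair_functional lam ` A1 lam" using functional_is_pairing[OF lam] by blast
  qed
  \<comment> \<open>\<open>FRv\<close> is only known to be nonnegative; adding \<open>b\<close>
    keeps \<open>E\<close> positive and makes \<open>b / E\<close> at most the upper constant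
    1.\<close>
  define E where "E = bloch_const TYPE('n) * (2 * FRv TYPE('n) lam) + b"
  have E: "E \<ge> b" using bloch_const_pos[of "TYPE('n)"] FRv_nonneg[OF lam, where 'n = 'n] by (simp add: E_def)
  show "\<exists>c C. 0 < c \<and> c \<le> C \<and>
          (\<forall>g\<in>(A1 lam :: ('n cspace \<Rightarrow> complex) set).
             c * A1_norm lam g \<le> dual_norm (pair_functional lam g)
             \<and> dual_norm (pair_functional lam g) \<le> C * A1_norm lam g)"
  proof (rule exI[of _ "b / E"], rule exI[of _ 1], intro conjI ballI)
    show "0 < b / E" "b / E \<le> 1" using b E by simp_all
    fix g :: "'n cspace \<Rightarrow> complex" assume g: "g \<in> A1 lam"
    note \<Phi> = dual_norm_bounds[OF pair_functional_bounded[OF g]]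
    have d0: "0 \<le> dual_norm (pair_functional lam g)" using \<Phi>(2) by (simp add: bloch0_functional_def)
    show "dual_norm (pair_functional lam g) \<le> 1 * A1_norm lam g" using \<Phi>(1) by simp
    have "b * A1_norm lam g \<le> dual_norm (pair_functional lam g) * (bloch_const TYPE('n) * (2 * FRv TYPE('n) lam))"
      unfolding b_def by (rule A1_norm_le_dual_norm[OF lam g])
    also have "\<dots> \<le> dual_norm (pair_functional lam g) * E"
      using d0 b by (intro mult_left_mono) (auto simp: E_def)
    finally show "b / E * A1_norm lam g \<le> dual_norm (pair_functional lam g)"
      using b E by (simp add: field_simps)
  qed
qed

end
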